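(* Let $f$ be an entire function of order $\rho\in(0,\infty)\setminus\mathbb{N}$. Let $L\in\mathbb{N}$ and $\varepsilon(r)=1/\log^L(r)$. Suppose that all but finitely many zeros of $f$ are contained in $$\{re^{i\theta}\colon r>\exp^L(1),\ |\theta|<\varepsilon(r)\}$$ and that $$|n(r,0)-c\,r^{\rho(r)}|=O\!\left(\varepsilon(r)r^{\rho(r)}\right)$$ as $r\to\infty$ for some $c>0$ and some proximate order $\rho(r)$ satisfying $$\rho'(r)\,r\log r=O(\varepsilon(r))$$ as $r\to\infty$. Then $$\log|f(re^{i\theta})|=c\,\frac{\pi\cos((\theta-\pi)\rho(r))}{\sin\pi\rho(r)}\,r^{\rho(r)}+O\!\left(\sqrt[4]{\varepsilon(r)}\,r^{\rho(r)}\right)$$ as $r\to\infty$, uniformly for $\theta$ satisfying $$\sqrt{\varepsilon(r)}\leq\theta\leq2\pi-\sqrt{\varepsilon(r)}.$$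
   Context: $\log^L$ and $\exp^L$ denote the $L$-th iterates of the logarithm and of the exponential function. $n(r,0)$ is the number of zeros of $f$, counted with multiplicity, in the closed disk of radius $r$ around $0$. A function $\rho(r)$ is a proximate order if it is positive and differentiable for large $r$, $\lim_{r\to\infty}\rho(r)=\rho\in(0,\infty)$, and $\lim_{r\to\infty}\rho'(r)\,r\log r=0$; here the limit $\rho$ is the order of $f$. *)

theory Defs
  imports "HOL-Complex_Analysis.Complex_Analysis" "HOL-Library.Landau_Symbols"
begin

definition max_modulus :: "(complex \<Rightarrow> complex) \<Rightarrow> real \<Rightarrow> real" where
  "max_modulus f r = (SUP z\<in>cball 0 r. norm (f z))"

(* For nonconstant entire f the maximum modulus tends to infinity, so the iterated
   logarithm is only evaluated at positive arguments for large r. *)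
definition entire_order :: "(complex \<Rightarrow> complex) \<Rightarrow> ereal" where
  "entire_order f = Limsup at_top (\<lambda>r. ereal (ln (ln (max_modulus f r)) / ln r))"

(* n(r,0): zorder is the multiplicity of the zero z; the sum is finite unless f = 0. *)
definition zero_count :: "(complex \<Rightarrow> complex) \<Rightarrow> real \<Rightarrow> int" where
  "zero_count f r = (\<Sum>z\<in>{z \<in> cball 0 r. f z = 0}. zorder f z)"

definition proximate_order :: "(real \<Rightarrow> real) \<Rightarrow> real \<Rightarrow> bool" where
  "proximate_order \<sigma> \<rho> \<longleftrightarrow>
     0 < \<rho> \<and>
     (\<forall>\<^sub>F r in at_top. 0 < \<sigma> r \<and> \<sigma> differentiable (at r)) \<and>
     (\<sigma> \<longlongrightarrow> \<rho>) at_top \<and>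
     ((\<lambda>r. deriv \<sigma> r * r * ln r) \<longlongrightarrow> 0) at_top"

definition iter_log_recip :: "nat \<Rightarrow> real \<Rightarrow> real" where
  "iter_log_recip L r = 1 / (ln ^^ L) r"

definition thin_region :: "nat \<Rightarrow> complex set" where
  "thin_region L =
     {of_real r * cis \<theta> | r \<theta>. r > (exp ^^ L) 1 \<and> \<bar>\<theta>\<bar> < iter_log_recip L r}"

end

theory Submission
  imports Defs "HOL-Real_Asymp.Real_Asymp"
begin

text \<open>
  Write \<open>p\<close> for the integer part of \<open>\<rho>\<close>, \<open>V(r)\<close> for \<open>r\<close> to the power \<open>\<sigma>(r)\<close>, and \<open>E\<close> for the Weierstrass
  factor of genus \<open>p\<close>.  The counting hypothesis makes the canonical product of genus \<open>p\<close> over the zeros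
  \<open>a\<^sub>n\<close> converge, so \<open>f(z) = z^m exp(g(z)) \<Prod>E(z/a\<^sub>n)\<close> with \<open>g\<close> entire.

  The order of \<open>f\<close> lies strictly between \<open>p\<close> and \<open>p + 1\<close>, which forces \<open>g\<close> to be a polynomial of degree at
  most \<open>p\<close>: on suitable circles the product is not too small, so \<open>Re g\<close> grows more slowly than the power
  \<open>p + 1\<close>, and the Borel-Caratheodory inequality turns this into a bound for \<open>g\<close> itself
  (\<open>exp_factor_growth\<close>).  Hence \<open>log|f|\<close> equals \<open>\<Sum>log|E(z/a\<^sub>n)|\<close> up to an error that is a smaller power of \<open>r\<close>
  than \<open>V(r)\<close>, whereas \<open>\<epsilon>\<close> decays more slowly than every power.

  The sum is compared with its value for zeros moved to the moduli \<open>|a\<^sub>n|\<close> on the positive axis.  The angular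
  derivative of \<open>log|E(u)|\<close> is at most \<open>|u|^(p+1)/|1-u|\<close>, and \<open>|1-u|\<close> is at least a multiple of
  \<open>sqrt \<epsilon> (1+|u|)\<close> outside the excluded sector.  Zeros of modulus at least \<open>sqrt r\<close> have angles
  \<open>O(\<epsilon>(r))\<close>, and the contribution of the smaller ones is a smaller power of \<open>r\<close>, so the move costs
  \<open>O(sqrt \<epsilon> V)\<close> (\<open>sum_rotation_estimate\<close>).

  For positive zeros, summation by parts writes the sum as an integral of the counting function against an
  explicit kernel (\<open>sums_tail_integrals\<close>).  For fixed \<open>r\<close>, the counting function at \<open>r x\<close> equals
  \<open>c V(r) x^\<sigma>(r)\<close> up to \<open>O(\<epsilon>(r) V(r))\<close> times a fixed sum of two powers of \<open>x\<close>, uniformly in \<open>x\<close>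
  (\<open>counting_comparison\<close>); this is where the rate of decay of \<open>\<sigma>'\<close> enters.  The pure power integrates to the
  cosine over the sine by a classical Stieltjes integral (\<open>power_potential\<close>), and the error integrates to
  \<open>O(\<epsilon> V / sqrt \<epsilon>)\<close> because the kernel is \<open>O(1/sqrt \<epsilon>)\<close> times a fixed integrable function
  (\<open>log_potential_asymp\<close>).  All errors are thus \<open>O(sqrt \<epsilon> V)\<close>, and the square root of \<open>\<epsilon>\<close> is below its
  fourth root.
\<close>

section \<open>Stieltjes integrals on the half-line\<close>

text \<open>
  The substitution \<open>x = t/(1-t)\<close> turns the integral into the Beta integral of \<open>\<alpha>\<close> and \<open>1 - \<alpha>\<close>, which the
  reflection formula evaluates.
\<close>

lemma beta_kernel_integral:
  fixes \<alpha> :: real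
  assumes "0 < \<alpha>" "\<alpha> < 1"
  shows "set_integrable lborel {0<..} (\<lambda>x. x powr (\<alpha> - 1) / (1 + x))"
    and "(LBINT x:{0<..}. x powr (\<alpha> - 1) / (1 + x)) = pi / sin (pi * \<alpha>)"
proof -
  define f where "f = (\<lambda>x::real. x powr (\<alpha> - 1) / (1 + x))"
  define g where "g = (\<lambda>t::real. t / (1 - t))"
  define g' where "g' = (\<lambda>t::real. 1 / (1 - t)^2)"
  have pull: "f (g t) * g' t = t powr (\<alpha> - 1) * (1 - t) powr ((1 - \<alpha>) - 1)"
    if "0 < t" "t < 1" for t
  proof -
    have "1 + g t = 1 / (1 - t)" using that by (simp add: g_def field_simps)
    hence "f (g t) * g' t = t powr (\<alpha> - 1) / (1 - t) powr (\<alpha> - 1) * (1 - t) / (1 - t)^2"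
      using that by (simp add: f_def g_def g'_def powr_divide)
    also have "\<dots> = t powr (\<alpha> - 1) * ((1 - t) powr 1 / ((1 - t) powr (\<alpha> - 1) * (1 - t) powr 2))"
      using that by (simp)
    also have "(1 - t) powr 1 / ((1 - t) powr (\<alpha> - 1) * (1 - t) powr 2) = (1 - t) powr ((1 - \<alpha>) - 1)"
      unfolding powr_add[symmetric] powr_diff[symmetric] by simp
    finally show ?thesis .
  qed
  have e01: "einterval 0 1 = {0::real<..<1}"
    by (auto simp: einterval_def zero_ereal_def one_ereal_def)
  have e0: "einterval 0 \<infinity> = {0::real<..}"
    by (auto simp: einterval_def zero_ereal_def)
  have int0: "set_integrable lborel {0<..<1} (\<lambda>t::real. t powr (\<alpha> - 1) * (1 - t) powr ((1 - \<alpha>) - 1))"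
    by (rule set_integrable_subset[OF integrable_Beta]) (use assms in auto)
  have int1: "set_integrable lborel (einterval 0 1) (\<lambda>t. f (g t) * g' t)"
    unfolding e01
    by (rule iffD1[OF set_integrable_cong int0]) (auto simp: pull)
  have A: "((ereal \<circ> g \<circ> real_of_ereal) \<longlongrightarrow> 0) (at_right 0)"
  proof -
    have "(g \<longlongrightarrow> 0) (at_right 0)" unfolding g_def by real_asymp
    thus ?thesis by (simp add: zero_ereal_def at_right_ereal tendsto_compose_filtermap[symmetric] filterlim_filtermap o_def)
  qed
  have B: "((ereal \<circ> g \<circ> real_of_ereal) \<longlongrightarrow> \<infinity>) (at_left 1)"
  proof -
    have "filterlim g at_top (at_left 1)" unfolding g_def by real_asymp
    thus ?thesis
      by (simp add: one_ereal_def at_left_ereal filterlim_filtermap o_def tendsto_PInfty_eq_at_top)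
  qed
  have deriv: "DERIV g x :> g' x" if "0 < ereal x" "ereal x < 1" for x
    using that unfolding g_def g'_def zero_ereal_def one_ereal_def
    by (auto intro!: derivative_eq_intros simp: field_simps power2_eq_square)
  have contf: "isCont f (g x)" if "0 < ereal x" "ereal x < 1" for x
  proof -
    have "g x > 0" using that by (auto simp: g_def zero_ereal_def one_ereal_def)
    thus ?thesis unfolding f_def by (intro continuous_intros) auto
  qed
  have contg': "isCont g' x" if "0 < ereal x" "ereal x < 1" for x
    using that unfolding g'_def by (intro continuous_intros) (auto simp: one_ereal_def)
  have fnn: "0 \<le> f (g x)" if "0 < ereal x" "ereal x < 1" for x
    using that by (auto simp: f_def g_def zero_ereal_def one_ereal_def intro!: divide_nonneg_nonneg add_nonneg_nonneg)
  have g'nn: "0 \<le> g' x" for x by (simp add: g'_def)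
  have "(0::ereal) < 1" by simp
  note sub = interval_integral_substitution_nonneg[OF this deriv contf contg' fnn g'nn A B int1]
  from sub(1) show "set_integrable lborel {0<..} (\<lambda>x. x powr (\<alpha> - 1) / (1 + x))"
    by (simp add: e0 f_def)
  have "(LBINT x:{0<..}. f x) = (LBINT x=0..1. (f (g x) * g' x))"
    using sub(2) by (simp add: interval_integral_Ioi zero_ereal_def)
  also have "\<dots> = (LBINT x:{0<..<1}. (f (g x) * g' x))"
    by (simp add: interval_lebesgue_integral_def e01[unfolded zero_ereal_def one_ereal_def] zero_ereal_def one_ereal_def)
  also have "\<dots> = (LBINT t:{0<..<1}. t powr (\<alpha> - 1) * (1 - t) powr ((1 - \<alpha>) - 1))"
    by (intro set_lebesgue_integral_cong) (auto simp: pull)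
  also have "\<dots> = integral {0<..<1} (\<lambda>t. t powr (\<alpha> - 1) * (1 - t) powr ((1 - \<alpha>) - 1))"
    by (rule set_borel_integral_eq_integral(2)[OF int0])
  also have "\<dots> = integral {0..1} (\<lambda>t. t powr (\<alpha> - 1) * (1 - t) powr ((1 - \<alpha>) - 1))"
    by (rule integral_open_interval_real[symmetric])
  also have "\<dots> = Beta \<alpha> (1 - \<alpha>)"
    using has_integral_Beta_real[of \<alpha> "1 - \<alpha>"] assms by (auto simp: has_integral_iff)
  also have "\<dots> = pi / sin (pi * \<alpha>)"
  proof -
    have "complex_of_real (Gamma \<alpha> * Gamma (1 - \<alpha>)) = of_real (pi / sin (pi * \<alpha>))"
      using Gamma_reflection_complex[of "of_real \<alpha>"]
      by (simp add: Gamma_complex_of_real[symmetric] sin_of_real[symmetric])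
    hence "Gamma \<alpha> * Gamma (1 - \<alpha>) = pi / sin (pi * \<alpha>)" by (simp only: of_real_eq_iff)
    thus ?thesis by (simp add: Beta_def)
  qed
  finally show "(LBINT x:{0<..}. x powr (\<alpha> - 1) / (1 + x)) = pi / sin (pi * \<alpha>)"
    by (simp add: f_def)
qed

text \<open>
  With \<open>C = cos(\<psi>/2)\<close> the squared norm exceeds \<open>((1+s) C)^2\<close> by exactly \<open>(1-s)^2 (1-C^2)\<close>.
\<close>

lemma norm_add_cis_ge:
  fixes s :: real
  assumes "0 \<le> s"
  shows "(1 + s) * \<bar>cos (\<psi> / 2)\<bar> \<le> norm (of_real s + cis \<psi>)"
proof (rule power2_le_imp_le)
  define C where "C = cos (\<psi> / 2)"
  have c: "cos \<psi> = 2 * C\<^sup>2 - 1" using cos_double_cos[of "\<psi> / 2"] by (simp add: C_def)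
  have C1: "C\<^sup>2 \<le> 1" unfolding C_def by (simp add: abs_square_le_1)
  have "(norm (of_real s + cis \<psi>))\<^sup>2 = (s + cos \<psi>)\<^sup>2 + (sin \<psi>)\<^sup>2"
    by (simp add: cmod_power2)
  also have "\<dots> = s\<^sup>2 + 2 * s * cos \<psi> + ((cos \<psi>)\<^sup>2 + (sin \<psi>)\<^sup>2)"
    by (simp add: power2_eq_square algebra_simps)
  also have "\<dots> = ((1 + s) * C)\<^sup>2 + (1 - s)\<^sup>2 * (1 - C\<^sup>2)"
    unfolding sin_squared_eq c by (simp add: power2_eq_square algebra_simps)
  finally have "(norm (of_real s + cis \<psi>))\<^sup>2 = ((1 + s) * C)\<^sup>2 + (1 - s)\<^sup>2 * (1 - C\<^sup>2)" .
  thus "((1 + s) * \<bar>cos (\<psi> / 2)\<bar>)\<^sup>2 \<le> (norm (of_real s + cis \<psi>))\<^sup>2"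
    using C1 by (simp add: C_def[symmetric] power_mult_distrib)
qed simp

lemma set_integrable_stieltjes_kernel:
  fixes \<alpha> \<psi> :: real
  assumes "0 < \<alpha>" "\<alpha> < 1" "\<bar>\<psi>\<bar> < pi"
  shows "set_integrable lborel {0<..} (\<lambda>x. of_real (x powr (\<alpha> - 1)) / (of_real x + cis \<psi>))"
proof -
  define \<kappa> where "\<kappa> = cos (\<psi> / 2)"
  have \<kappa>: "\<kappa> > 0" unfolding \<kappa>_def using assms by (intro cos_gt_zero_pi) auto
  have "set_integrable lborel {0<..} (\<lambda>x. (1 / \<kappa>) * (x powr (\<alpha> - 1) / (1 + x)))"
    by (intro set_integrable_mult_right beta_kernel_integral assms)
  thus ?thesis
  proof (rule set_integrable_bound)
    show "set_borel_measurable lborel {0<..} (\<lambda>x. complex_of_real (x powr (\<alpha> - 1)) / (of_real x + cis \<psi>))"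
      unfolding set_borel_measurable_def by measurable
    have "norm (complex_of_real (x powr (\<alpha> - 1)) / (of_real x + cis \<psi>))
         \<le> norm (1 / \<kappa> * (x powr (\<alpha> - 1) / (1 + x)))" if "x > 0" for x
    proof -
      have "(1 + x) * \<kappa> \<le> norm (of_real x + cis \<psi>)"
        using norm_add_cis_ge[of x \<psi>] that \<kappa> by (simp add: \<kappa>_def)
      hence "x powr (\<alpha> - 1) / norm (of_real x + cis \<psi>) \<le> x powr (\<alpha> - 1) / ((1 + x) * \<kappa>)"
        using that \<kappa> by (intro divide_left_mono) (auto intro!: mult_pos_pos elim: less_le_trans[rotated])
      thus ?thesis using that \<kappa> by (simp add: norm_divide field_simps)
    qed
    thus "AE x in lborel. x \<in> {0<..} \<longrightarrow> norm (complex_of_real (x powr (\<alpha> - 1)) / (of_real x + cis \<psi>))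
         \<le> norm (1 / \<kappa> * (x powr (\<alpha> - 1) / (1 + x)))" by auto
  qed
qed

lemma has_vector_derivative_quotient:
  fixes f g :: "real \<Rightarrow> complex"
  assumes "(f has_vector_derivative f') (at x within S)" "(g has_vector_derivative g') (at x within S)" "g x \<noteq> 0"
  shows "((\<lambda>x. f x / g x) has_vector_derivative (f' * g x - f x * g') / (g x * g x)) (at x within S)"
proof -
  have "((\<lambda>x. f x / g x) has_derivative (\<lambda>h. (h *\<^sub>R f' * g x - f x * (h *\<^sub>R g')) / (g x * g x))) (at x within S)"
    using assms unfolding has_vector_derivative_def by (intro has_derivative_divide')
  thus ?thesis
    unfolding has_vector_derivative_def by (simp add: scaleR_conv_of_real field_simps)
qed

text \<open>
  Multiplied by \<open>cis ((1-\<alpha>) \<psi>)\<close>, the integral is constant in \<open>\<psi>\<close>: the \<open>\<psi>\<close>-derivative of the integrand is also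
  an \<open>x\<close>-derivative, so for the integral over a compact interval it leaves only boundary terms, and these
  vanish as the interval exhausts the half-line.  At \<open>\<psi> = 0\<close> the value is a Beta integral.
\<close>

lemma LBINT_powr_div_add_cis:
  fixes \<alpha> \<psi> :: real
  assumes \<alpha>: "0 < \<alpha>" "\<alpha> < 1" and \<psi>: "\<bar>\<psi>\<bar> < pi"
  shows "(LBINT x:{0<..}. of_real (x powr (\<alpha> - 1)) / (of_real x + cis \<psi>))
           = of_real (pi / sin (pi * \<alpha>)) * cis ((\<alpha> - 1) * \<psi>)"
proof -
  define \<kappa> where "\<kappa> = cos (\<psi> / 2)"
  have \<kappa>: "\<kappa> > 0" unfolding \<kappa>_def using \<psi> by (intro cos_gt_zero_pi) auto
  define U where "U = closed_segment 0 \<psi>"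
  have U: "\<kappa> \<le> \<bar>cos (t / 2)\<bar>" if "t \<in> U" for t
  proof -
    have "\<bar>t\<bar> \<le> \<bar>\<psi>\<bar>" using that unfolding U_def closed_segment_eq_real_ivl by (auto split: if_splits)
    hence "cos (\<bar>\<psi>\<bar> / 2) \<le> cos (\<bar>t\<bar> / 2)" using \<psi> by (subst cos_mono_le_eq) auto
    moreover have "cos (\<bar>\<psi>\<bar> / 2) = cos (\<psi> / 2)" "cos (\<bar>t\<bar> / 2) = cos (t / 2)"
      by (auto simp: abs_if)
    ultimately show ?thesis unfolding \<kappa>_def by linarith
  qed
  have den: "(1 + x) * \<kappa> \<le> norm (of_real x + cis t)" if "t \<in> U" "x \<ge> 0" for t x
    using norm_add_cis_ge[of x t] U[OF that(1)] that(2)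
    by (smt (verit, best) mult_left_mono)
  have den0: "of_real x + cis t \<noteq> 0" if "t \<in> U" "x > 0" for t x
    using den[OF that(1), of x] that(2) \<kappa> by (smt (verit, best) mult_pos_pos norm_zero)
  \<comment> \<open>\<open>F'\<close> is both the derivative of \<open>F\<close> in the angle and the derivative of \<open>P\<close> in \<open>x\<close>.\<close>
  define F where "F = (\<lambda>t x. cis ((1 - \<alpha>) * t) * of_real (x powr (\<alpha> - 1)) / (of_real x + cis t))"
  define F' where "F' = (\<lambda>t x. \<i> * cis ((1 - \<alpha>) * t) * of_real (x powr (\<alpha> - 1)) *
      (of_real (1 - \<alpha>) / (of_real x + cis t) - cis t / (of_real x + cis t)^2))"
  define P where "P = (\<lambda>t x. - \<i> * cis ((1 - \<alpha>) * t) * of_real (x powr \<alpha>) / (of_real x + cis t))"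
  have dF: "((\<lambda>t. F t x) has_vector_derivative F' t x) (at t within U)" if "t \<in> U" "x > 0" for t x
  proof -
    define k where "k = complex_of_real (1 - \<alpha>)"
    define X where "X = complex_of_real (x powr (\<alpha> - 1))"
    define D where "D = of_real x + cis t"
    have D: "D \<noteq> 0" using den0[OF that] by (simp add: D_def)
    have "((\<lambda>t. cis ((1 - \<alpha>) * t)) has_vector_derivative (1 - \<alpha>) *\<^sub>R (\<i> * cis ((1 - \<alpha>) * t))) (at t within U)"
      unfolding has_vector_derivative_def by (auto intro!: derivative_eq_intros simp: scaleR_conv_of_real)
    hence 1: "((\<lambda>t. cis ((1 - \<alpha>) * t) * X) has_vector_derivative k * (\<i> * cis ((1 - \<alpha>) * t)) * X) (at t within U)"
      by (intro has_vector_derivative_mult_left) (simp add: scaleR_conv_of_real k_def)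
    have 2: "((\<lambda>t. of_real x + cis t) has_vector_derivative \<i> * cis t) (at t within U)"
      unfolding has_vector_derivative_def by (auto intro!: derivative_eq_intros simp: scaleR_conv_of_real)
    have "((\<lambda>t. F t x) has_vector_derivative
       ((k * (\<i> * cis ((1 - \<alpha>) * t)) * X) * D - cis ((1 - \<alpha>) * t) * X * (\<i> * cis t)) / (D * D)) (at t within U)"
      unfolding F_def X_def[symmetric] D_def
      by (intro has_vector_derivative_quotient 1 2 den0 that)
    also have "((k * (\<i> * cis ((1 - \<alpha>) * t)) * X) * D - cis ((1 - \<alpha>) * t) * X * (\<i> * cis t)) / (D * D) = F' t x"
      unfolding F'_def X_def[symmetric] D_def[symmetric] k_def[symmetric]
      using D by (simp add: field_simps power2_eq_square)
    finally show ?thesis .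
  qed
  have dP: "((\<lambda>x. P t x) has_vector_derivative F' t x) (at x within S)" if "t \<in> U" "x > 0" for t x S
  proof -
    define a where "a = complex_of_real \<alpha>"
    define X where "X = complex_of_real (x powr (\<alpha> - 1))"
    define C where "C = cis ((1 - \<alpha>) * t)"
    define D where "D = of_real x + cis t"
    have D: "D \<noteq> 0" using den0[OF that] by (simp add: D_def)
    have c: "cis t = D - of_real x" by (simp add: D_def)
    have pw: "complex_of_real (x powr \<alpha>) = of_real x * X"
      using that(2) by (simp add: X_def powr_diff)
    have "((\<lambda>x. x powr \<alpha>) has_real_derivative \<alpha> * x powr (\<alpha> - 1)) (at x within S)"
      by (rule DERIV_subset[OF has_real_derivative_powr]) (use that(2) in auto)
    hence "((\<lambda>x. complex_of_real (x powr \<alpha>)) has_vector_derivative of_real (\<alpha> * x powr (\<alpha> - 1))) (at x within S)"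
      by (intro has_vector_derivative_of_real) (simp add: has_real_derivative_iff_has_vector_derivative)
    hence 1: "((\<lambda>x. - \<i> * C * complex_of_real (x powr \<alpha>)) has_vector_derivative - \<i> * C * (a * X)) (at x within S)"
      by (intro has_vector_derivative_mult_right) (simp add: a_def X_def)
    have 2: "((\<lambda>x. complex_of_real x + cis t) has_vector_derivative 1) (at x within S)"
      by (auto intro!: derivative_eq_intros)
    have "((\<lambda>x. P t x) has_vector_derivative
       ((- \<i> * C * (a * X)) * D - (- \<i> * C * (of_real x * X)) * 1) / (D * D)) (at x within S)"
      unfolding P_def C_def[symmetric] pw[symmetric] D_def
      by (intro has_vector_derivative_quotient 1 2 den0 that)
    also have "((- \<i> * C * (a * X)) * D - (- \<i> * C * (of_real x * X)) * 1) / (D * D) = F' t x"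
      unfolding F'_def C_def[symmetric] X_def[symmetric] D_def[symmetric] c of_real_diff a_def[symmetric]
      using D by (simp add: field_simps power2_eq_square)
    finally show ?thesis .
  qed
  have bP: "norm (P t x) \<le> x powr \<alpha> / ((1 + x) * \<kappa>)" if "t \<in> U" "x > 0" for t x
    using den[OF that(1), of x] that \<kappa>
    by (auto simp: P_def norm_mult norm_divide intro!: divide_left_mono mult_pos_pos elim: less_le_trans[rotated])
  have main: "norm (integral {a..b} (F \<psi>) - integral {a..b} (F 0))
      \<le> (a powr \<alpha> / ((1 + a) * \<kappa>) + b powr \<alpha> / ((1 + b) * \<kappa>)) * \<bar>\<psi>\<bar>" if "0 < a" "a \<le> b" for a b
  proof -
    have FTC: "(F' t has_integral (P t b - P t a)) {a..b}" if "t \<in> U" for t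
      using \<open>0 < a\<close> \<open>a \<le> b\<close> that by (intro fundamental_theorem_of_calculus dP) auto
    have L: "((\<lambda>t. integral (cbox a b) (F t)) has_vector_derivative integral (cbox a b) (F' t)) (at t within U)" if "t \<in> U" for t
    proof (rule leibniz_rule_vector_derivative)
      show "F t integrable_on cbox a b" if "t \<in> U" for t
        unfolding F_def using that \<open>0 < a\<close> den0[OF that]
        by (intro integrable_continuous continuous_intros) auto
      show "continuous_on (U \<times> cbox a b) (\<lambda>(t, x). F' t x)"
        unfolding F'_def split_beta using \<open>0 < a\<close> den0
        by (intro continuous_intros) (auto simp: o_def)
      show "convex U" by (simp add: U_def)
    qed (use that \<open>0 < a\<close> in \<open>auto intro!: dF\<close>)
    have "((\<lambda>t. integral {a..b} (F t)) has_derivative (\<lambda>h. h *\<^sub>R (P t b - P t a))) (at t within U)" if "t \<in> U" for t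
      using L[OF that] integral_unique[OF FTC[OF that]] by (simp add: has_vector_derivative_def)
    moreover have "onorm (\<lambda>h. h *\<^sub>R (P t b - P t a)) \<le> a powr \<alpha> / ((1 + a) * \<kappa>) + b powr \<alpha> / ((1 + b) * \<kappa>)" if "t \<in> U" for t
    proof -
      have "cmod (P t b - P t a) \<le> a powr \<alpha> / ((1 + a) * \<kappa>) + b powr \<alpha> / ((1 + b) * \<kappa>)"
        using bP[OF that, of a] bP[OF that, of b] norm_triangle_ineq4[of "P t b" "P t a"] \<open>0 < a\<close> \<open>a \<le> b\<close>
        by linarith
      hence "norm (h *\<^sub>R (P t b - P t a)) \<le> (a powr \<alpha> / ((1 + a) * \<kappa>) + b powr \<alpha> / ((1 + b) * \<kappa>)) * norm h" for h
        unfolding norm_scaleR real_norm_def by (subst mult.commute) (rule mult_right_mono, auto)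
      thus ?thesis by (rule onorm_le)
    qed
    ultimately have "norm (integral {a..b} (F \<psi>) - integral {a..b} (F 0))
      \<le> (a powr \<alpha> / ((1 + a) * \<kappa>) + b powr \<alpha> / ((1 + b) * \<kappa>)) * norm (\<psi> - 0)"
      by (intro differentiable_bound[where S = U and f = "\<lambda>t. integral {a..b} (F t)"]) (auto simp: U_def)
    thus ?thesis by simp
  qed
  define A where "A = (\<lambda>n::nat. {1 / real (Suc n) .. real (Suc n)})"
  have UA: "(\<Union>n. A n) = {0<..}"
  proof safe
    fix x :: real assume "x > 0"
    obtain n1 where "inverse (of_nat (Suc n1)) < x" using reals_Archimedean[OF \<open>x > 0\<close>] by auto
    moreover obtain n2 where "x < real n2" using reals_Archimedean2 by auto
    moreover have "1 / real (Suc (max n1 n2)) \<le> 1 / real (Suc n1)"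
      by (intro divide_left_mono) auto
    moreover have "real n2 \<le> real (Suc (max n1 n2))" by simp
    ultimately have "x \<in> A (max n1 n2)"
      by (simp add: A_def inverse_eq_divide)
    thus "x \<in> (\<Union>n. A n)" by auto
  next
    fix x n assume "x \<in> A n"
    thus "0 < x" by (auto simp: A_def elim: less_le_trans[rotated])
  qed
  have incA: "incseq A"
  proof (rule monoI)
    fix m n :: nat assume "m \<le> n"
    hence "1 / real (Suc n) \<le> 1 / real (Suc m)" by (intro divide_left_mono) auto
    thus "A m \<subseteq> A n" using \<open>m \<le> n\<close> by (auto simp: A_def)
  qed
  have int: "set_integrable lborel {0<..} (F t)" if "\<bar>t\<bar> < pi" for t
    using set_integrable_mult_right[of "cis ((1 - \<alpha>) * t)", OF set_integrable_stieltjes_kernel[OF \<alpha> that]]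
    by (simp add: F_def mult_ac)
  have lim: "(\<lambda>n. integral (A n) (F t)) \<longlonglongrightarrow> (LBINT x:{0<..}. F t x)" if "\<bar>t\<bar> < pi" for t
  proof -
    have "(\<lambda>n. LBINT x:A n. F t x) \<longlonglongrightarrow> (LBINT x:(\<Union>n. A n). F t x)"
      using int[OF that] UA incA by (intro set_integral_cont_up) (simp_all, simp add: A_def)
    moreover have "(LBINT x:A n. F t x) = integral (A n) (F t)" for n
    proof (rule set_borel_integral_eq_integral(2)[OF set_integrable_subset[OF int[OF that]]])
      show "A n \<in> sets lborel" by (simp add: A_def)
      show "A n \<subseteq> {0<..}" using UA by blast
    qed
    ultimately show ?thesis by (simp add: UA)
  qed
  define B where "B = (\<lambda>u. u powr \<alpha> / ((1 + u) * \<kappa>))"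
  have "(\<lambda>n. B (1 / real (Suc n))) \<longlonglongrightarrow> 0" "(\<lambda>n. B (real (Suc n))) \<longlonglongrightarrow> 0"
    unfolding B_def using \<alpha> \<kappa> by real_asymp+
  hence "(\<lambda>n. (B (1 / real (Suc n)) + B (real (Suc n))) * \<bar>\<psi>\<bar>) \<longlonglongrightarrow> (0 + 0) * \<bar>\<psi>\<bar>"
    by (intro tendsto_intros)
  hence z: "(\<lambda>n. (B (1 / real (Suc n)) + B (real (Suc n))) * \<bar>\<psi>\<bar>) \<longlonglongrightarrow> 0" by simp
  have "(\<lambda>n. integral (A n) (F \<psi>) - integral (A n) (F 0)) \<longlonglongrightarrow> 0"
  proof (rule Lim_null_comparison[OF always_eventually z], rule allI)
    fix n
    show "norm (integral (A n) (F \<psi>) - integral (A n) (F 0)) \<le> (B (1 / real (Suc n)) + B (real (Suc n))) * \<bar>\<psi>\<bar>"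
      unfolding A_def B_def by (rule main) (auto intro: order.trans[of _ 1])
  qed
  moreover have "(\<lambda>n. integral (A n) (F \<psi>) - integral (A n) (F 0)) \<longlonglongrightarrow> (LBINT x:{0<..}. F \<psi> x) - (LBINT x:{0<..}. F 0 x)"
    using \<psi> by (intro tendsto_diff lim) auto
  ultimately have eq: "(LBINT x:{0<..}. F \<psi> x) = (LBINT x:{0<..}. F 0 x)"
    using LIMSEQ_unique by fastforce
  have "(LBINT x:{0<..}. F 0 x) = (LBINT x:{0<..}. complex_of_real (x powr (\<alpha> - 1) / (1 + x)))"
    by (simp add: F_def add.commute)
  also have "\<dots> = complex_of_real (LBINT x:{0<..}. x powr (\<alpha> - 1) / (1 + x))"
    by (rule set_integral_complex_of_real)
  also have "\<dots> = of_real (pi / sin (pi * \<alpha>))" by (simp only: beta_kernel_integral(2)[OF \<alpha>])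
  finally have 0: "(LBINT x:{0<..}. F 0 x) = of_real (pi / sin (pi * \<alpha>))" .
  have "(LBINT x:{0<..}. F \<psi> x) = cis ((1 - \<alpha>) * \<psi>) * (LBINT x:{0<..}. of_real (x powr (\<alpha> - 1)) / (of_real x + cis \<psi>))"
    unfolding F_def by (simp only: set_integral_mult_right times_divide_eq_right[symmetric])
  hence "cis ((\<alpha> - 1) * \<psi>) * (cis ((1 - \<alpha>) * \<psi>) * (LBINT x:{0<..}. of_real (x powr (\<alpha> - 1)) / (of_real x + cis \<psi>)))
     = cis ((\<alpha> - 1) * \<psi>) * of_real (pi / sin (pi * \<alpha>))"
    using eq 0 by simp
  moreover have "cis ((\<alpha> - 1) * \<psi>) * cis ((1 - \<alpha>) * \<psi>) = 1"
    by (simp add: cis_mult algebra_simps)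
  ultimately show ?thesis by (simp add: mult.assoc[symmetric] mult.commute)
qed

section \<open>Counting functions and summation by parts\<close>

definition counting :: "(nat \<Rightarrow> real) \<Rightarrow> real \<Rightarrow> real" where
  "counting s x = real (card {n. s n \<le> x})"

lemma finite_le_if_at_top:
  fixes s :: "nat \<Rightarrow> real"
  assumes "filterlim s at_top sequentially"
  shows "finite {n. s n \<le> x}"
proof -
  have "eventually (\<lambda>n. s n > x) sequentially"
    using assms by (simp add: filterlim_at_top_dense)
  then obtain N where "\<And>n. n \<ge> N \<Longrightarrow> s n > x" by (auto simp: eventually_sequentially)
  hence "{n. s n \<le> x} \<subseteq> {..<N}" by (force simp: not_le[symmetric])
  thus ?thesis using finite_subset by blast
qed

lemma mono_counting:
  assumes "filterlim s at_top sequentially"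
  shows "mono (counting s)"
  unfolding counting_def
  by (auto intro!: monoI card_mono finite_le_if_at_top assms)

lemma counting_nonneg: "0 \<le> counting s x"
  by (simp add: counting_def)

lemma borel_measurable_counting [measurable]:
  assumes "filterlim s at_top sequentially"
  shows "counting s \<in> borel_measurable borel"
  by (rule borel_measurable_mono[OF mono_counting[OF assms]])

text \<open>
  Summation by parts in integrated form: the indicators of the half-lines \<open>[s\<^sub>n, \<infinity>)\<close> add up to the counting
  function, and the integrability of its product with \<open>h\<close> permits interchanging sum and integral.
\<close>

lemma sums_tail_integrals:
  fixes h :: "real \<Rightarrow> real"
  assumes s: "filterlim s at_top sequentially" "\<And>n. s n > 0"
    and h [measurable]: "h \<in> borel_measurable borel"
    and int: "set_integrable lborel {0<..} (\<lambda>x. counting s x * h x)"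
  shows "set_integrable lborel {s n..} h"
    and "(\<lambda>n. LBINT x:{s n..}. h x) sums (LBINT x:{0<..}. counting s x * h x)"
proof -
  define g where "g = (\<lambda>n x. indicator {s n..} x *\<^sub>R h x)"
  define G where "G = (\<lambda>x. indicator {0<..} x *\<^sub>R (counting s x * h x))"
  have intG: "integrable lborel G" using int by (simp add: set_integrable_def G_def)
  have [measurable]: "g n \<in> borel_measurable lborel" for n unfolding g_def by measurable
  have sums: "(\<lambda>n. F (g n x)) sums (F (G x))" if F: "F = (\<lambda>y. y) \<or> F = (\<lambda>y. \<bar>y\<bar>)" for x and F :: "real \<Rightarrow> real"
  proof -
    have "(\<lambda>n. F (g n x)) sums (\<Sum>n\<in>{n. s n \<le> x}. F (g n x))"
      using F by (intro sums_finite finite_le_if_at_top s) (auto simp: g_def)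
    also have "(\<Sum>n\<in>{n. s n \<le> x}. F (g n x)) = (\<Sum>n\<in>{n. s n \<le> x}. F (h x))"
      by (intro sum.cong) (auto simp: g_def)
    also have "\<dots> = counting s x * F (h x)" by (simp add: counting_def)
    also have "\<dots> = F (G x)"
    proof (cases "x > 0")
      case True thus ?thesis using F by (auto simp: G_def abs_mult counting_def)
    next
      case False
      hence "{n. s n \<le> x} = {}" using s(2) by (force simp: not_le intro: less_le_trans)
      thus ?thesis using False F by (auto simp: G_def counting_def)
    qed
    finally show ?thesis .
  qed
  have sums1: "(\<lambda>n. g n x) sums G x" and sums2: "(\<lambda>n. \<bar>g n x\<bar>) sums \<bar>G x\<bar>" for x
    using sums[of "\<lambda>y. y"] sums[of "\<lambda>y. \<bar>y\<bar>"] by auto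
  have gG: "(\<Sum>i<N. \<bar>g i x\<bar>) \<le> \<bar>G x\<bar>" for N x
    using sum_le_suminf[of "\<lambda>n. \<bar>g n x\<bar>" "{..<N}"] sums2[of x] by (auto simp: sums_iff)
  have intg: "integrable lborel (g n)" for n
  proof (rule Bochner_Integration.integrable_bound[OF intG])
    have "\<bar>g n x\<bar> \<le> (\<Sum>i<Suc n. \<bar>g i x\<bar>)" for x
      by (intro member_le_sum) auto
    also have "\<dots> x \<le> \<bar>G x\<bar>" for x by (rule gG)
    finally show "AE x in lborel. norm (g n x) \<le> norm (G x)" by simp
  qed measurable
  thus "set_integrable lborel {s n..} h" by (simp add: set_integrable_def g_def)
  have "summable (\<lambda>n. \<integral>x. norm (g n x) \<partial>lborel)"
  proof (rule summableI_nonneg_bounded)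
    show "(\<Sum>i<N. \<integral>x. norm (g i x) \<partial>lborel) \<le> (\<integral>x. norm (G x) \<partial>lborel)" for N
    proof -
      have "(\<Sum>i<N. \<integral>x. norm (g i x) \<partial>lborel) = (\<integral>x. (\<Sum>i<N. norm (g i x)) \<partial>lborel)"
        by (rule Bochner_Integration.integral_sum[symmetric]) (intro integrable_norm intg)
      also have "\<dots> \<le> (\<integral>x. norm (G x) \<partial>lborel)"
        using gG by (intro integral_mono Bochner_Integration.integrable_sum integrable_norm intg intG) auto
      finally show ?thesis .
    qed
  qed simp
  hence "(\<lambda>n. integral\<^sup>L lborel (g n)) sums (\<integral>x. (\<Sum>n. g n x) \<partial>lborel)"
    using sums2 by (intro sums_integral intg) (auto simp: sums_iff)
  also have "(\<lambda>x. \<Sum>n. g n x) = G" using sums1 by (auto simp: sums_iff)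
  finally show "(\<lambda>n. LBINT x:{s n..}. h x) sums (LBINT x:{0<..}. counting s x * h x)"
    by (simp add: set_lebesgue_integral_def g_def G_def)
qed

section \<open>Logarithmic derivatives of Weierstrass factors\<close>

lemma has_real_derivative_ln_norm:
  fixes F :: "real \<Rightarrow> complex"
  assumes "(F has_vector_derivative F') (at x within S)" "F x \<noteq> 0"
  shows "((\<lambda>t. ln (norm (F t))) has_real_derivative Re (F' / F x)) (at x within S)"
proof -
  have "((\<lambda>t. norm (F t)) has_derivative (\<lambda>h. (h *\<^sub>R F') \<bullet> sgn (F x))) (at x within S)"
    by (rule has_derivative_compose[OF assms(1)[unfolded has_vector_derivative_def] has_derivative_norm[OF assms(2)]])
  hence "((\<lambda>t. norm (F t)) has_real_derivative (F' \<bullet> sgn (F x))) (at x within S)"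
    unfolding has_field_derivative_def by (simp add: mult_commute_abs)
  hence "((\<lambda>t. ln (norm (F t))) has_real_derivative 1 / norm (F x) * (F' \<bullet> sgn (F x))) (at x within S)"
    using assms(2) by (auto intro!: derivative_eq_intros)
  also have "1 / norm (F x) * (F' \<bullet> sgn (F x)) = Re (F' / F x)"
    unfolding complex_div_cnj[of F' "F x"]
    using assms(2) by (simp add: inner_complex_def sgn_div_norm power2_eq_square field_simps flip: of_real_power of_real_mult)
  finally show ?thesis .
qed

text \<open>
  Differentiating the exponent gives a finite geometric series, which telescopes against \<open>1 - z\<close>.
\<close>

lemma has_field_derivative_weierstrass_factor:
  "(weierstrass_factor p has_field_derivative - (z ^ p) * exp (\<Sum>k=1..p. z ^ k / of_nat k)) (at z)"
proof -
  have g: "(1 - z) * (\<Sum>k=1..p. z ^ (k - 1)) = 1 - z ^ p"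
  proof (induction p)
    case (Suc p)
    have "(\<Sum>k=1..Suc p. z ^ (k - 1)) = (\<Sum>k=1..p. z ^ (k - 1)) + z ^ p" by simp
    thus ?case by (simp only: distrib_left Suc.IH) (simp add: algebra_simps)
  qed simp
  have 1: "((\<lambda>z. \<Sum>k=1..p. z ^ k / of_nat k) has_field_derivative (\<Sum>k=1..p. z ^ (k - 1))) (at z)"
    by (rule DERIV_sum) (auto intro!: derivative_eq_intros)
  have "((\<lambda>z. (1 - z) * exp (\<Sum>k=1..p. z ^ k / of_nat k)) has_field_derivative
     (0 - 1) * exp (\<Sum>k=1..p. z ^ k / of_nat k) + (exp (\<Sum>k=1..p. z ^ k / of_nat k) * (\<Sum>k=1..p. z ^ (k - 1))) * (1 - z)) (at z)"
    by (intro DERIV_mult DERIV_diff DERIV_const DERIV_ident DERIV_chain2[OF DERIV_exp] 1)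
  also have "(0 - 1) * exp (\<Sum>k=1..p. z ^ k / of_nat k) + (exp (\<Sum>k=1..p. z ^ k / of_nat k) * (\<Sum>k=1..p. z ^ (k - 1))) * (1 - z)
    = exp (\<Sum>k=1..p. z ^ k / of_nat k) * ((1 - z) * (\<Sum>k=1..p. z ^ (k - 1)) - 1)"
    by (simp add: algebra_simps)
  also have "\<dots> = - (z ^ p) * exp (\<Sum>k=1..p. z ^ k / of_nat k)"
    unfolding g by simp
  finally show ?thesis unfolding weierstrass_factor_def[abs_def] .
qed

abbreviation log_factor :: "nat \<Rightarrow> complex \<Rightarrow> real" where
  "log_factor p u \<equiv> ln (norm (weierstrass_factor p u))"

lemma has_real_derivative_ln_weierstrass_factor:
  fixes u :: "real \<Rightarrow> complex"
  assumes u: "(u has_vector_derivative u') (at x within S)" and "u x \<noteq> 1"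
  shows "((\<lambda>t. log_factor p (u t)) has_real_derivative
           Re (- u' * u x ^ p / (1 - u x))) (at x within S)"
proof -
  define e where "e = exp (\<Sum>k=1..p. u x ^ k / of_nat k)"
  have "((\<lambda>t. weierstrass_factor p (u t)) has_vector_derivative u' * (- (u x ^ p) * e)) (at x within S)"
    unfolding e_def using field_vector_diff_chain_within[OF u has_field_derivative_at_within[OF has_field_derivative_weierstrass_factor]]
    by (simp add: o_def)
  hence "((\<lambda>t. log_factor p (u t)) has_real_derivative
      Re (u' * (- (u x ^ p) * e) / weierstrass_factor p (u x))) (at x within S)"
    using assms(2) by (intro has_real_derivative_ln_norm) auto
  also have "u' * (- (u x ^ p) * e) / weierstrass_factor p (u x) = - u' * u x ^ p / (1 - u x)"
    unfolding weierstrass_factor_def e_def[symmetric] by (simp add: e_def)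
  finally show ?thesis .
qed

lemma norm_diff_cis_ge:
  assumes "0 \<le> s"
  shows "(1 + s) * \<bar>sin (\<theta> / 2)\<bar> \<le> norm (of_real s - cis \<theta>)"
proof -
  have "cos ((\<theta> - pi) / 2) = sin (\<theta> / 2)"
    by (simp add: diff_divide_distrib cos_diff)
  moreover have "of_real s + cis (\<theta> - pi) = of_real s - cis \<theta>"
    by (simp add: cis_divide[symmetric])
  ultimately show ?thesis using norm_add_cis_ge[OF assms, of "\<theta> - pi"] by simp
qed

lemma norm_one_minus_cis_ge:
  assumes "0 \<le> s"
  shows "(1 + s) * \<bar>sin (\<theta> / 2)\<bar> \<le> norm (1 - of_real s * cis \<theta>)"
proof -
  have "norm (1 - of_real s * cis \<theta>) = norm (cnj (1 - of_real s * cis \<theta>))" by (simp only: complex_mod_cnj)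
  also have "cnj (1 - of_real s * cis \<theta>) = - cis (- \<theta>) * (of_real s - cis \<theta>)"
    using cis_mult[of "- \<theta>" \<theta>] by (simp add: cis_cnj right_diff_distrib mult.commute)
  also have "norm \<dots> = norm (of_real s - cis \<theta>)" by (simp add: norm_mult)
  finally show ?thesis using norm_diff_cis_ge[OF assms] by simp
qed

text \<open>
  Minus the \<open>x\<close>-derivative of \<open>log|E(cis \<theta> / x)|\<close> for the factor \<open>E\<close> of genus \<open>p\<close>; see
  \<open>LBINT_potential_kernel_tail\<close>.
\<close>

definition potential_kernel :: "nat \<Rightarrow> real \<Rightarrow> real \<Rightarrow> real" where
  "potential_kernel p \<theta> x =
     - (x powr - real (Suc p) * Re (cis (real (Suc p) * \<theta>) / (of_real x - cis \<theta>)))"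

lemma borel_measurable_potential_kernel [measurable]:
  "potential_kernel p \<theta> \<in> borel_measurable borel"
  unfolding potential_kernel_def[abs_def] by measurable

lemma potential_kernel_bound:
  assumes "x > 0" "sin (\<theta> / 2) > 0"
  shows "\<bar>potential_kernel p \<theta> x\<bar> \<le> x powr - real (Suc p) / (1 + x) / sin (\<theta> / 2)"
proof -
  have d: "(1 + x) * sin (\<theta> / 2) \<le> norm (of_real x - cis \<theta>)"
    using norm_diff_cis_ge[of x \<theta>] assms by simp
  have pos: "0 < (1 + x) * sin (\<theta> / 2)" using assms by simp
  have "\<bar>Re (cis (real (Suc p) * \<theta>) / (of_real x - cis \<theta>))\<bar> \<le> 1 / norm (of_real x - cis \<theta>)"
    using abs_Re_le_cmod[of "cis (real (Suc p) * \<theta>) / (of_real x - cis \<theta>)"] by (simp add: norm_divide)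
  also have "\<dots> \<le> 1 / ((1 + x) * sin (\<theta> / 2))"
    by (intro divide_left_mono mult_pos_pos less_le_trans[OF pos d] d pos) auto
  finally have "x powr - real (Suc p) * \<bar>Re (cis (real (Suc p) * \<theta>) / (of_real x - cis \<theta>))\<bar>
      \<le> x powr - real (Suc p) * (1 / ((1 + x) * sin (\<theta> / 2)))"
    by (intro mult_left_mono) auto
  thus ?thesis by (simp add: potential_kernel_def abs_mult)
qed

lemma set_integrable_power_kernel:
  fixes a q :: real
  assumes "q < a" "a < q + 1"
  shows "set_integrable lborel {0<..} (\<lambda>x. x powr a * (x powr - (q + 1) / (1 + x)))"
    and "(LBINT x:{0<..}. x powr a * (x powr - (q + 1) / (1 + x))) = pi / sin (pi * (a - q))"
proof -
  have eq: "x powr a * (x powr - (q + 1) / (1 + x)) = x powr ((a - q) - 1) / (1 + x)" for x :: real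
    by (simp add: powr_add[symmetric] algebra_simps)
  show "set_integrable lborel {0<..} (\<lambda>x. x powr a * (x powr - (q + 1) / (1 + x)))"
       "(LBINT x:{0<..}. x powr a * (x powr - (q + 1) / (1 + x))) = pi / sin (pi * (a - q))"
    unfolding eq using beta_kernel_integral[of "a - q"] assms by auto
qed

text \<open>
  This produces the main term.  With \<open>\<alpha> = \<sigma> - p\<close> the integrand is the real part of a unimodular constant times
  the Stieltjes kernel at the angle \<open>\<theta> - \<pi>\<close>; shifting the arguments of cosine and sine by multiples of \<open>\<pi>\<close>
  removes \<open>p\<close> from the result.
\<close>

lemma power_potential:
  fixes \<sigma> :: real
  assumes \<sigma>: "real p < \<sigma>" "\<sigma> < real p + 1" and \<theta>: "0 < \<theta>" "\<theta> < 2 * pi"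
  shows "set_integrable lborel {0<..} (\<lambda>x. x powr \<sigma> * potential_kernel p \<theta> x)"
    and "(LBINT x:{0<..}. x powr \<sigma> * potential_kernel p \<theta> x)
           = pi * cos ((\<theta> - pi) * \<sigma>) / sin (pi * \<sigma>)"
proof -
  define \<alpha> where "\<alpha> = \<sigma> - real p"
  have \<alpha>: "0 < \<alpha>" "\<alpha> < 1" using \<sigma> by (auto simp: \<alpha>_def)
  have \<psi>: "\<bar>\<theta> - pi\<bar> < pi" using \<theta> by auto
  define K where "K = (\<lambda>x. of_real (x powr (\<alpha> - 1)) / (of_real x + cis (\<theta> - pi)))"
  define w where "w = - cis (real (Suc p) * \<theta>)"
  have eq: "x powr \<sigma> * potential_kernel p \<theta> x = Re (w * K x)" for x
  proof -
    have "of_real x + cis (\<theta> - pi) = of_real x - cis \<theta>"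
      by (simp add: cis_divide[symmetric])
    hence "w * K x = of_real (- (x powr (\<alpha> - 1))) * (cis (real (Suc p) * \<theta>) / (of_real x - cis \<theta>))"
      unfolding K_def w_def by simp
    hence "Re (w * K x) = - (x powr (\<alpha> - 1) * Re (cis (real (Suc p) * \<theta>) / (of_real x - cis \<theta>)))"
      by (simp only: Re_complex_of_real times_complex.sel Im_complex_of_real)
    also have "x powr (\<alpha> - 1) = x powr \<sigma> * x powr - real (Suc p)"
      by (simp add: powr_add[symmetric] \<alpha>_def algebra_simps)
    finally show ?thesis by (simp add: potential_kernel_def)
  qed
  have int: "set_integrable lborel {0<..} (\<lambda>x. w * K x)"
    unfolding K_def by (intro set_integrable_mult_right set_integrable_stieltjes_kernel \<alpha> \<psi>)
  show "set_integrable lborel {0<..} (\<lambda>x. x powr \<sigma> * potential_kernel p \<theta> x)"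
    using int unfolding eq set_integrable_def
    by (drule_tac integrable_Re) (simp add: scaleR_conv_of_real)
  have "(LBINT x:{0<..}. x powr \<sigma> * potential_kernel p \<theta> x) = Re (LBINT x:{0<..}. w * K x)"
    using int unfolding eq set_integrable_def set_lebesgue_integral_def
    by (subst integral_Re[symmetric]) auto
  also have "(LBINT x:{0<..}. w * K x) = w * (of_real (pi / sin (pi * \<alpha>)) * cis ((\<alpha> - 1) * (\<theta> - pi)))"
    unfolding set_integral_mult_right by (simp only: K_def LBINT_powr_div_add_cis[OF \<alpha> \<psi>])
  also have "\<dots> = of_real (pi / sin (pi * \<alpha>)) * (- cis (real (Suc p) * \<theta> + (\<alpha> - 1) * (\<theta> - pi)))"
    by (simp only: w_def cis_mult[symmetric]) (simp add: mult_ac)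
  also have "Re \<dots> = pi / sin (pi * \<alpha>) * (- cos (real (Suc p) * \<theta> + (\<alpha> - 1) * (\<theta> - pi)))"
    by simp
  also have "real (Suc p) * \<theta> + (\<alpha> - 1) * (\<theta> - pi) = (\<theta> - pi) * \<sigma> + real (Suc p) * pi"
    by (simp add: \<alpha>_def algebra_simps)
  also have "cos \<dots> = (-1) ^ Suc p * cos ((\<theta> - pi) * \<sigma>)"
    by (simp only: cos_add cos_npi sin_npi) (simp add: mult_ac)
  also have "sin (pi * \<alpha>) = (-1) ^ p * sin (pi * \<sigma>)"
  proof -
    have "pi * \<alpha> = pi * \<sigma> - real p * pi" by (simp add: \<alpha>_def algebra_simps)
    thus ?thesis by (simp only: sin_diff cos_npi sin_npi) (simp add: mult_ac)
  qed
  also have "pi / ((-1) ^ p * sin (pi * \<sigma>)) * - ((-1) ^ Suc p * cos ((\<theta> - pi) * \<sigma>))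
      = pi * cos ((\<theta> - pi) * \<sigma>) / sin (pi * \<sigma>)"
    by (cases "even p") auto
  finally show "(LBINT x:{0<..}. x powr \<sigma> * potential_kernel p \<theta> x)
           = pi * cos ((\<theta> - pi) * \<sigma>) / sin (pi * \<sigma>)" .
qed

text \<open>
  The fundamental theorem of calculus on \<open>[s, \<infinity>)\<close>: the boundary term at infinity vanishes because \<open>E(0) = 1\<close>.
\<close>

lemma LBINT_potential_kernel_tail:
  assumes "s > 0" and \<theta>: "0 < \<theta>" "\<theta> < 2 * pi"
    and int: "set_integrable lborel {s..} (potential_kernel p \<theta>)"
  shows "(LBINT x:{s..}. potential_kernel p \<theta> x) = log_factor p (cis \<theta> / of_real s)"
proof -
  define G where "G = (\<lambda>x. - log_factor p (cis \<theta> / of_real x))"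
  have sin0: "sin (\<theta> / 2) > 0" using \<theta> by (intro sin_gt_zero) auto
  have ne: "of_real x - cis \<theta> \<noteq> 0" if "x > 0" for x
    using norm_diff_cis_ge[of x \<theta>] sin0 that by (auto simp: mult_le_0_iff)
  have dG: "(G has_vector_derivative potential_kernel p \<theta> x) (at x)" if "x > 0" for x
  proof -
    define w where "w = cis \<theta>"
    define X where "X = complex_of_real x"
    have X: "X \<noteq> 0" "X - w \<noteq> 0" using that ne[OF that] by (auto simp: X_def w_def)
    have u: "((\<lambda>x. cis \<theta> / of_real x) has_vector_derivative (0 * X - w * 1) / (X * X)) (at x)"
      unfolding X_def w_def using that
      by (intro has_vector_derivative_quotient) (auto intro!: derivative_eq_intros)
    have deriv: "((\<lambda>t. log_factor p (cis \<theta> / of_real t)) has_real_derivative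
       Re (- ((0 * X - w * 1) / (X * X)) * (w / X) ^ p / (1 - w / X))) (at x)"
      using has_real_derivative_ln_weierstrass_factor[OF u] X by (auto simp: X_def w_def)
    have R: "Re (of_real y * q) = y * Re q" for y q by simp
    note deriv
    also have "- ((0 * X - w * 1) / (X * X)) * (w / X) ^ p / (1 - w / X) = (1 / X ^ Suc p) * (w ^ Suc p / (X - w))"
      using X by (simp add: field_simps power_divide)
    also have "1 / X ^ Suc p = of_real (x powr - real (Suc p))"
      using that by (simp only: powr_minus powr_realpow X_def) (simp add: divide_inverse)
    also have "w ^ Suc p = cis (real (Suc p) * \<theta>)"
      unfolding w_def by (rule Complex.DeMoivre)
    finally have "((\<lambda>t. log_factor p (cis \<theta> / of_real t)) has_real_derivative
       - potential_kernel p \<theta> x) (at x)"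
      by (simp only: R potential_kernel_def X_def w_def minus_minus)
    hence "(G has_real_derivative - (- potential_kernel p \<theta> x)) (at x)"
      unfolding G_def by (rule DERIV_minus)
    thus ?thesis by (simp add: has_real_derivative_iff_has_vector_derivative)
  qed
  have cont: "isCont (potential_kernel p \<theta>) x" if "x > 0" for x
    unfolding potential_kernel_def[abs_def] using that ne[OF that]
    by (intro continuous_intros) auto
  have B: "(G \<longlongrightarrow> 0) at_top"
  proof -
    have "((\<lambda>x. norm (cis \<theta> / complex_of_real x)) \<longlongrightarrow> 0) at_top"
      unfolding norm_divide norm_cis norm_of_real by real_asymp
    hence "((\<lambda>x. cis \<theta> / of_real x) \<longlongrightarrow> 0) at_top"
      by (rule tendsto_norm_zero_cancel)
    hence "((\<lambda>x. weierstrass_factor p (cis \<theta> / of_real x)) \<longlongrightarrow> weierstrass_factor p 0) at_top"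
      by (intro isCont_tendsto_compose[OF DERIV_isCont[OF has_field_derivative_weierstrass_factor]])
    hence "(G \<longlongrightarrow> - ln (norm (1::complex))) at_top"
      unfolding G_def by (intro tendsto_intros) auto
    thus ?thesis by simp
  qed
  have A: "(G \<longlongrightarrow> G s) (at_right s)"
    using has_vector_derivative_continuous[OF dG[OF \<open>s > 0\<close>]]
    unfolding isCont_def by (rule tendsto_within_subset) auto
  have "(LBINT x=ereal s..\<infinity>. potential_kernel p \<theta> x) = 0 - G s"
  proof (rule interval_integral_FTC_integrable[where F = G])
    show "set_integrable lborel (einterval (ereal s) \<infinity>) (potential_kernel p \<theta>)"
      by (rule set_integrable_subset[OF int]) (auto simp: einterval_def)
    show "((G \<circ> real_of_ereal) \<longlongrightarrow> G s) (at_right (ereal s))"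
      using A by (simp add: at_right_ereal filterlim_filtermap o_def)
    show "((G \<circ> real_of_ereal) \<longlongrightarrow> 0) (at_left \<infinity>)"
      using B by (simp add: at_left_PInf filterlim_filtermap o_def)
  qed (use \<open>s > 0\<close> in \<open>auto intro!: dG cont\<close>)
  also have "(LBINT x=ereal s..\<infinity>. potential_kernel p \<theta> x) = (LBINT x:{s<..}. potential_kernel p \<theta> x)"
    by (simp add: interval_integral_Ioi)
  also have "\<dots> = (LBINT x:{s..}. potential_kernel p \<theta> x)"
    unfolding set_lebesgue_integral_def
    by (intro integral_cong_AE AE_I[where N = "{s}"]) (auto simp: indicator_def)
  finally show ?thesis by (simp add: G_def)
qed

section \<open>Kernel sums over sequences of regular growth\<close>

text \<open>
  Already the part of the integral over \<open>[s, 2s]\<close> is this large, as the integrand decreases.  It allows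
  sums of the left-hand side to be controlled by summation by parts.
\<close>

lemma power_kernel_tail_ge:
  fixes s q :: real
  assumes "s > 0" "q \<ge> 0"
    and int: "set_integrable lborel {s..} (\<lambda>x. x powr - (q + 1) / (1 + x))"
  shows "s powr - q / (1 + s) \<le> 2 powr (q + 2) * (LBINT x:{s..}. x powr - (q + 1) / (1 + x))"
proof -
  define J where "J = {s..2 * s}"
  define c where "c = (2 * s) powr - (q + 1) / (1 + 2 * s)"
  have "s * c = (LBINT x:J. c)"
    using assms(1) by (simp add: set_lebesgue_integral_def J_def)
  also have "\<dots> \<le> (LBINT x:J. x powr - (q + 1) / (1 + x))"
  proof (rule set_integral_mono)
    show "c \<le> x powr - (q + 1) / (1 + x)" if "x \<in> J" for x
      unfolding c_def using that assms unfolding J_def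
      by (intro frac_le powr_mono2') auto
    show "set_integrable lborel J (\<lambda>x. x powr - (q + 1) / (1 + x))"
      by (rule set_integrable_subset[OF int]) (auto simp: J_def)
    show "set_integrable lborel J (\<lambda>_. c)"
      unfolding J_def by (intro borel_integrable_atLeastAtMost' continuous_intros)
  qed
  also have "\<dots> \<le> (LBINT x:{s..}. x powr - (q + 1) / (1 + x))"
    unfolding set_lebesgue_integral_def
  proof (rule integral_mono)
    show "integrable lborel (\<lambda>x. indicat_real J x *\<^sub>R (x powr - (q + 1) / (1 + x)))"
      using set_integrable_subset[OF int, of J] by (simp add: set_integrable_def J_def)
    show "integrable lborel (\<lambda>x. indicat_real {s..} x *\<^sub>R (x powr - (q + 1) / (1 + x)))"
      using int by (simp add: set_integrable_def)
    show "indicat_real J x *\<^sub>R (x powr - (q + 1) / (1 + x)) \<le> indicat_real {s..} x *\<^sub>R (x powr - (q + 1) / (1 + x))" for x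
      using assms(1) by (auto simp: J_def indicator_def)
  qed
  finally have le: "s * c \<le> (LBINT x:{s..}. x powr - (q + 1) / (1 + x))" .
  have "s powr - q / (1 + s) \<le> 2 powr (q + 2) * (s * c)"
  proof -
    have "2 powr (q + 2) * (s * c) = s powr - q * 2 / (1 + 2 * s)"
    proof -
      have e1: "(2 * s) powr - (q + 1) = 2 powr - (q + 1) * s powr - (q + 1)"
        using assms(1) by (simp add: powr_mult)
      have e2: "2 powr (q + 2) * 2 powr - (q + 1) = (2::real)"
        by (simp add: powr_add[symmetric])
      have e3: "s * s powr - (q + 1) = s powr - q"
        using assms(1) by (simp add: powr_mult_base)
      have "x * (s * ((y * z) / d)) = (x * y) * (s * z) / d" for x y z d :: real by simp
      thus ?thesis unfolding c_def e1 by (simp only: e2 e3) (simp only: mult.commute)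
    qed
    also have "\<dots> \<ge> s powr - q / (1 + s)"
      using assms(1) by (simp add: field_simps)
    finally show ?thesis by simp
  qed
  also have "\<dots> \<le> 2 powr (q + 2) * (LBINT x:{s..}. x powr - (q + 1) / (1 + x))"
    using le by (intro mult_left_mono) auto
  finally show ?thesis .
qed

lemma power_kernel_dominated_integral:
  fixes R h :: "real \<Rightarrow> real" and a b q M m :: real
  assumes ab: "q < a" "a < q + 1" "q < b" "b < q + 1"
    and [measurable]: "R \<in> borel_measurable borel" "h \<in> borel_measurable borel"
    and R: "\<And>x. x > 0 \<Longrightarrow> \<bar>R x\<bar> \<le> M * (x powr a + x powr b)"
    and h: "\<And>x. x > 0 \<Longrightarrow> \<bar>h x\<bar> \<le> x powr - (q + 1) / (1 + x) / m"
    and "m > 0"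
  shows "set_integrable lborel {0<..} (\<lambda>x. R x * h x)"
    and "\<bar>LBINT x:{0<..}. R x * h x\<bar> \<le> M * (pi / sin (pi * (a - q)) + pi / sin (pi * (b - q))) / m"
proof -
  define D where "D = (\<lambda>x. (M / m) * (x powr a * (x powr - (q + 1) / (1 + x)) + x powr b * (x powr - (q + 1) / (1 + x))))"
  have intD: "set_integrable lborel {0<..} D"
    unfolding D_def using ab by (intro set_integrable_mult_right set_integral_add set_integrable_power_kernel)
  have le: "\<bar>R x * h x\<bar> \<le> D x" if "x > 0" for x
  proof -
    have "\<bar>R x\<bar> * \<bar>h x\<bar> \<le> (M * (x powr a + x powr b)) * (x powr - (q + 1) / (1 + x) / m)"
      using that \<open>m > 0\<close> R[OF that] h[OF that] by (intro mult_mono) (auto intro: order.trans[OF abs_ge_zero])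
    also have "\<dots> = D x"
    proof -
      have "(M * (xa + xb)) * (K / m) = (M / m) * (xa * K + xb * K)" for xa xb K
        by (simp add: algebra_simps add_divide_distrib)
      thus ?thesis by (simp only: D_def)
    qed
    finally show ?thesis by (simp add: abs_mult)
  qed
  show int: "set_integrable lborel {0<..} (\<lambda>x. R x * h x)"
  proof (rule set_integrable_bound[OF intD])
    show "set_borel_measurable lborel {0<..} (\<lambda>x. R x * h x)"
      unfolding set_borel_measurable_def by measurable
    show "AE x in lborel. x \<in> {0<..} \<longrightarrow> norm (R x * h x) \<le> norm (D x)"
      using order.trans[OF le abs_ge_self] by (intro AE_I2 impI) auto
  qed
  have "\<bar>LBINT x:{0<..}. R x * h x\<bar> \<le> (LBINT x:{0<..}. \<bar>R x * h x\<bar>)"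
    using set_integral_norm_bound[OF int] by simp
  also have "\<dots> \<le> (LBINT x:{0<..}. D x)"
    using le by (intro set_integral_mono set_integrable_abs int intD) auto
  also have "\<dots> = (M / m) * ((LBINT x:{0<..}. x powr a * (x powr - (q + 1) / (1 + x))) + (LBINT x:{0<..}. x powr b * (x powr - (q + 1) / (1 + x))))"
    unfolding D_def
    by (simp only: set_integral_mult_right
        set_integral_add(2)[OF set_integrable_power_kernel(1)[OF ab(1,2)] set_integrable_power_kernel(1)[OF ab(3,4)]])
  also have "\<dots> = M * (pi / sin (pi * (a - q)) + pi / sin (pi * (b - q))) / m"
    by (simp only: set_integrable_power_kernel(2)[OF ab(1,2)] set_integrable_power_kernel(2)[OF ab(3,4)]
        times_divide_eq_left)
  finally show "\<bar>LBINT x:{0<..}. R x * h x\<bar> \<le> M * (pi / sin (pi * (a - q)) + pi / sin (pi * (b - q))) / m" .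
qed

text \<open>
  For \<open>a\<close> and \<open>b\<close> between \<open>q\<close> and \<open>q + 1\<close>, the integral of \<open>(x^a + x^b) x^(-q-1) / (1+x)\<close> over the half-line.
\<close>

definition kernel_mass :: "real \<Rightarrow> real \<Rightarrow> real \<Rightarrow> real" where
  "kernel_mass q a b = pi / sin (pi * (a - q)) + pi / sin (pi * (b - q))"

lemma kernel_mass_pos:
  assumes "q < a" "a < q + 1" "q < b" "b < q + 1"
  shows "kernel_mass q a b > 0"
proof -
  have "sin (pi * t) > 0" if "0 < t" "t < 1" for t :: real
    using that by (intro sin_gt_zero) auto
  from this[of "a - q"] this[of "b - q"] show ?thesis
    using assms by (auto simp: kernel_mass_def intro!: add_pos_pos divide_pos_pos)
qed

text \<open>
  By \<open>power_kernel_tail_ge\<close> each term is at most a constant times a tail integral, and these integrals add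
  up to the integral of the counting function against the kernel.
\<close>

lemma sum_power_kernel:
  fixes s :: "nat \<Rightarrow> real" and a b q M :: real
  assumes ab: "q < a" "a < q + 1" "q < b" "b < q + 1" and "q \<ge> 0"
    and s: "filterlim s at_top sequentially" "\<And>n. s n > 0"
    and M: "\<And>x. x > 0 \<Longrightarrow> counting s x \<le> M * (x powr a + x powr b)"
  shows "summable (\<lambda>n. s n powr - q / (1 + s n))"
    and "(\<Sum>n. s n powr - q / (1 + s n)) \<le> 2 powr (q + 2) * kernel_mass q a b * M"
proof -
  define h where "h = (\<lambda>x::real. x powr - (q + 1) / (1 + x))"
  have [measurable]: "h \<in> borel_measurable borel" "counting s \<in> borel_measurable borel"
    unfolding h_def using s(1) by measurable
  have Ms: "\<bar>counting s x\<bar> \<le> M * (x powr a + x powr b)" if "x > 0" for x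
    using M[OF that] by (simp add: counting_nonneg)
  have hb: "\<bar>h x\<bar> \<le> x powr - (q + 1) / (1 + x) / 1" if "x > 0" for x
    using that by (simp add: h_def)
  note dom = power_kernel_dominated_integral[where R = "counting s" and h = h, OF ab _ _ Ms hb zero_less_one]
  have int: "set_integrable lborel {0<..} (\<lambda>x. counting s x * h x)"
    by (rule dom) measurable
  have bound: "\<bar>LBINT x:{0<..}. counting s x * h x\<bar> \<le> M * (pi / sin (pi * (a - q)) + pi / sin (pi * (b - q))) / 1"
    by (rule dom) measurable
  note tails = sums_tail_integrals[OF s _ int]
  have S: "(\<lambda>n. 2 powr (q + 2) * (LBINT x:{s n..}. h x)) sums (2 powr (q + 2) * (LBINT x:{0<..}. counting s x * h x))"
    by (intro sums_mult tails) measurable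
  have le: "s n powr - q / (1 + s n) \<le> 2 powr (q + 2) * (LBINT x:{s n..}. h x)" for n
    unfolding h_def by (intro power_kernel_tail_ge s \<open>q \<ge> 0\<close> tails(1)[unfolded h_def]) measurable
  show summ: "summable (\<lambda>n. s n powr - q / (1 + s n))"
  proof (rule summable_comparison_test'[OF sums_summable[OF S]])
    show "norm (s n powr - q / (1 + s n)) \<le> 2 powr (q + 2) * (LBINT x:{s n..}. h x)" for n
      using le[of n] s(2)[of n] by simp
  qed
  have "(\<Sum>n. s n powr - q / (1 + s n)) \<le> 2 powr (q + 2) * (LBINT x:{0<..}. counting s x * h x)"
    by (rule sums_le[OF le summable_sums[OF summ] S])
  also have "\<dots> \<le> 2 powr (q + 2) * (kernel_mass q a b * M)"
    using bound by (intro mult_left_mono) (auto simp: kernel_mass_def algebra_simps)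
  finally show "(\<Sum>n. s n powr - q / (1 + s n)) \<le> 2 powr (q + 2) * kernel_mass q a b * M"
    by (simp add: mult.assoc)
qed

text \<open>
  Summation by parts represents the sum as the integral of the counting function against the potential
  kernel.  The power \<open>A x^\<sigma>\<close> contributes the main term; the remainder is integrated against the bound
  \<open>x^(-p-1) / ((1+x) sin(\<theta>/2))\<close> of the kernel.
\<close>

lemma log_potential_asymp:
  fixes s :: "nat \<Rightarrow> real" and a b A B \<sigma> \<theta> :: real
  assumes ab: "real p < a" "a < real p + 1" "real p < b" "b < real p + 1"
    and \<sigma>: "real p < \<sigma>" "\<sigma> < real p + 1"
    and s: "filterlim s at_top sequentially" "\<And>n. s n > 0"
    and \<theta>: "0 < \<theta>" "\<theta> < 2 * pi"
    and B: "\<And>x. x > 0 \<Longrightarrow> \<bar>counting s x - A * x powr \<sigma>\<bar> \<le> B * (x powr a + x powr b)"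
  shows "summable (\<lambda>n. log_factor p (cis \<theta> / of_real (s n)))"
    and "\<bar>(\<Sum>n. log_factor p (cis \<theta> / of_real (s n)))
           - A * (pi * cos ((\<theta> - pi) * \<sigma>) / sin (pi * \<sigma>))\<bar>
         \<le> B * kernel_mass (real p) a b / sin (\<theta> / 2)"
proof -
  define h where "h = potential_kernel p \<theta>"
  define R where "R = (\<lambda>x. counting s x - A * x powr \<sigma>)"
  have [measurable]: "h \<in> borel_measurable borel" "R \<in> borel_measurable borel"
    unfolding h_def R_def using borel_measurable_counting[OF s(1)] by measurable
  have sin0: "sin (\<theta> / 2) > 0" using \<theta> by (intro sin_gt_zero) auto
  have hb: "\<bar>h x\<bar> \<le> x powr - (real p + 1) / (1 + x) / sin (\<theta> / 2)" if "x > 0" for x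
    using potential_kernel_bound[OF that sin0, of p] by (simp add: h_def add.commute)
  have RB: "\<bar>R x\<bar> \<le> B * (x powr a + x powr b)" if "x > 0" for x
    unfolding R_def by (rule B[OF that])
  note dom = power_kernel_dominated_integral[where R = R and h = h, OF ab _ _ RB hb sin0]
  have intR: "set_integrable lborel {0<..} (\<lambda>x. R x * h x)"
    by (rule dom) measurable
  have boundR: "\<bar>LBINT x:{0<..}. R x * h x\<bar> \<le> B * kernel_mass (real p) a b / sin (\<theta> / 2)"
    unfolding kernel_mass_def by (rule dom) measurable
  note pw = power_potential[OF \<sigma> \<theta>, folded h_def]
  have eq: "counting s x * h x = A * (x powr \<sigma> * h x) + R x * h x" for x
    by (simp add: R_def algebra_simps)
  have intA: "set_integrable lborel {0<..} (\<lambda>x. A * (x powr \<sigma> * h x))"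
    by (intro set_integrable_mult_right pw)
  have int: "set_integrable lborel {0<..} (\<lambda>x. counting s x * h x)"
    unfolding eq by (intro set_integral_add intA intR)
  have val: "(LBINT x:{0<..}. counting s x * h x) = A * (pi * cos ((\<theta> - pi) * \<sigma>) / sin (pi * \<sigma>)) + (LBINT x:{0<..}. R x * h x)"
    unfolding eq by (subst set_integral_add(2)[OF intA intR]) (simp add: pw)
  note tails = sums_tail_integrals[OF s _ int]
  have "(LBINT x:{s n..}. h x) = log_factor p (cis \<theta> / of_real (s n))" for n
    using tails(1)[of n] unfolding h_def by (intro LBINT_potential_kernel_tail s \<theta>) auto
  hence "(\<lambda>n. log_factor p (cis \<theta> / of_real (s n))) sums
     (A * (pi * cos ((\<theta> - pi) * \<sigma>) / sin (pi * \<sigma>)) + (LBINT x:{0<..}. R x * h x))"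
    using tails(2) unfolding val by simp
  thus "summable (\<lambda>n. log_factor p (cis \<theta> / of_real (s n)))"
    and "\<bar>(\<Sum>n. log_factor p (cis \<theta> / of_real (s n)))
           - A * (pi * cos ((\<theta> - pi) * \<sigma>) / sin (pi * \<sigma>))\<bar>
         \<le> B * kernel_mass (real p) a b / sin (\<theta> / 2)"
    using boundR by (auto simp: sums_iff)
qed

section \<open>Rotation and size of Weierstrass factors\<close>

text \<open>
  Mean value theorem: up to sign, the derivative of \<open>log|E(u)|\<close> along the path is the real part of
  \<open>u' u^p / (1-u)\<close>.
\<close>

lemma ln_weierstrass_factor_path:
  assumes u: "\<And>t. t \<in> closed_segment \<alpha> \<beta> \<Longrightarrow> (u has_vector_derivative u' t) (at t within closed_segment \<alpha> \<beta>)"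
    and B: "\<And>t. t \<in> closed_segment \<alpha> \<beta> \<Longrightarrow> u t \<noteq> 1 \<and> norm (u' t) * norm (u t) ^ p / norm (1 - u t) \<le> B"
  shows "\<bar>log_factor p (u \<alpha>) - log_factor p (u \<beta>)\<bar> \<le> B * \<bar>\<alpha> - \<beta>\<bar>"
  unfolding real_norm_def[symmetric]
proof (rule field_differentiable_bound[where S = "closed_segment \<alpha> \<beta>"])
  fix t assume t: "t \<in> closed_segment \<alpha> \<beta>"
  define D where "D = - u' t * u t ^ p / (1 - u t)"
  show "((\<lambda>t. log_factor p (u t)) has_real_derivative Re D) (at t within closed_segment \<alpha> \<beta>)"
    unfolding D_def using B[OF t] by (intro has_real_derivative_ln_weierstrass_factor u t) simp
  have "norm (Re D) \<le> norm D" unfolding real_norm_def by (rule abs_Re_le_cmod)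
  also have "\<dots> \<le> B"
    using B[OF t] by (simp only: D_def norm_mult norm_divide norm_power norm_minus_cancel)
  finally show "norm (Re D) \<le> B" .
qed auto

lemma ln_weierstrass_factor_rotate:
  assumes "s \<ge> 0" "m > 0"
    and far: "\<And>t. t \<in> closed_segment \<alpha> \<beta> \<Longrightarrow> m * (1 + s) \<le> norm (1 - of_real s * cis t)"
  shows "\<bar>log_factor p (of_real s * cis \<alpha>) - log_factor p (of_real s * cis \<beta>)\<bar>
           \<le> s ^ Suc p / (1 + s) / m * \<bar>\<alpha> - \<beta>\<bar>"
proof (rule ln_weierstrass_factor_path)
  fix t assume t: "t \<in> closed_segment \<alpha> \<beta>"
  show "((\<lambda>t. of_real s * cis t) has_vector_derivative \<i> * (of_real s * cis t)) (at t within closed_segment \<alpha> \<beta>)"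
    unfolding has_vector_derivative_def by (auto intro!: derivative_eq_intros simp: scaleR_conv_of_real)
  have pos: "0 < m * (1 + s)" using assms by simp
  note d = far[OF t]
  have "norm (\<i> * (of_real s * cis t)) * norm (of_real s * cis t) ^ p / norm (1 - of_real s * cis t)
      = s ^ Suc p / norm (1 - of_real s * cis t)"
    using assms(1) by (simp add: norm_mult)
  also have "\<dots> \<le> s ^ Suc p / (m * (1 + s))"
    using assms(1) by (intro divide_left_mono d mult_pos_pos less_le_trans[OF pos d] pos) auto
  also have "\<dots> = s ^ Suc p / (1 + s) / m" by (simp add: mult.commute)
  finally show "of_real s * cis t \<noteq> 1 \<and> norm (\<i> * (of_real s * cis t)) * norm (of_real s * cis t) ^ p / norm (1 - of_real s * cis t)
      \<le> s ^ Suc p / (1 + s) / m"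
    using d pos by auto
qed

lemma inverse_power_kernel:
  assumes "(x::real) > 0"
  shows "(1 / x) ^ Suc p / (1 + 1 / x) = x powr - real p / (1 + x)"
proof -
  have "(1 / x) ^ Suc p = x powr - real p / x"
    using assms by (simp add: powr_minus powr_realpow divide_inverse power_inverse)
  moreover have "y / x / (1 + 1 / x) = y / (1 + x)" for y
    using assms by (simp add: field_simps)
  ultimately show ?thesis by (simp only:)
qed

text \<open>
  On the segment from \<open>u\<close> to \<open>0\<close> one has \<open>|1 - t u| \<ge> 1/2\<close>.
\<close>

lemma ln_weierstrass_factor_small:
  assumes "norm u \<le> 1 / 2"
  shows "\<bar>log_factor p u\<bar> \<le> 2 * norm u ^ Suc p"
proof -
  have "\<bar>log_factor p (of_real 1 * u) - log_factor p (of_real 0 * u)\<bar>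
      \<le> 2 * norm u ^ Suc p * \<bar>1 - 0\<bar>"
  proof (rule ln_weierstrass_factor_path)
    fix t :: real assume t: "t \<in> closed_segment 1 0"
    show "((\<lambda>t. of_real t * u) has_vector_derivative u) (at t within closed_segment 1 0)"
      unfolding has_vector_derivative_def by (auto intro!: derivative_eq_intros simp: scaleR_conv_of_real)
    have tu: "norm (of_real t * u) \<le> norm u"
      using t by (simp add: norm_mult closed_segment_eq_real_ivl mult_left_le_one_le)
    have d: "1 / 2 \<le> norm (1 - of_real t * u)"
      using norm_triangle_ineq2[of 1 "of_real t * u"] tu assms by simp
    have "norm u * norm (of_real t * u) ^ p / norm (1 - of_real t * u) \<le> norm u * norm u ^ p / (1 / 2)"
      using d tu by (intro frac_le mult_left_mono power_mono) auto
    thus "of_real t * u \<noteq> 1 \<and> norm u * norm (of_real t * u) ^ p / norm (1 - of_real t * u) \<le> 2 * norm u ^ Suc p"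
      using d by auto
  qed
  thus ?thesis by simp
qed

lemma ln_weierstrass_factor_ge:
  assumes "1 / 2 \<le> norm u" "u \<noteq> 1"
  shows "ln (norm (1 - u)) - real p * 2 ^ p * norm u ^ p \<le> log_factor p u"
proof -
  define \<Sigma> where "\<Sigma> = (\<Sum>k=1..p. u ^ k / of_nat k)"
  have "norm \<Sigma> \<le> (\<Sum>k=1..p. norm (u ^ k / of_nat k))"
    unfolding \<Sigma>_def by (rule norm_sum)
  also have "\<dots> \<le> (\<Sum>k=1..p. (2 * norm u) ^ p)"
  proof (rule sum_mono)
    fix k assume k: "k \<in> {1..p}"
    have "norm (u ^ k / of_nat k) = norm u ^ k / real k" by (simp add: norm_divide norm_power)
    also have "\<dots> \<le> norm u ^ k / 1" using k by (intro divide_left_mono) auto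
    also have "norm u ^ k / 1 = norm u ^ k" by simp
    also have "\<dots> \<le> (2 * norm u) ^ k" by (rule power_mono) auto
    also have "\<dots> \<le> (2 * norm u) ^ p" using k assms by (intro power_increasing) auto
    finally show "norm (u ^ k / of_nat k) \<le> (2 * norm u) ^ p" .
  qed
  also have "\<dots> = real p * 2 ^ p * norm u ^ p" by (simp add: power_mult_distrib)
  finally have "- (real p * 2 ^ p * norm u ^ p) \<le> Re \<Sigma>"
    using abs_Re_le_cmod[of \<Sigma>] by linarith
  moreover have "log_factor p u = ln (norm (1 - u)) + Re \<Sigma>"
    using assms(2) by (simp add: weierstrass_factor_def \<Sigma>_def norm_mult ln_mult)
  ultimately show ?thesis by simp
qed

text \<open>
  A constant for \<open>ln_weierstrass_factor_lower\<close>, chosen to serve both cases of its proof.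
\<close>

definition factor_loss :: "nat \<Rightarrow> real" where
  "factor_loss p = 3 + 3 * real p * 2 ^ p"

text \<open>
  If \<open>|a| \<ge> 2r\<close>, the factor is close to \<open>1\<close>; otherwise only the linear part \<open>1 - z/a\<close> can make it small.
  Both regimes are expressed through the one kernel that \<open>sum_power_kernel\<close> sums.
\<close>

lemma ln_weierstrass_factor_lower:
  assumes "r > 0" "norm z = r" "a \<noteq> 0" "z \<noteq> a"
  shows "- factor_loss p * ((norm a / r) powr - real p / (1 + norm a / r))
           + (if norm a < 2 * r then min 0 (ln (norm (1 - z / a))) else 0)
         \<le> log_factor p (z / a)"
proof -
  define x where "x = norm a / r"
  have x: "x > 0" using assms by (simp add: x_def)
  define \<kappa> where "\<kappa> = x powr - real p / (1 + x)"
  have u: "norm (z / a) = 1 / x" using assms by (simp add: norm_divide x_def)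
  have xp: "(1 / x) ^ p = x powr - real p"
    using x by (simp add: powr_minus powr_realpow divide_inverse power_inverse)
  have \<kappa>0: "\<kappa> \<ge> 0" using x by (simp add: \<kappa>_def)
  have K: "(1 / x) ^ Suc p / (1 + 1 / x) = \<kappa>" unfolding \<kappa>_def by (rule inverse_power_kernel[OF x])
  show ?thesis
  proof (cases "norm a < 2 * r")
    case False
    hence x2: "x \<ge> 2" using assms by (simp add: x_def field_simps)
    have "\<bar>log_factor p (z / a)\<bar> \<le> 2 * (1 / x) ^ Suc p"
      using ln_weierstrass_factor_small[of "z / a" p] x2 unfolding u by (simp add: field_simps)
    also have "(1 / x) ^ Suc p = \<kappa> * (1 + 1 / x)"
    proof -
      have "1 + 1 / x > 0" using x by (simp add: add_pos_pos)
      hence "1 + 1 / x \<noteq> 0" by simp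
      from iffD1[OF nonzero_divide_eq_eq[OF this] K] show ?thesis .
    qed
    also have "2 * (\<kappa> * (1 + 1 / x)) = 2 * (1 + 1 / x) * \<kappa>" by simp
    also have "\<dots> \<le> 3 * \<kappa>"
    proof (rule mult_right_mono)
      show "2 * (1 + 1 / x) \<le> 3" using x2 by (simp add: field_simps)
    qed (rule \<kappa>0)
    also have "\<dots> \<le> factor_loss p * \<kappa>"
      by (intro mult_right_mono \<kappa>0) (simp add: factor_loss_def)
    finally show ?thesis using False by (simp add: \<kappa>_def x_def)
  next
    case True
    hence x2: "x < 2" using assms by (simp add: x_def field_simps)
    have "x powr - real p = (1 + x) * \<kappa>" using x by (simp add: \<kappa>_def)
    also have "\<dots> \<le> 3 * \<kappa>" using x2 by (intro mult_right_mono \<kappa>0) auto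
    finally have "(real p * 2 ^ p) * x powr - real p \<le> (real p * 2 ^ p) * (3 * \<kappa>)"
      by (intro mult_left_mono) auto
    also have "\<dots> \<le> factor_loss p * \<kappa>"
      using \<kappa>0 by (simp add: factor_loss_def algebra_simps)
    finally have "real p * 2 ^ p * norm (z / a) ^ p \<le> factor_loss p * \<kappa>"
      unfolding u xp .
    moreover have "ln (norm (1 - z / a)) - real p * 2 ^ p * norm (z / a) ^ p \<le> log_factor p (z / a)"
      using assms x2 x by (intro ln_weierstrass_factor_ge) (auto simp: u field_simps)
    ultimately show ?thesis using True by (simp add: \<kappa>_def x_def)
  qed
qed

section \<open>The exponential factor of an entire function of finite order\<close>

text \<open>
  The excluded intervals have total length less than \<open>1\<close>, so they cannot cover \<open>[R, R+1]\<close>.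
\<close>

lemma exists_radius_avoiding_finite:
  fixes T :: "real set"
  assumes "finite T" "card T \<le> N"
  shows "\<exists>r\<in>{R..R+1}. \<forall>t\<in>T. 1 / (2 * (real N + 1)) \<le> \<bar>r - t\<bar>"
proof (rule ccontr)
  define d where "d = 1 / (2 * (real N + 1))"
  have d: "d > 0" by (simp add: d_def)
  assume "\<not> ?thesis"
  hence H: "\<exists>t\<in>T. \<bar>r - t\<bar> < d" if "r \<in> {R..R+1}" for r
    using that unfolding d_def[symmetric] by (meson not_le)
  have "{R..R+1} \<subseteq> (\<Union>t\<in>T. {t - d..t + d})"
  proof
    fix r assume "r \<in> {R..R+1}"
    then obtain t where "t \<in> T" "\<bar>r - t\<bar> < d" using H by blast
    moreover from this have "r \<in> {t - d..t + d}" by auto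
    ultimately show "r \<in> (\<Union>t\<in>T. {t - d..t + d})" by blast
  qed
  hence "measure lborel {R..R+1} \<le> measure lborel (\<Union>t\<in>T. {t - d..t + d})"
    using assms(1) by (intro measure_mono_fmeasurable fmeasurable.finite_UN) (auto simp: fmeasurable_def emeasure_lborel_Icc_eq)
  also have "\<dots> \<le> (\<Sum>t\<in>T. measure lborel {t - d..t + d})"
    using assms(1) by (intro measure_UNION_le) (auto simp: fmeasurable_def emeasure_lborel_Icc_eq)
  also have "\<dots> = real (card T) * (2 * d)" using d by simp
  also have "\<dots> \<le> real N * (2 * d)" using assms(2) d by (intro mult_right_mono) auto
  also have "\<dots> < 1" by (simp add: d_def field_simps)
  finally show False by simp
qed

lemma counting_scale:
  assumes "r > 0"
  shows "counting (\<lambda>n. s n / r) x = counting s (r * x)"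
  using assms by (simp add: counting_def field_simps)

text \<open>
  For \<open>A > 0\<close> the map \<open>h/(2A - h)\<close> sends the half-plane \<open>Re h < A\<close> into the unit disc and fixes \<open>0\<close>, so the
  Schwarz lemma applies to its composition with \<open>h = g - g(0)\<close>, rescaled to the unit disc.
\<close>

lemma Borel_Caratheodory_half:
  assumes g: "g holomorphic_on UNIV" and R: "R > 0"
    and A: "\<And>z. norm z \<le> R \<Longrightarrow> Re (g z) \<le> A" and z: "norm z \<le> R / 2"
  shows "norm (g z - g 0) \<le> 2 * (A - Re (g 0))"
proof (rule field_le_epsilon)
  fix e :: real assume e: "e > 0"
  \<comment> \<open>The extra \<open>e/2\<close> makes the bound strict, also when \<open>g\<close> is constant.\<close>
  define A' where "A' = A - Re (g 0) + e / 2"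
  define h where "h = (\<lambda>w. g (of_real R * w) - g 0)"
  have A0: "A - Re (g 0) \<ge> 0" using A[of 0] R by simp
  hence A': "A' > 0" using e by (simp add: A'_def)
  have Reh: "Re (h w) < A'" if "norm w < 1" for w
  proof -
    have "norm (of_real R * w) \<le> R" using that R by (simp add: norm_mult mult_left_le)
    from A[OF this] show ?thesis using e by (simp add: h_def A'_def)
  qed
  have ne: "2 * of_real A' - h w \<noteq> 0" if "norm w < 1" for w
  proof
    assume "2 * of_real A' - h w = 0"
    hence "Re (2 * of_real A' - h w) = 0" by simp
    thus False using Reh[OF that] A' by simp
  qed
  have less: "norm (h w) < norm (2 * of_real A' - h w)" if "norm w < 1" for w
  proof (rule power2_less_imp_less)
    have "0 < A' * (A' - Re (h w))" using A' Reh[OF that] by simp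
    thus "(norm (h w))\<^sup>2 < (norm (2 * of_real A' - h w))\<^sup>2"
      unfolding cmod_power2 by (simp add: power2_eq_square algebra_simps)
  qed simp
  define \<phi> where "\<phi> = (\<lambda>w. h w / (2 * of_real A' - h w))"
  have holh: "h holomorphic_on ball 0 1"
  proof -
    have "(g \<circ> (\<lambda>w. of_real R * w)) holomorphic_on ball 0 1"
      by (rule holomorphic_on_compose_gen[OF _ g]) (auto intro!: holomorphic_intros)
    thus ?thesis unfolding h_def o_def by (intro holomorphic_intros)
  qed
  define w where "w = z / of_real R"
  have w: "norm w \<le> 1 / 2" using z R by (simp add: w_def norm_divide field_simps)
  have "norm (\<phi> w) \<le> norm w"
  proof (rule Schwarz_Lemma(1))
    show "\<phi> holomorphic_on ball 0 1"
      unfolding \<phi>_def using ne by (intro holomorphic_intros holh) auto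
    show "\<phi> 0 = 0" by (simp add: \<phi>_def h_def)
    show "norm (\<phi> v) < 1" if "norm v < 1" for v
      using less[OF that] ne[OF that] by (simp add: \<phi>_def norm_divide divide_less_eq)
  qed (use w in auto)
  hence "norm (\<phi> w) \<le> 1 / 2" using w by linarith
  hence "norm (h w) / norm (2 * of_real A' - h w) \<le> 1 / 2" by (simp only: \<phi>_def norm_divide)
  moreover have "norm (2 * of_real A' - h w) > 0" using ne[of w] w by simp
  ultimately have "norm (h w) \<le> norm (2 * of_real A' - h w) / 2" by (simp add: field_simps)
  also have "\<dots> \<le> (2 * A' + norm (h w)) / 2"
    using norm_triangle_ineq4[of "2 * of_real A'" "h w"] A' by (simp add: norm_mult)
  finally have "norm (h w) \<le> 2 * A'" by simp
  moreover have "h w = g z - g 0" using R by (simp add: h_def w_def)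
  ultimately show "norm (g z - g 0) \<le> 2 * (A - Re (g 0)) + e" by (simp add: A'_def)
qed

text \<open>
  Borel-Caratheodory bounds \<open>|g|\<close> by the power \<open>q < p + 1\<close>; Liouville's theorem gives degree at most \<open>p + 1\<close>, and
  Cauchy's inequality removes the top coefficient.
\<close>

lemma entire_real_part_growth_imp_polynomial:
  assumes g: "g holomorphic_on UNIV" and q: "0 \<le> q" "q < real p + 1" and "R0 \<ge> 1" "C \<ge> 0"
    and A: "\<And>R z. R \<ge> R0 \<Longrightarrow> norm z \<le> R \<Longrightarrow> Re (g z) \<le> C * R powr q"
  shows "\<exists>C'. \<forall>z. norm z \<ge> 1 \<longrightarrow> norm (g z) \<le> C' * norm z ^ p"
proof -
  define B where "B = 2 * C * 2 powr q + 3 * norm (g 0)"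
  have B0: "B \<ge> 0" using \<open>C \<ge> 0\<close> by (simp add: B_def)
  have gb: "norm (g z) \<le> B * norm z powr q" if z: "norm z \<ge> R0" for z
  proof -
    have z1: "norm z \<ge> 1" using z \<open>R0 \<ge> 1\<close> by simp
    have "norm (g z - g 0) \<le> 2 * (C * (2 * norm z) powr q - Re (g 0))"
      using z z1 by (intro Borel_Caratheodory_half[OF g, of "2 * norm z"] A) auto
    moreover have "norm (g z) \<le> norm (g z - g 0) + norm (g 0)"
      using norm_triangle_ineq[of "g z - g 0" "g 0"] by simp
    moreover have "- Re (g 0) \<le> norm (g 0)" using abs_Re_le_cmod[of "g 0"] by linarith
    ultimately have "norm (g z) \<le> 2 * C * (2 * norm z) powr q + 3 * norm (g 0)" by argo
    also have "\<dots> \<le> 2 * C * (2 * norm z) powr q + 3 * norm (g 0) * norm z powr q"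
      using z1 q ge_one_powr_ge_zero[of "norm z" q] by (simp add: mult_le_cancel_left1)
    also have "\<dots> = B * norm z powr q" using z1 by (simp add: B_def powr_mult algebra_simps)
    finally show ?thesis .
  qed
  have top0: "(deriv ^^ Suc p) g 0 = 0"
  proof -
    have "norm ((deriv ^^ Suc p) g 0) \<le> fact (Suc p) * B * r powr (q - real (Suc p))" if "r \<ge> R0" for r
    proof -
      have r: "r > 0" using that \<open>R0 \<ge> 1\<close> by simp
      have "norm ((deriv ^^ Suc p) g 0) \<le> fact (Suc p) * (B * r powr q) / r ^ Suc p"
      proof (rule Cauchy_inequality)
        show "g holomorphic_on ball 0 r" "continuous_on (cball 0 r) g"
          using g holomorphic_on_subset holomorphic_on_imp_continuous_on by blast+
        show "norm (g x) \<le> B * r powr q" if "norm (0 - x) = r" for x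
          using gb[of x] that \<open>r \<ge> R0\<close> by simp
      qed (rule r)
      also have "\<dots> = fact (Suc p) * B * r powr (q - real (Suc p))"
        using r by (simp only: powr_diff powr_realpow) (simp add: mult.assoc)
      finally show ?thesis .
    qed
    moreover have "((\<lambda>r. fact (Suc p) * B * r powr (q - real (Suc p))) \<longlongrightarrow> fact (Suc p) * B * 0) at_top"
      using q by (intro tendsto_mult tendsto_const tendsto_neg_powr filterlim_ident) auto
    ultimately have "norm ((deriv ^^ Suc p) g 0) \<le> fact (Suc p) * B * 0"
      by (intro tendsto_lowerbound[of _ _ at_top]) (auto intro: eventually_mono[OF eventually_ge_at_top[of R0]])
    thus ?thesis by simp
  qed
  define c where "c = (\<lambda>k. (deriv ^^ k) g 0 / fact k)"
  have poly: "g z = (\<Sum>k\<le>p. c k * z ^ k)" for z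
  proof -
    have "norm (g z) \<le> B * norm z ^ Suc p" if "R0 \<le> norm z" for z
    proof -
      have "norm z powr q \<le> norm z powr real (Suc p)"
        using that \<open>R0 \<ge> 1\<close> q by (intro powr_mono) auto
      also have "\<dots> = norm z ^ Suc p" using that \<open>R0 \<ge> 1\<close> by (subst powr_realpow) auto
      finally show ?thesis using gb[OF that] B0 by (meson mult_left_mono order.trans)
    qed
    from Liouville_polynomial[OF g this, where \<xi> = z] show ?thesis
      using top0 by (simp add: c_def del: funpow.simps)
  qed
  have "norm (g z) \<le> (\<Sum>k\<le>p. norm (c k)) * norm z ^ p" if "norm z \<ge> 1" for z
  proof -
    have "norm (g z) \<le> (\<Sum>k\<le>p. norm (c k * z ^ k))" unfolding poly[of z] by (rule norm_sum)
    also have "\<dots> \<le> (\<Sum>k\<le>p. norm (c k) * norm z ^ p)"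
      using that by (intro sum_mono) (auto simp: norm_mult norm_power intro!: mult_left_mono power_increasing)
    finally show ?thesis by (simp add: sum_distrib_right)
  qed
  thus ?thesis by blast
qed

text \<open>
  On a circle of radius \<open>r\<close> at distance at least \<open>1/(2(N+1))\<close> from the \<open>N\<close> zero moduli up to \<open>2R + 2\<close>, each of the
  linear factors that can be small is at least \<open>1/(4r(N+1))\<close>.  There are at most \<open>N = O(R^b)\<close> of them, and
  the remaining losses add up to \<open>O(R^b)\<close>.
\<close>

lemma partial_canonical_products_lower:
  fixes a :: "nat \<Rightarrow> complex"
  assumes a0: "\<And>n. a n \<noteq> 0" and lim: "filterlim (\<lambda>n. norm (a n)) at_top sequentially"
    and b: "real p < l" "l \<le> b" "b < real p + 1"
    and M1: "\<And>y. y > 0 \<Longrightarrow> counting (\<lambda>n. norm (a n)) y \<le> M1 * (y powr l + y powr b)"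
  shows "\<exists>C\<ge>0. \<forall>R\<ge>1. \<exists>r\<in>{R..R+1}. \<forall>z. norm z = r \<longrightarrow> z \<notin> range a \<and>
      (\<forall>N. - C * (R powr b * (1 + ln R)) \<le> (\<Sum>n<N. log_factor p (z / a n)))"
proof -
  define s where "s = (\<lambda>n. norm (a n))"
  have s0: "s n > 0" for n using a0 by (simp add: s_def)
  define M where "M = 2 * M1"
  have M10: "M1 \<ge> 0" using M1[of 1] counting_nonneg[of "\<lambda>n. norm (a n)" 1] by simp
  hence M0: "M \<ge> 0" by (simp add: M_def)
  have M: "counting (\<lambda>n. norm (a n)) y \<le> M * y powr b" if "y \<ge> 1" for y
  proof -
    have "M1 * (y powr l + y powr b) \<le> M1 * (y powr b + y powr b)"
      using that b M10 by (intro mult_left_mono add_right_mono powr_mono) auto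
    thus ?thesis using M1[of y] that by (simp add: M_def)
  qed
  have b0: "b > 0" using b by linarith
  define K where "K = 2 powr (real p + 2) * kernel_mass (real p) l b"
  have K0: "K \<ge> 0" using kernel_mass_pos[of "real p" l b] b by (simp add: K_def)
  define C2 where "C2 = ln (8 * (M * 4 powr b + 1)) + 1 + b"
  have C20: "C2 \<ge> 0"
  proof -
    have "M * 4 powr b \<ge> 0" using M0 by simp
    hence "ln (8 * (M * 4 powr b + 1)) \<ge> 0" by (intro ln_ge_zero) simp
    thus ?thesis using b0 by (simp add: C2_def)
  qed
  define C where "C = factor_loss p * (K * (M * 2 powr b)) + M * 4 powr b * C2"
  have fl0: "factor_loss p \<ge> 0" by (simp add: factor_loss_def)
  have C0: "C \<ge> 0" using fl0 K0 M0 C20 by (simp add: C_def)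
  have main: "\<exists>r\<in>{R..R+1}. \<forall>z. norm z = r \<longrightarrow> z \<notin> range a \<and>
      (\<forall>N. - C * (R powr b * (1 + ln R)) \<le> (\<Sum>n<N. log_factor p (z / a n)))"
    if R: "R \<ge> 1" for R
  proof -
    \<comment> \<open>Since \<open>r \<le> R + 1\<close>, these indices include all zeros of modulus below \<open>2r\<close>.\<close>
    define J where "J = {n. s n \<le> 2 * R + 2}"
    have finJ: "finite J" unfolding J_def s_def by (rule finite_le_if_at_top[OF lim])
    define N0 where "N0 = card J"
    have "\<exists>r\<in>{R..R+1}. \<forall>t\<in>s ` J. 1 / (2 * (real N0 + 1)) \<le> \<bar>r - t\<bar>"
      unfolding N0_def by (intro exists_radius_avoiding_finite finite_imageI finJ card_image_le)
    then obtain r where r: "r \<in> {R..R+1}" and away: "\<And>t. t \<in> s ` J \<Longrightarrow> 1 / (2 * (real N0 + 1)) \<le> \<bar>r - t\<bar>"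
      by blast
    have rpos: "r \<ge> 1" "r \<le> 2 * R" using r R by auto
    define \<Lambda> where "\<Lambda> = ln (4 * r * (real N0 + 1))"
    have ge1: "4 * r * (real N0 + 1) \<ge> 1"
      using mult_mono[of 1 "4 * r" 1 "real N0 + 1"] rpos by simp
    have \<Lambda>0: "\<Lambda> \<ge> 0" unfolding \<Lambda>_def by (intro ln_ge_zero ge1)
    have N0: "real N0 \<le> M * 4 powr b * R powr b"
    proof -
      have "real N0 = counting (\<lambda>n. norm (a n)) (2 * R + 2)"
        by (simp add: counting_def N0_def J_def s_def)
      also have "\<dots> \<le> M * (2 * R + 2) powr b" using R by (intro M) auto
      also have "\<dots> \<le> M * (4 * R) powr b" using R b0 M0 by (intro mult_left_mono powr_mono2) auto
      finally show ?thesis using R by (simp add: powr_mult)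
    qed
    have \<Lambda>le: "\<Lambda> \<le> C2 * (1 + ln R)"
    proof -
      have Rb: "R powr b \<ge> 1" using R b0 by (intro ge_one_powr_ge_zero) auto
      have P: "M * 4 powr b \<ge> 0" using M0 by simp
      have "real N0 + 1 \<le> (M * 4 powr b + 1) * R powr b"
        using N0 Rb by (simp add: distrib_right)
      hence "4 * r * (real N0 + 1) \<le> (8 * R) * ((M * 4 powr b + 1) * R powr b)"
        using rpos R by (intro mult_mono[of "4 * r" "8 * R"]) auto
      hence "\<Lambda> \<le> ln ((8 * R) * ((M * 4 powr b + 1) * R powr b))"
        unfolding \<Lambda>_def using ge1 by (subst ln_le_cancel_iff) auto
      also have "(8 * R) * ((M * 4 powr b + 1) * R powr b) = (8 * (M * 4 powr b + 1)) * (R * R powr b)"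
        by simp
      also have "ln \<dots> = ln (8 * (M * 4 powr b + 1)) + (1 + b) * ln R"
        using R P by (subst ln_mult) (auto simp: ln_mult ln_powr algebra_simps)
      also have "\<dots> \<le> C2 * 1 + C2 * ln R"
      proof -
        have "ln (8 * (M * 4 powr b + 1)) \<ge> 0" using P by (intro ln_ge_zero) simp
        thus ?thesis using R b0 by (intro add_mono mult_right_mono) (auto simp: C2_def)
      qed
      finally show ?thesis by (simp add: distrib_left)
    qed
    show ?thesis
    proof (intro bexI[of _ r] allI impI conjI)
      fix z :: complex assume z: "norm z = r"
      have ne: "z \<noteq> a n" for n
      proof
        assume "z = a n"
        hence "s n = r" using z by (simp add: s_def)
        hence "r \<in> s ` J" using r R by (force simp: J_def)
        from away[OF this] show False by (simp add: add_nonneg_pos field_simps)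
      qed
      thus "z \<notin> range a" by blast
      fix N
      define \<kappa> where "\<kappa> = (\<lambda>n. (s n / r) powr - real p / (1 + s n / r))"
      have \<kappa>0: "\<kappa> n \<ge> 0" for n using s0[of n] rpos by (simp add: \<kappa>_def)
      have lb: "- factor_loss p * \<kappa> n - (if n \<in> J then \<Lambda> else 0) \<le> log_factor p (z / a n)" for n
      proof -
        have "- factor_loss p * \<kappa> n + (if norm (a n) < 2 * r then min 0 (ln (norm (1 - z / a n))) else 0)
           \<le> log_factor p (z / a n)"
          using ln_weierstrass_factor_lower[OF _ z a0 ne] rpos by (simp add: \<kappa>_def s_def)
        moreover have "- \<Lambda> \<le> min 0 (ln (norm (1 - z / a n)))" "n \<in> J" if *: "norm (a n) < 2 * r"
        proof -
          show nJ: "n \<in> J" using * r by (auto simp: J_def s_def)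
          have "1 / (4 * r * (real N0 + 1)) = (1 / (2 * (real N0 + 1))) / (2 * r)"
            by simp
          also have "\<dots> \<le> \<bar>r - s n\<bar> / s n"
            using away[of "s n"] nJ s0[of n] * by (intro frac_le) (auto simp: s_def)
          also have "\<dots> \<le> norm (a n - z) / s n"
            using norm_triangle_ineq3[of "a n" z] s0[of n] z by (intro divide_right_mono) (auto simp: s_def)
          also have "\<dots> = norm (1 - z / a n)"
            using a0[of n] by (simp add: s_def norm_divide[symmetric] diff_divide_distrib)
          finally have "ln (1 / (4 * r * (real N0 + 1))) \<le> ln (norm (1 - z / a n))"
            using ge1 ne[of n] a0[of n] by (subst ln_le_cancel_iff) auto
          moreover have "ln (1 / (4 * r * (real N0 + 1))) = - \<Lambda>"
            using ge1 by (simp add: \<Lambda>_def ln_div)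
          ultimately show "- \<Lambda> \<le> min 0 (ln (norm (1 - z / a n)))" using \<Lambda>0 by simp
        qed
        ultimately show ?thesis using \<Lambda>0 by (auto split: if_splits)
      qed
      have sumk: "(\<Sum>n<N. \<kappa> n) \<le> K * (M * r powr b)"
      proof -
        have lim': "filterlim (\<lambda>n. s n / r) at_top sequentially"
          unfolding s_def divide_inverse using rpos
          by (intro filterlim_at_top_mult_tendsto_pos[OF tendsto_const _ lim]) auto
        have c: "counting (\<lambda>n. s n / r) x \<le> (M * r powr b) * (x powr l + x powr b)" if "x > 0" for x
        proof -
          have "counting (\<lambda>n. s n / r) x \<le> M1 * ((r * x) powr l + (r * x) powr b)"
            using rpos M1[of "r * x"] that by (simp add: counting_scale s_def)
          also have "\<dots> = M1 * (r powr l * x powr l + r powr b * x powr b)"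
            using rpos that by (simp add: powr_mult)
          also have "\<dots> \<le> M * (r powr b * x powr l + r powr b * x powr b)"
            using rpos b M10 by (intro mult_mono add_right_mono mult_right_mono powr_mono) (auto simp: M_def)
          finally show ?thesis by (simp add: distrib_left)
        qed
        have pos': "s n / r > 0" for n using s0[of n] rpos by simp
        note sp = sum_power_kernel[of "real p" l b, OF _ _ _ _ _ lim' pos' c]
        have "(\<Sum>n<N. \<kappa> n) \<le> (\<Sum>n. \<kappa> n)"
          using sp(1) b \<kappa>0 by (intro sum_le_suminf) (auto simp: \<kappa>_def)
        also have "\<dots> \<le> K * (M * r powr b)"
          using sp(2) b by (simp add: \<kappa>_def K_def)
        finally show ?thesis .
      qed
      have rb: "r powr b \<le> 2 powr b * R powr b"
        using rpos R b0 by (subst powr_mult[symmetric]) (auto intro!: powr_mono2)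
      have "(\<Sum>n<N. (if n \<in> J then \<Lambda> else 0)) \<le> real N0 * \<Lambda>"
      proof -
        have "(\<Sum>n<N. (if n \<in> J then \<Lambda> else 0)) = real (card ({..<N} \<inter> J)) * \<Lambda>"
          by (simp add: sum.If_cases)
        also have "\<dots> \<le> real N0 * \<Lambda>"
          unfolding N0_def using finJ \<Lambda>0 by (intro mult_right_mono) (auto intro!: card_mono)
        finally show ?thesis .
      qed
      also have "\<dots> \<le> (M * 4 powr b * R powr b) * (C2 * (1 + ln R))"
        using N0 \<Lambda>le \<Lambda>0 M0 by (intro mult_mono[of "real N0"]) auto
      finally have S2: "(\<Sum>n<N. (if n \<in> J then \<Lambda> else 0)) \<le> M * 4 powr b * C2 * (R powr b * (1 + ln R))"
        by (simp add: mult_ac)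
      have "factor_loss p * (\<Sum>n<N. \<kappa> n) \<le> factor_loss p * (K * (M * (2 powr b * R powr b)))"
        using sumk rb fl0 K0 M0 by (intro mult_left_mono order.trans[OF sumk]) auto
      also have "\<dots> = factor_loss p * (K * (M * 2 powr b)) * (R powr b * 1)" by simp
      also have "\<dots> \<le> factor_loss p * (K * (M * 2 powr b)) * (R powr b * (1 + ln R))"
        using R fl0 K0 M0 by (intro mult_left_mono) auto
      finally have S1: "factor_loss p * (\<Sum>n<N. \<kappa> n) \<le> factor_loss p * (K * (M * 2 powr b)) * (R powr b * (1 + ln R))" .
      have "- C * (R powr b * (1 + ln R)) \<le> - factor_loss p * (\<Sum>n<N. \<kappa> n) - (\<Sum>n<N. (if n \<in> J then \<Lambda> else 0))"
      proof -
        have "C * X = factor_loss p * (K * (M * 2 powr b)) * X + M * 4 powr b * C2 * X" for X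
          unfolding C_def by (rule distrib_right)
        thus ?thesis unfolding mult_minus_left using add_mono[OF S1 S2] by simp
      qed
      also have "\<dots> = (\<Sum>n<N. - factor_loss p * \<kappa> n - (if n \<in> J then \<Lambda> else 0))"
        by (simp add: sum_subtractf sum_distrib_left sum_negf)
      also have "\<dots> \<le> (\<Sum>n<N. log_factor p (z / a n))"
        by (intro sum_mono lb)
      finally show "- C * (R powr b * (1 + ln R)) \<le> (\<Sum>n<N. log_factor p (z / a n))" .
    qed (use r in auto)
  qed
  show ?thesis using C0 main by blast
qed

text \<open>
  The degree bound in Hadamard's theorem.  On the good circles, \<open>Re g\<close> is at most \<open>log|f|\<close> minus the logarithm
  of the product, hence \<open>O(R^q)\<close> for some \<open>q < p + 1\<close>; the maximum principle extends this to the discs.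
\<close>

lemma exp_factor_growth:
  fixes a :: "nat \<Rightarrow> complex"
  assumes f: "\<And>z. f z = z ^ m * exp (g z) * P z" and g: "g holomorphic_on UNIV"
    and P: "\<And>z. (\<lambda>N. \<Prod>n<N. weierstrass_factor p (z / a n)) \<longlonglongrightarrow> P z"
    and a0: "\<And>n. a n \<noteq> 0" and lim: "filterlim (\<lambda>n. norm (a n)) at_top sequentially"
    and b: "real p < l" "l \<le> b" "b < real p + 1"
    and M: "\<And>y. y > 0 \<Longrightarrow> counting (\<lambda>n. norm (a n)) y \<le> M * (y powr l + y powr b)"
    and growth: "\<forall>\<^sub>F r in at_top. \<forall>z. norm z = r \<longrightarrow> norm (f z) \<le> exp (r powr b)"
  shows "\<exists>C. \<forall>z. norm z \<ge> 1 \<longrightarrow> norm (g z) \<le> C * norm z ^ p"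
proof -
  obtain C where C: "C \<ge> 0" and low: "\<And>R. R \<ge> 1 \<Longrightarrow> \<exists>r\<in>{R..R+1}. \<forall>z. norm z = r \<longrightarrow> z \<notin> range a \<and>
      (\<forall>N. - C * (R powr b * (1 + ln R)) \<le> (\<Sum>n<N. log_factor p (z / a n)))"
    using partial_canonical_products_lower[OF a0 lim b M] by blast
  obtain R1 where R1: "\<And>r z. r \<ge> R1 \<Longrightarrow> norm z = r \<Longrightarrow> norm (f z) \<le> exp (r powr b)"
    using growth by (auto simp: eventually_at_top_linorder)
  \<comment> \<open>Any exponent strictly between \<open>b\<close> and \<open>p + 1\<close> absorbs the logarithm in the lower bound of the product.\<close>
  define q where "q = (b + real p + 1) / 2"
  have q: "b < q" "q < real p + 1" "q \<ge> 0" using b by (auto simp: q_def)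
  have "((\<lambda>R. (R powr b * (1 + ln R)) / R powr q) \<longlongrightarrow> 0) at_top"
    using q by real_asymp
  hence "\<forall>\<^sub>F R in at_top. (R powr b * (1 + ln R)) / R powr q < 1"
    by (rule order_tendstoD) simp
  then obtain R2 where R2: "\<And>R. R \<ge> R2 \<Longrightarrow> (R powr b * (1 + ln R)) / R powr q < 1"
    by (auto simp: eventually_at_top_linorder)
  define R0 where "R0 = max 1 (max R1 R2)"
  have Re: "Re (g z) \<le> (2 powr b + C) * R powr q" if R: "R \<ge> R0" and z: "norm z \<le> R" for R z
  proof -
    have R': "R \<ge> 1" "R \<ge> R1" "R \<ge> R2" using R by (auto simp: R0_def)
    from low[OF R'(1)] obtain r where r: "r \<in> {R..R+1}"
      and lr: "\<And>w. norm w = r \<Longrightarrow> w \<notin> range a"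
      and ls: "\<And>w N. norm w = r \<Longrightarrow> - C * (R powr b * (1 + ln R)) \<le> (\<Sum>n<N. log_factor p (w / a n))"
      by blast
    define L where "L = C * (R powr b * (1 + ln R))"
    have Lq: "L \<le> C * R powr q"
      unfolding L_def using R2[OF R'(3)] R' C by (intro mult_left_mono) (auto simp: divide_less_eq)
    have rb: "r powr b \<le> 2 powr b * R powr q"
    proof -
      have "r powr b \<le> (2 * R) powr b" using r R' b by (intro powr_mono2) auto
      also have "\<dots> = 2 powr b * R powr b" using R' by (simp add: powr_mult)
      also have "\<dots> \<le> 2 powr b * R powr q" using R' q by (intro mult_left_mono powr_mono) auto
      finally show ?thesis .
    qed
    have circ: "Re (g w) \<le> (2 powr b + C) * R powr q" if w: "norm w = r" for w
    proof -
      have "exp (- L) \<le> norm (\<Prod>n<N. weierstrass_factor p (w / a n))" for N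
      proof -
        have nz: "norm (weierstrass_factor p (w / a n)) > 0" for n
          using lr[OF w] a0[of n] by auto
        have "exp (- L) \<le> exp (\<Sum>n<N. log_factor p (w / a n))"
          using ls[OF w, of N] by (simp add: L_def)
        also have "\<dots> = (\<Prod>n<N. norm (weierstrass_factor p (w / a n)))"
          using nz by (simp add: exp_sum)
        finally show ?thesis by (simp add: prod_norm)
      qed
      hence PL: "exp (- L) \<le> norm (P w)"
        by (intro tendsto_lowerbound[OF tendsto_norm[OF P]]) auto
      have "exp (Re (g w)) * exp (- L) \<le> exp (Re (g w)) * (r ^ m * norm (P w))"
      proof (rule mult_left_mono)
        have "1 * exp (- L) \<le> r ^ m * norm (P w)"
          using r R' PL by (intro mult_mono one_le_power) auto
        thus "exp (- L) \<le> r ^ m * norm (P w)" by simp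
      qed simp
      also have "\<dots> = norm (f w)" by (simp add: f norm_mult norm_power w)
      also have "\<dots> \<le> exp (r powr b)" using r R' w by (intro R1) auto
      finally have "exp (Re (g w) - L) \<le> exp (r powr b)" by (simp add: exp_diff exp_minus divide_inverse)
      hence "Re (g w) \<le> r powr b + L" by simp
      also have "\<dots> \<le> (2 powr b + C) * R powr q" using rb Lq by (simp add: distrib_right)
      finally show ?thesis .
    qed
    show ?thesis
    proof (rule maximum_real_frontier[where S = "cball 0 r" and f = g and \<xi> = z])
      show "g holomorphic_on interior (cball 0 r)" using g holomorphic_on_subset by blast
      show "continuous_on (closure (cball 0 r)) g"
        using g holomorphic_on_subset holomorphic_on_imp_continuous_on by blast
      show "Re (g w) \<le> (2 powr b + C) * R powr q" if "w \<in> frontier (cball 0 r)" for w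
        using that r R' by (intro circ) (auto simp: frontier_cball)
      show "z \<in> cball 0 r" using z r by auto
    qed simp
  qed
  have "R0 \<ge> 1" by (simp add: R0_def)
  moreover have "2 powr b + C \<ge> 0" using C by simp
  ultimately show ?thesis
    by (rule entire_real_part_growth_imp_polynomial[OF g q(3,2) _ _ Re])
qed

section \<open>Gauges, proximate orders and regular variation\<close>

text \<open>
  The properties of the reciprocal of an iterated logarithm that the estimates use: it is eventually
  positive and decreasing, tends to \<open>0\<close>, varies by at most a factor \<open>2\<close> between \<open>sqrt r\<close> and \<open>r\<close>, and decays more
  slowly than any power.
\<close>

definition slow_gauge :: "(real \<Rightarrow> real) \<Rightarrow> bool" where
  "slow_gauge \<epsilon> \<longleftrightarrow>
     (\<exists>R0>0. (\<forall>r\<ge>R0. 0 < \<epsilon> r) \<and> (\<forall>r\<ge>R0. \<forall>s\<ge>r. \<epsilon> s \<le> \<epsilon> r)) \<and>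
     (\<epsilon> \<longlongrightarrow> 0) at_top \<and>
     (\<forall>\<^sub>F r in at_top. \<epsilon> (sqrt r) \<le> 2 * \<epsilon> r) \<and>
     (\<forall>\<delta>>0. \<forall>\<^sub>F r in at_top. r powr - \<delta> \<le> \<epsilon> r)"

text \<open>
  The comparison of \<open>r\<close> with \<open>sqrt r\<close> survives one more logarithm, since \<open>log(l/2) \<ge> (log l)/2\<close> once \<open>l \<ge> 4\<close>.
\<close>

lemma iter_log_Suc_properties:
  "(\<exists>R0>0. \<forall>r\<ge>R0. \<forall>s\<ge>r. (ln ^^ Suc k) r \<le> (ln ^^ Suc k) (s::real)) \<and>
   filterlim ((ln ^^ Suc k) :: real \<Rightarrow> real) at_top at_top \<and>
   (\<forall>\<^sub>F r in at_top. (ln ^^ Suc k) r / 2 \<le> (ln ^^ Suc k) (sqrt r)) \<and>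
   (\<forall>\<^sub>F r in at_top. (ln ^^ Suc k) r \<le> ln (r::real))"
proof (induction k)
  case 0
  have "\<forall>r\<ge>1. \<forall>s\<ge>r. ln r \<le> ln (s::real)" by simp
  moreover have "\<forall>\<^sub>F r in at_top. ln r / 2 \<le> ln (sqrt (r::real))"
    by (rule eventually_mono[OF eventually_gt_at_top[of 0]]) (simp add: ln_sqrt)
  ultimately show ?case by (auto simp: ln_at_top intro!: exI[of _ 1])
next
  case (Suc k)
  define l where "l = ((ln ^^ Suc k) :: real \<Rightarrow> real)"
  have l: "(ln ^^ Suc (Suc k)) r = ln (l r)" for r by (simp add: l_def)
  obtain R0 where R0: "R0 > 0" "\<And>r s. r \<ge> R0 \<Longrightarrow> s \<ge> r \<Longrightarrow> l r \<le> l s"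
    using Suc.IH unfolding l_def[symmetric] by blast
  have lim: "filterlim l at_top at_top"
    and half: "\<forall>\<^sub>F r in at_top. l r / 2 \<le> l (sqrt r)" and le: "\<forall>\<^sub>F r in at_top. l r \<le> ln r"
    using Suc.IH unfolding l_def[symmetric] by blast+
  have ev4: "\<forall>\<^sub>F r in at_top. l r \<ge> 4" using lim by (simp add: filterlim_at_top)
  then obtain R1 where R1: "\<And>r. r \<ge> R1 \<Longrightarrow> l r \<ge> 4" by (auto simp: eventually_at_top_linorder)
  have "\<exists>R0>0. \<forall>r\<ge>R0. \<forall>s\<ge>r. ln (l r) \<le> ln (l s)"
  proof (intro exI[of _ "max R0 R1"] conjI allI impI)
    show "0 < max R0 R1" using R0(1) by simp
    fix r s assume "max R0 R1 \<le> r" "r \<le> s"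
    thus "ln (l r) \<le> ln (l s)"
      using R0(2)[of r s] R1[of r] R1[of s] by (subst ln_le_cancel_iff) auto
  qed
  moreover have "filterlim (\<lambda>r. ln (l r)) at_top at_top"
    by (rule filterlim_compose[OF ln_at_top lim])
  moreover have "\<forall>\<^sub>F r in at_top. ln (l r) / 2 \<le> ln (l (sqrt r))"
    using half ev4
  proof eventually_elim
    case (elim r)
    have "ln (l r) / 2 = ln (sqrt (l r))" using elim by (simp add: ln_sqrt)
    also have "\<dots> \<le> ln (l r / 2)"
    proof -
      have "sqrt (l r) * 2 \<le> l r"
      proof -
        have "2 \<le> sqrt (l r)" using elim by (intro real_le_rsqrt) simp
        hence "sqrt (l r) * 2 \<le> sqrt (l r) * sqrt (l r)" using elim(2) by (intro mult_left_mono) auto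
        moreover have "sqrt (l r) * sqrt (l r) = l r"
          by (rule real_sqrt_mult_self[THEN trans], rule abs_of_nonneg) (use elim(2) in linarith)
        ultimately show ?thesis by linarith
      qed
      thus ?thesis using elim by (subst ln_le_cancel_iff) auto
    qed
    also have "\<dots> \<le> ln (l (sqrt r))" using elim by (subst ln_le_cancel_iff) auto
    finally show ?case .
  qed
  moreover have "\<forall>\<^sub>F r in at_top. ln (l r) \<le> ln r"
    using le ev4
  proof eventually_elim
    case (elim r)
    have "ln (l r) \<le> l r" using ln_le_minus_one[of "l r"] elim by simp
    thus ?case using elim by simp
  qed
  ultimately show ?case unfolding l by blast
qed

lemma slow_gauge_iter_log_recip:
  assumes "L \<ge> 1"
  shows "slow_gauge (iter_log_recip L)"
proof -
  obtain k where L: "L = Suc k" using assms by (cases L) auto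
  define l where "l = ((ln ^^ L) :: real \<Rightarrow> real)"
  have \<epsilon>: "iter_log_recip L = (\<lambda>r. 1 / l r)" by (simp add: iter_log_recip_def l_def fun_eq_iff)
  note P = iter_log_Suc_properties[of k, folded L, folded l_def]
  obtain R0 where R0: "R0 > 0" "\<And>r s. r \<ge> R0 \<Longrightarrow> s \<ge> r \<Longrightarrow> l r \<le> l s" using P by blast
  have lim: "filterlim l at_top at_top"
    and half: "\<forall>\<^sub>F r in at_top. l r / 2 \<le> l (sqrt r)" and le: "\<forall>\<^sub>F r in at_top. l r \<le> ln r"
    using P by blast+
  have ev1: "\<forall>\<^sub>F r in at_top. l r \<ge> 1" using lim by (simp add: filterlim_at_top)
  then obtain R1 where R1: "\<And>r. r \<ge> R1 \<Longrightarrow> l r \<ge> 1" by (auto simp: eventually_at_top_linorder)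
  have "\<exists>R0>0. (\<forall>r\<ge>R0. 0 < 1 / l r) \<and> (\<forall>r\<ge>R0. \<forall>s\<ge>r. 1 / l s \<le> 1 / l r)"
  proof (intro exI[of _ "max R0 R1"] conjI allI impI)
    show "0 < max R0 R1" using R0(1) by simp
    show "0 < 1 / l r" if "max R0 R1 \<le> r" for r using R1[of r] that by simp
    fix r s assume "max R0 R1 \<le> r" "r \<le> s"
    thus "1 / l s \<le> 1 / l r"
      using R0(2)[of r s] R1[of r] R1[of s] by (intro divide_left_mono) auto
  qed
  moreover have "((\<lambda>r. 1 / l r) \<longlongrightarrow> 0) at_top"
    by (intro tendsto_divide_0[OF tendsto_const] filterlim_at_top_imp_at_infinity lim)
  moreover have "\<forall>\<^sub>F r in at_top. 1 / l (sqrt r) \<le> 2 * (1 / l r)"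
    using half ev1
  proof eventually_elim
    case (elim r)
    have "1 / l (sqrt r) \<le> 1 / (l r / 2)" using elim by (intro divide_left_mono) auto
    thus ?case by simp
  qed
  moreover have "\<forall>\<^sub>F r in at_top. r powr - \<delta> \<le> 1 / l r" if "\<delta> > 0" for \<delta>
  proof -
    have "\<forall>\<^sub>F r in at_top. r powr - \<delta> \<le> 1 / ln r" using that by real_asymp
    thus ?thesis using le ev1
    proof eventually_elim
      case (elim r)
      have "1 / ln r \<le> 1 / l r" using elim by (intro divide_left_mono) auto
      thus ?case using elim by linarith
    qed
  qed
  ultimately show ?thesis unfolding slow_gauge_def \<epsilon> by blast
qed

lemma slow_gaugeE:
  assumes "slow_gauge \<epsilon>"
  obtains R0 where "R0 > 0" "\<And>r. r \<ge> R0 \<Longrightarrow> 0 < \<epsilon> r" "\<And>r s. r \<ge> R0 \<Longrightarrow> s \<ge> r \<Longrightarrow> \<epsilon> s \<le> \<epsilon> r"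
proof -
  from conjunct1[OF assms[unfolded slow_gauge_def]] obtain R0
    where R0: "R0 > 0 \<and> (\<forall>r\<ge>R0. 0 < \<epsilon> r) \<and> (\<forall>r\<ge>R0. \<forall>s\<ge>r. \<epsilon> s \<le> \<epsilon> r)"
    by (rule exE)
  show thesis by (rule that[of R0]) (use R0 in auto)
qed

lemma
  assumes "slow_gauge \<epsilon>"
  shows slow_gauge_eventually_less: "\<kappa> > 0 \<Longrightarrow> \<forall>\<^sub>F r in at_top. \<bar>\<epsilon> r\<bar> < \<kappa>"
    and slow_gauge_sqrt: "\<forall>\<^sub>F r in at_top. \<epsilon> (sqrt r) \<le> 2 * \<epsilon> r"
    and slow_gauge_power: "\<delta> > 0 \<Longrightarrow> \<forall>\<^sub>F r in at_top. r powr - \<delta> \<le> \<epsilon> r"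
proof -
  note g = conjunct2[OF assms[unfolded slow_gauge_def]]
  from tendstoD[OF conjunct1[OF g], of \<kappa>] show "\<forall>\<^sub>F r in at_top. \<bar>\<epsilon> r\<bar> < \<kappa>" if "\<kappa> > 0"
    using that by (simp add: dist_real_def)
  show "\<forall>\<^sub>F r in at_top. \<epsilon> (sqrt r) \<le> 2 * \<epsilon> r" by (rule conjunct1[OF conjunct2[OF g]])
  show "\<forall>\<^sub>F r in at_top. r powr - \<delta> \<le> \<epsilon> r" if "\<delta> > 0"
    using conjunct2[OF conjunct2[OF g]] that by simp
qed

lemma abs_exp_minus_one_le: "\<bar>exp y - 1\<bar> \<le> \<bar>y\<bar> * exp \<bar>y\<bar>" for y :: real
proof (cases "y \<ge> 0")
  case True
  have "1 - y \<le> exp (- y)" using exp_ge_add_one_self[of "- y"] by simp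
  hence "(1 - y) * exp y \<le> exp (- y) * exp y" by (intro mult_right_mono) auto
  hence "exp y - 1 \<le> y * exp y" by (simp add: exp_minus algebra_simps)
  thus ?thesis using True by simp
next
  case False
  have "1 - exp y \<le> - y" using exp_ge_add_one_self[of y] by linarith
  also have "\<dots> \<le> - y * exp (- y)" using False by (simp add: mult_le_cancel_left1)
  finally show ?thesis using False by simp
qed

text \<open>
  In the coordinate \<open>u = log r\<close> the logarithm of \<open>V\<close> is \<open>G(u) = \<tau>(u) u\<close> with \<open>\<tau>(u) = \<sigma>(exp u)\<close>, and
  \<open>G'(u) = \<tau>'(u) u + \<tau>(u)\<close>.  This is close to \<open>\<rho>\<close>, which gives the crude comparison at all scales.  Between \<open>sqrt r\<close>
  and \<open>r^2\<close> it even differs from \<open>\<sigma>(r)\<close> only by \<open>O(\<epsilon>(r))\<close>, because on that range the change of \<open>\<tau>\<close> is an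
  integral of \<open>O(\<epsilon>(r)/u)\<close> over an interval of length \<open>O(u)\<close>; this gives the fine comparison.
\<close>

lemma proximate_order_regular_variation:
  fixes \<sigma> \<epsilon> :: "real \<Rightarrow> real" and \<rho> \<delta> :: real
  assumes prox: "proximate_order \<sigma> \<rho>" and gauge: "slow_gauge \<epsilon>"
    and O: "(\<lambda>r. deriv \<sigma> r * r * ln r) \<in> O[at_top](\<epsilon>)" and \<delta>: "\<delta> > 0"
  obtains K R0 where "K > 0" "R0 > 1"
    "\<And>r. r \<ge> R0 \<Longrightarrow> \<bar>\<sigma> r - \<rho>\<bar> \<le> \<delta>"
    "\<And>t r. t \<ge> R0 \<Longrightarrow> r \<ge> R0 \<Longrightarrow>
       t powr \<sigma> t \<le> r powr \<sigma> r * ((t / r) powr \<rho> * exp (\<delta> * \<bar>ln (t / r)\<bar>))"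
    "\<And>t r. r \<ge> R0 \<Longrightarrow> sqrt r \<le> t \<Longrightarrow> t \<le> r\<^sup>2 \<Longrightarrow>
       \<bar>t powr \<sigma> t - r powr \<sigma> r * (t / r) powr \<sigma> r\<bar>
         \<le> K * \<epsilon> r * (r powr \<sigma> r * ((t / r) powr \<rho> * exp (\<delta> * \<bar>ln (t / r)\<bar>)))"
proof -
  from O obtain K1 where K1: "K1 > 0" and "\<forall>\<^sub>F r in at_top. norm (deriv \<sigma> r * r * ln r) \<le> K1 * norm (\<epsilon> r)"
    by (rule landau_o.bigE)
  hence e1: "\<forall>\<^sub>F r in at_top. \<bar>deriv \<sigma> r * r * ln r\<bar> \<le> K1 * \<bar>\<epsilon> r\<bar>" by simp
  have p1: "\<forall>\<^sub>F r in at_top. 0 < \<sigma> r \<and> \<sigma> differentiable (at r)" and p2: "(\<sigma> \<longlongrightarrow> \<rho>) at_top"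
    and p3: "((\<lambda>r. deriv \<sigma> r * r * ln r) \<longlongrightarrow> 0) at_top"
    using prox unfolding proximate_order_def by iprover+
  have e2: "\<forall>\<^sub>F r in at_top. \<bar>deriv \<sigma> r * r * ln r\<bar> < \<delta> / 4"
    using tendstoD[OF p3, of "\<delta> / 4"] \<delta> by (simp add: dist_real_def)
  have e3: "\<forall>\<^sub>F r in at_top. \<bar>\<sigma> r - \<rho>\<bar> < \<delta> / 4"
    using tendstoD[OF p2, of "\<delta> / 4"] \<delta> by (simp add: dist_real_def)
  have e4: "\<forall>\<^sub>F r in at_top. \<sigma> differentiable (at r)"
    by (rule eventually_mono[OF p1]) simp
  have e6: "\<forall>\<^sub>F r in at_top. \<bar>\<epsilon> r\<bar> < \<delta> / (24 * K1)"
    using \<delta> K1 by (intro slow_gauge_eventually_less[OF gauge]) simp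
  obtain Ra where Ra: "Ra > 0" "\<And>r. r \<ge> Ra \<Longrightarrow> 0 < \<epsilon> r" "\<And>r s. r \<ge> Ra \<Longrightarrow> s \<ge> r \<Longrightarrow> \<epsilon> s \<le> \<epsilon> r"
    by (rule slow_gaugeE[OF gauge]) (rule that)
  have "\<forall>\<^sub>F r in at_top. \<bar>deriv \<sigma> r * r * ln r\<bar> \<le> K1 * \<bar>\<epsilon> r\<bar> \<and> \<bar>deriv \<sigma> r * r * ln r\<bar> < \<delta> / 4 \<and>
      \<bar>\<sigma> r - \<rho>\<bar> < \<delta> / 4 \<and> \<sigma> differentiable (at r) \<and> \<epsilon> (sqrt r) \<le> 2 * \<epsilon> r \<and> \<bar>\<epsilon> r\<bar> < \<delta> / (24 * K1)" (is "eventually ?Q _")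
    by (intro eventually_conj e1 e2 e3 e4 slow_gauge_sqrt[OF gauge] e6)
  from iffD1[OF eventually_at_top_linorder this] obtain Rb where
    Rb': "\<forall>r\<ge>Rb. ?Q r"
    by (rule exE)
  note Rb = Rb'[rule_format]
  define Rc where "Rc = max (exp 1) (max Ra Rb)"
  define U where "U = ln Rc"
  have Rc: "Rc \<ge> exp 1" "Rc \<ge> Ra" "Rc \<ge> Rb" by (auto simp: Rc_def)
  have Rc0: "Rc > 0" using Rc(1) exp_gt_zero[of 1] by linarith
  have U1: "U \<ge> 1"
  proof -
    have "ln (exp 1) \<le> ln Rc" using Rc(1) Rc0 by (subst ln_le_cancel_iff) auto
    thus ?thesis by (simp add: U_def)
  qed
  have expU: "exp u \<ge> Rc" if "u \<ge> U" for u
  proof -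
    have "exp U \<le> exp u" using that by simp
    thus ?thesis using Rc0 by (simp add: U_def)
  qed
  define \<tau> where "\<tau> = (\<lambda>u. \<sigma> (exp u))"
  define D where "D = (\<lambda>u. deriv \<sigma> (exp u) * exp u)"
  have d\<tau>: "(\<tau> has_real_derivative D u) (at u within S)" if "u \<ge> U" for u S
  proof -
    have "\<sigma> differentiable (at (exp u))" using Rb[of "exp u"] expU[OF that] Rc by simp
    then obtain d where d: "(\<sigma> has_real_derivative d) (at (exp u))"
      using real_differentiable_def by blast
    hence "(\<sigma> has_real_derivative deriv \<sigma> (exp u)) (at (exp u))"
      using DERIV_imp_deriv[OF d] by simp
    from DERIV_chain2[OF this DERIV_exp[of u]] show ?thesis
      unfolding \<tau>_def D_def by (rule has_field_derivative_at_within)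
  qed
  have Du: "\<bar>D u * u\<bar> \<le> K1 * \<epsilon> (exp u)" "\<bar>D u * u\<bar> \<le> \<delta> / 4" "\<bar>\<tau> u - \<rho>\<bar> \<le> \<delta> / 4" if "u \<ge> U" for u
    using Rb[of "exp u"] Ra(2)[of "exp u"] expU[OF that] Rc unfolding D_def \<tau>_def by auto
  define G where "G = (\<lambda>u. \<tau> u * u)"
  have VG: "t powr \<sigma> t = exp (G (ln t))" if "t > 0" for t
    using that by (simp add: G_def \<tau>_def powr_def)
  have dG: "((\<lambda>u. G u - k * u) has_real_derivative (D u * u + \<tau> u - k)) (at u within S)" if "u \<ge> U" for u k S
    unfolding G_def using d\<tau>[OF that] by (auto intro!: derivative_eq_intros)
  have potter: "\<bar>G u - G v - \<rho> * (u - v)\<bar> \<le> \<delta> / 2 * \<bar>u - v\<bar>" if "u \<ge> U" "v \<ge> U" for u v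
  proof -
    have "norm ((G u - \<rho> * u) - (G v - \<rho> * v)) \<le> \<delta> / 2 * norm (u - v)"
    proof (rule field_differentiable_bound[where S = "{U..}"])
      fix w assume "w \<in> {U..}"
      hence w: "w \<ge> U" by simp
      show "((\<lambda>u. G u - \<rho> * u) has_real_derivative (D w * w + \<tau> w - \<rho>)) (at w within {U..})" by (rule dG[OF w])
      show "norm (D w * w + \<tau> w - \<rho>) \<le> \<delta> / 2" using Du(2,3)[OF w] unfolding real_norm_def by linarith
    qed (use that in auto)
    thus ?thesis by (simp add: algebra_simps)
  qed
  have fine: "\<bar>G u - G v - \<tau> v * (u - v)\<bar> \<le> 6 * K1 * \<epsilon> (exp v) * \<bar>u - v\<bar>"
    if v: "v \<ge> 2 * U" and u: "v / 2 \<le> u" "u \<le> 2 * v" for u v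
  proof -
    define S where "S = {v / 2..2 * v}"
    define e where "e = \<epsilon> (exp v)"
    have v0: "v > 0" "v \<ge> U" using v U1 by auto
    have SU: "w \<ge> U" if "w \<in> S" for w using that v by (auto simp: S_def)
    have e2: "\<epsilon> (exp w) \<le> 2 * e" if "w \<in> S" for w
    proof -
      have "\<epsilon> (exp w) \<le> \<epsilon> (exp (v / 2))"
        using that v expU[of "v / 2"] Rc by (intro Ra(3)) (auto simp: S_def)
      also have "exp (v / 2) = sqrt (exp v)"
        by (rule real_sqrt_unique[symmetric]) (auto simp: power2_eq_square exp_add[symmetric])
      also have "\<epsilon> \<dots> \<le> 2 * e" unfolding e_def using Rb[of "exp v"] expU[OF v0(2)] Rc by simp
      finally show ?thesis .
    qed
    have e0: "e > 0" unfolding e_def using expU[OF v0(2)] Rc by (intro Ra) auto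
    have \<tau>\<tau>: "\<bar>\<tau> w - \<tau> v\<bar> \<le> 4 * K1 * e" if w: "w \<in> S" for w
    proof -
      have "norm (\<tau> w - \<tau> v) \<le> (4 * K1 * e / v) * norm (w - v)"
      proof (rule field_differentiable_bound[where S = S])
        fix y assume y: "y \<in> S"
        show "(\<tau> has_real_derivative D y) (at y within S)" by (rule d\<tau>[OF SU[OF y]])
        have y0: "y > 0" using SU[OF y] U1 by linarith
        have "\<bar>D y\<bar> * y \<le> K1 * (2 * e)"
        proof -
          have "\<bar>D y\<bar> * y = \<bar>D y * y\<bar>" using y0 by (simp add: abs_mult)
          also have "\<dots> \<le> K1 * \<epsilon> (exp y)" by (rule Du(1)[OF SU[OF y]])
          also have "\<dots> \<le> K1 * (2 * e)" using K1 e2[OF y] by (intro mult_left_mono) auto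
          finally show ?thesis .
        qed
        hence "\<bar>D y\<bar> \<le> K1 * (2 * e) / y" using y0 by (simp add: field_simps)
        also have "\<dots> \<le> K1 * (2 * e) / (v / 2)"
          using y v0 K1 e0 by (intro divide_left_mono) (auto simp: S_def)
        finally show "norm (D y) \<le> 4 * K1 * e / v" by simp
      qed (use w v0 in \<open>auto simp: S_def\<close>)
      also have "\<dots> \<le> (4 * K1 * e / v) * v"
        using w v0 K1 e0 by (intro mult_left_mono) (auto simp: S_def)
      finally show ?thesis using v0 by simp
    qed
    have "norm ((G u - \<tau> v * u) - (G v - \<tau> v * v)) \<le> 6 * K1 * e * norm (u - v)"
    proof (rule field_differentiable_bound[where S = S])
      fix w assume w: "w \<in> S"
      show "((\<lambda>u. G u - \<tau> v * u) has_real_derivative (D w * w + \<tau> w - \<tau> v)) (at w within S)" by (rule dG[OF SU[OF w]])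
      have "\<bar>D w * w\<bar> \<le> K1 * (2 * e)"
      proof -
        have "K1 * \<epsilon> (exp w) \<le> K1 * (2 * e)" using K1 e2[OF w] by (intro mult_left_mono) auto
        thus ?thesis using Du(1)[OF SU[OF w]] by linarith
      qed
      thus "norm (D w * w + \<tau> w - \<tau> v) \<le> 6 * K1 * e" using \<tau>\<tau>[OF w] unfolding real_norm_def by linarith
    qed (use u v0 in \<open>auto simp: S_def\<close>)
    thus ?thesis by (simp add: e_def algebra_simps)
  qed
  show thesis
  proof (rule that[of "24 * K1 / \<delta>" "Rc\<^sup>2"])
    have Rc1: "Rc > 1" using Rc(1) exp_gt_one[of 1] by linarith
    show "24 * K1 / \<delta> > 0" using K1 \<delta> by simp
    show Rc2: "Rc\<^sup>2 > 1" using Rc1 by (simp add: one_less_power)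
    have big: "ln r \<ge> 2 * U" "ln r \<ge> U" "r > 0" if "r \<ge> Rc\<^sup>2" for r
    proof -
      show "r > 0" using that Rc2 by linarith
      have "ln (Rc\<^sup>2) \<le> ln r" using that Rc2 by (subst ln_le_cancel_iff) auto
      thus "ln r \<ge> 2 * U" using Rc0 by (simp add: U_def ln_realpow)
      thus "ln r \<ge> U" using U1 by simp
    qed
    show sr: "\<bar>\<sigma> r - \<rho>\<bar> \<le> \<delta>" if "r \<ge> Rc\<^sup>2" for r
      using Du(3)[OF big(2)[OF that]] big(3)[OF that] \<delta> by (simp add: \<tau>_def)
    show "t powr \<sigma> t \<le> r powr \<sigma> r * ((t / r) powr \<rho> * exp (\<delta> * \<bar>ln (t / r)\<bar>))" if tr: "t \<ge> Rc\<^sup>2" "r \<ge> Rc\<^sup>2" for t r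
    proof -
      note t = big[OF tr(1)] and r = big[OF tr(2)]
      have ln: "ln (t / r) = ln t - ln r" using t r by (simp add: ln_div)
      have "G (ln t) \<le> G (ln r) + \<rho> * ln (t / r) + \<delta> / 2 * \<bar>ln (t / r)\<bar>"
        using potter[OF t(2) r(2)] unfolding ln by linarith
      also have "\<dots> \<le> G (ln r) + (\<rho> * ln (t / r) + \<delta> * \<bar>ln (t / r)\<bar>)" using \<delta> by simp
      finally have "exp (G (ln t)) \<le> exp (G (ln r)) * (exp (\<rho> * ln (t / r)) * exp (\<delta> * \<bar>ln (t / r)\<bar>))"
        by (simp add: exp_add[symmetric])
      also have "exp (\<rho> * ln (t / r)) = (t / r) powr \<rho>" using t r by (simp add: powr_def)
      finally show ?thesis using t r by (simp add: VG)
    qed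
    show "\<bar>t powr \<sigma> t - r powr \<sigma> r * (t / r) powr \<sigma> r\<bar>
         \<le> 24 * K1 / \<delta> * \<epsilon> r * (r powr \<sigma> r * ((t / r) powr \<rho> * exp (\<delta> * \<bar>ln (t / r)\<bar>)))"
      if r: "r \<ge> Rc\<^sup>2" and t: "sqrt r \<le> t" "t \<le> r\<^sup>2" for t r
    proof -
      note r = big[OF r]
      have "sqrt r > 0" using r(3) by simp
      hence t0: "t > 0" using t(1) by linarith
      define z where "z = ln (t / r)"
      have ln: "z = ln t - ln r" using t0 r by (simp add: ln_div z_def)
      have u1: "ln r / 2 \<le> ln t"
      proof -
        have "ln (sqrt r) \<le> ln t" using t r t0 by (subst ln_le_cancel_iff) auto
        thus ?thesis using r by (simp add: ln_sqrt)
      qed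
      have u2: "ln t \<le> 2 * ln r"
      proof -
        have "ln t \<le> ln (r\<^sup>2)" using t r t0 by (subst ln_le_cancel_iff) auto
        thus ?thesis using r by (simp add: ln_realpow)
      qed
      define e where "e = \<epsilon> r"
      have e: "0 < e" "e < \<delta> / (24 * K1)" unfolding e_def
        using Ra(2)[of r] Rb[of r] expU[OF r(2)] r(3) Rc by auto
      define y where "y = G (ln t) - G (ln r) - \<sigma> r * z"
      have yb: "\<bar>y\<bar> \<le> 6 * K1 * e * \<bar>z\<bar>"
        using fine[OF r(1) u1 u2] r(3) by (simp add: y_def \<tau>_def e_def ln)
      have "6 * K1 * e \<le> \<delta> / 4" using e(2) K1 by (simp add: field_simps)
      hence "6 * K1 * e * \<bar>z\<bar> \<le> \<delta> / 4 * \<bar>z\<bar>" by (rule mult_right_mono) simp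
      hence yb2: "\<bar>y\<bar> \<le> \<delta> / 4 * \<bar>z\<bar>" using yb by linarith
      have "t powr \<sigma> t = r powr \<sigma> r * (t / r) powr \<sigma> r * exp y"
      proof -
        have "(t / r) powr \<sigma> r = exp (\<sigma> r * z)" using t0 r by (simp add: powr_def z_def)
        thus ?thesis unfolding VG[OF t0] VG[OF r(3)] by (simp add: y_def exp_add[symmetric])
      qed
      hence "\<bar>t powr \<sigma> t - r powr \<sigma> r * (t / r) powr \<sigma> r\<bar> = \<bar>r powr \<sigma> r * (t / r) powr \<sigma> r * (exp y - 1)\<bar>"
        by (simp add: algebra_simps)
      also have "\<dots> = r powr \<sigma> r * ((t / r) powr \<sigma> r * \<bar>exp y - 1\<bar>)" by (simp add: abs_mult)
      also have "\<dots> \<le> r powr \<sigma> r * (((t / r) powr \<rho> * exp (\<delta> / 4 * \<bar>z\<bar>)) * ((24 * K1 / \<delta> * e * exp (\<delta> / 4 * \<bar>z\<bar>)) * exp (\<delta> / 4 * \<bar>z\<bar>)))"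
      proof (intro mult_left_mono mult_mono)
        have "(\<sigma> r - \<rho>) * z \<le> \<bar>\<sigma> r - \<rho>\<bar> * \<bar>z\<bar>" by (metis abs_ge_self abs_mult)
        also have "\<dots> \<le> \<delta> / 4 * \<bar>z\<bar>"
          using Du(3)[OF r(2)] r(3) by (intro mult_right_mono) (auto simp: \<tau>_def)
        finally have "\<sigma> r * z \<le> \<rho> * z + \<delta> / 4 * \<bar>z\<bar>" by (simp add: algebra_simps)
        thus "(t / r) powr \<sigma> r \<le> (t / r) powr \<rho> * exp (\<delta> / 4 * \<bar>z\<bar>)"
          using t0 r by (simp add: powr_def z_def exp_add[symmetric])
        have "\<bar>z\<bar> \<le> 4 / \<delta> * exp (\<delta> / 4 * \<bar>z\<bar>)"
        proof -
          have "\<delta> / 4 * \<bar>z\<bar> \<le> exp (\<delta> / 4 * \<bar>z\<bar>)"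
            using exp_ge_add_one_self[of "\<delta> / 4 * \<bar>z\<bar>"] by linarith
          thus ?thesis using \<delta> by (simp add: field_simps)
        qed
        hence "6 * K1 * e * \<bar>z\<bar> \<le> 6 * K1 * e * (4 / \<delta> * exp (\<delta> / 4 * \<bar>z\<bar>))"
          using K1 e by (intro mult_left_mono) auto
        hence "\<bar>y\<bar> \<le> 24 * K1 / \<delta> * e * exp (\<delta> / 4 * \<bar>z\<bar>)" using yb by simp
        hence "\<bar>y\<bar> * exp \<bar>y\<bar> \<le> (24 * K1 / \<delta> * e * exp (\<delta> / 4 * \<bar>z\<bar>)) * exp (\<delta> / 4 * \<bar>z\<bar>)"
          using yb2 K1 e \<delta> by (intro mult_mono) auto
        thus "\<bar>exp y - 1\<bar> \<le> (24 * K1 / \<delta> * e * exp (\<delta> / 4 * \<bar>z\<bar>)) * exp (\<delta> / 4 * \<bar>z\<bar>)"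
          using abs_exp_minus_one_le[of y] by linarith
      qed auto
      also have "\<dots> = 24 * K1 / \<delta> * e * (r powr \<sigma> r * ((t / r) powr \<rho> * (exp (\<delta> / 4 * \<bar>z\<bar>) * (exp (\<delta> / 4 * \<bar>z\<bar>) * exp (\<delta> / 4 * \<bar>z\<bar>)))))"
        by (simp only: mult_ac)
      also have "exp (\<delta> / 4 * \<bar>z\<bar>) * (exp (\<delta> / 4 * \<bar>z\<bar>) * exp (\<delta> / 4 * \<bar>z\<bar>)) = exp (3 / 4 * (\<delta> * \<bar>z\<bar>))"
        by (simp add: exp_add[symmetric])
      also have "24 * K1 / \<delta> * e * (r powr \<sigma> r * ((t / r) powr \<rho> * exp (3 / 4 * (\<delta> * \<bar>z\<bar>))))
          \<le> 24 * K1 / \<delta> * e * (r powr \<sigma> r * ((t / r) powr \<rho> * exp (\<delta> * \<bar>z\<bar>)))"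
        using K1 e \<delta> by (intro mult_left_mono) auto
      finally show ?thesis by (simp add: z_def e_def)
    qed
  qed
qed

lemma powr_exp_abs_ln_le:
  fixes x \<rho> \<delta> :: real
  assumes "x > 0"
  shows "x powr \<rho> * exp (\<delta> * \<bar>ln x\<bar>) \<le> x powr (\<rho> - \<delta>) + x powr (\<rho> + \<delta>)"
proof (cases "ln x \<ge> 0")
  case True
  hence "x powr \<rho> * exp (\<delta> * \<bar>ln x\<bar>) = x powr (\<rho> + \<delta>)"
    using assms by (simp add: powr_def exp_add[symmetric] algebra_simps)
  thus ?thesis by simp
next
  case False
  hence "x powr \<rho> * exp (\<delta> * \<bar>ln x\<bar>) = x powr (\<rho> - \<delta>)"
    using assms by (simp add: powr_def exp_add[symmetric] algebra_simps)
  thus ?thesis by simp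
qed

text \<open>
  If \<open>|log x| \<ge> (log r)/2\<close>, both terms are bounded by the crude comparison, and enlarging the exponent
  \<open>\<delta>/2\<close> to \<open>\<delta>\<close> gains a factor \<open>r^(-\<delta>/4) \<le> \<epsilon>(r)\<close>.  Otherwise \<open>r x\<close> lies between \<open>sqrt r\<close> and \<open>r^2\<close>, where the
  hypothesis on \<open>n\<close> and the fine comparison both have errors \<open>O(\<epsilon>(r))\<close>.
\<close>

lemma counting_comparison:
  fixes n \<sigma> \<epsilon> :: "real \<Rightarrow> real" and \<rho> \<delta> c :: real
  assumes prox: "proximate_order \<sigma> \<rho>" and gauge: "slow_gauge \<epsilon>"
    and O: "(\<lambda>r. deriv \<sigma> r * r * ln r) \<in> O[at_top](\<epsilon>)"
    and n0: "\<And>t. n t \<ge> 0" "mono n" "t0 > 0" "\<And>t. t < t0 \<Longrightarrow> n t = 0"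
    and nO: "(\<lambda>r. n r - c * r powr \<sigma> r) \<in> O[at_top](\<lambda>r. \<epsilon> r * r powr \<sigma> r)"
    and c: "c > 0" and \<delta>: "0 < \<delta>" "\<delta> < \<rho>"
  shows "\<exists>K\<ge>0. \<forall>\<^sub>F r in at_top. \<forall>x>0.
     \<bar>n (r * x) - c * r powr \<sigma> r * x powr \<sigma> r\<bar> \<le> K * \<epsilon> r * r powr \<sigma> r * (x powr (\<rho> - \<delta>) + x powr (\<rho> + \<delta>))"
proof -
  define V where "V = (\<lambda>r. r powr \<sigma> r)"
  define e where "e = (\<lambda>x::real. x powr \<rho> * exp (\<delta> / 2 * \<bar>ln x\<bar>))"
  define E where "E = (\<lambda>x::real. x powr \<rho> * exp (\<delta> * \<bar>ln x\<bar>))"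
  have d2: "\<delta> / 2 > 0" using \<delta> by simp
  have e0: "e x \<ge> 0" "E x \<ge> 0" "e x \<le> E x" for x
    using \<delta> by (auto simp: e_def E_def intro!: mult_left_mono mult_right_mono)
  obtain K0 R0 where K0: "K0 > 0" "R0 > 1"
    and S: "\<And>r. r \<ge> R0 \<Longrightarrow> \<bar>\<sigma> r - \<rho>\<bar> \<le> \<delta> / 2"
    and P': "\<And>t r. t \<ge> R0 \<Longrightarrow> r \<ge> R0 \<Longrightarrow>
       t powr \<sigma> t \<le> r powr \<sigma> r * ((t / r) powr \<rho> * exp (\<delta> / 2 * \<bar>ln (t / r)\<bar>))"
    and F': "\<And>t r. r \<ge> R0 \<Longrightarrow> sqrt r \<le> t \<Longrightarrow> t \<le> r\<^sup>2 \<Longrightarrow>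
       \<bar>t powr \<sigma> t - r powr \<sigma> r * (t / r) powr \<sigma> r\<bar>
         \<le> K0 * \<epsilon> r * (r powr \<sigma> r * ((t / r) powr \<rho> * exp (\<delta> / 2 * \<bar>ln (t / r)\<bar>)))"
    by (rule proximate_order_regular_variation[OF prox gauge O d2]) (rule that)
  have P: "V t \<le> V r * e (t / r)" if "t \<ge> R0" "r \<ge> R0" for t r
    unfolding V_def e_def by (rule P'[OF that])
  have F: "\<bar>V t - V r * (t / r) powr \<sigma> r\<bar> \<le> K0 * \<epsilon> r * (V r * e (t / r))"
    if "r \<ge> R0" "sqrt r \<le> t" "t \<le> r\<^sup>2" for t r
    unfolding V_def e_def by (rule F'[OF that])
  obtain Ra where Ra0: "Ra > 0" and Ra: "\<And>r. r \<ge> Ra \<Longrightarrow> 0 < \<epsilon> r" "\<And>r s. r \<ge> Ra \<Longrightarrow> s \<ge> r \<Longrightarrow> \<epsilon> s \<le> \<epsilon> r"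
    by (rule slow_gaugeE[OF gauge]) (rule that)
  obtain K1 where K1: "K1 > 0" and "\<forall>\<^sub>F r in at_top. norm (n r - c * V r) \<le> K1 * norm (\<epsilon> r * V r)"
    unfolding V_def by (rule landau_o.bigE[OF nO])
  hence h1: "\<forall>\<^sub>F r in at_top. \<bar>n r - c * V r\<bar> \<le> K1 * \<bar>\<epsilon> r * V r\<bar>" by simp
  have h2: "\<forall>\<^sub>F r in at_top. \<bar>\<epsilon> r\<bar> < 1" by (rule slow_gauge_eventually_less[OF gauge]) simp
  have h4: "\<forall>\<^sub>F r in at_top. r powr - (\<delta> / 4) \<le> \<epsilon> r" using \<delta> by (intro slow_gauge_power[OF gauge]) simp
  have "\<forall>\<^sub>F r in at_top. \<bar>n r - c * V r\<bar> \<le> K1 * \<bar>\<epsilon> r * V r\<bar> \<and> \<bar>\<epsilon> r\<bar> < 1 \<and> r powr - (\<delta> / 4) \<le> \<epsilon> r \<and> \<epsilon> (sqrt r) \<le> 2 * \<epsilon> r" (is "eventually ?Q _")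
    by (intro eventually_conj h1 h2 h4 slow_gauge_sqrt[OF gauge])
  from iffD1[OF eventually_at_top_linorder this] obtain Rb where
    Rb': "\<forall>r\<ge>Rb. ?Q r"
    by (rule exE)
  note Rb = Rb'[rule_format]
  define R1 where "R1 = max R0 (max Ra (max Rb t0))"
  have R1: "R1 \<ge> R0" "R1 \<ge> Ra" "R1 \<ge> Rb" "R1 > 1" "R1 \<ge> t0" using K0 by (auto simp: R1_def)
  have V0: "V r \<ge> 0" for r by (simp add: V_def)
  define A where "A = (R1 / t0) powr (\<rho> - \<delta> / 2)"
  have A: "A \<ge> 1" unfolding A_def using R1 n0(3) \<delta> by (intro ge_one_powr_ge_zero) auto
  have nV: "n t \<le> (c + K1) * V t" "\<bar>n t - c * V t\<bar> \<le> K1 * \<epsilon> t * V t" if "t \<ge> R1" for t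
  proof -
    have et: "0 < \<epsilon> t" "\<epsilon> t < 1" using Ra(1)[of t] Rb[of t] that R1 by auto
    show 1: "\<bar>n t - c * V t\<bar> \<le> K1 * \<epsilon> t * V t"
      using Rb[of t] that R1 et V0[of t] by (simp add: abs_mult mult.assoc)
    have "K1 * \<epsilon> t * V t \<le> K1 * 1 * V t" using et K1 V0[of t] by (intro mult_right_mono mult_left_mono) auto
    thus "n t \<le> (c + K1) * V t" using 1 by (simp add: distrib_right)
  qed
  have claim1: "n t \<le> (c + K1) * A * (V r * e (t / r))" if r: "r \<ge> R1" and t: "t > 0" for t r
  proof (cases "t \<ge> R1")
    case True
    have "n t \<le> (c + K1) * V t" by (rule nV[OF True])
    also have "\<dots> \<le> (c + K1) * (V r * e (t / r))"
      using True r R1 c K1 by (intro mult_left_mono P) auto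
    also have "\<dots> \<le> (c + K1) * A * (V r * e (t / r))"
      using A c K1 V0 e0 by (intro mult_right_mono) auto
    finally show ?thesis .
  next
    case False
    show ?thesis
    proof (cases "t < t0")
      case True
      thus ?thesis using n0(4)[OF True] A c K1 V0 e0 by simp
    next
      case tt: False
      have rr: "r > 0" "R1 > 0" using r R1 by auto
      have neg: "ln (t / r) \<le> 0" "ln (R1 / r) \<le> 0"
        using False r rr t by (auto intro!: ln_le_zero_iff[THEN iffD2] simp: field_simps)
      have eneg: "e x = x powr (\<rho> - \<delta> / 2)" if "ln x \<le> 0" "x > 0" for x
        using that by (simp add: e_def powr_def exp_add[symmetric] algebra_simps)
      \<comment> \<open>Between \<open>t0\<close> and \<open>R1\<close> only boundedness of \<open>n\<close> is known, so \<open>t\<close> is compared with \<open>R1\<close>.\<close>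
      have eR: "e (R1 / r) = e (t / r) * (R1 / t) powr (\<rho> - \<delta> / 2)"
        using eneg[OF neg(1)] eneg[OF neg(2)] rr t by (simp add: powr_mult[symmetric])
      have "(R1 / t) powr (\<rho> - \<delta> / 2) \<le> A"
        unfolding A_def using tt t rr n0(3) \<delta> by (intro powr_mono2 divide_left_mono) auto
      hence "e (R1 / r) \<le> e (t / r) * A"
        unfolding eR by (rule mult_left_mono) (rule e0)
      hence eA: "(c + K1) * (V r * e (R1 / r)) \<le> (c + K1) * (V r * (e (t / r) * A))"
        using c K1 V0 by (intro mult_left_mono) auto
      have "n t \<le> n R1" by (rule monoD[OF n0(2)]) (use False in simp)
      also have "\<dots> \<le> (c + K1) * V R1" by (rule nV) simp
      also have "\<dots> \<le> (c + K1) * (V r * e (R1 / r))"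
        using r R1 c K1 by (intro mult_left_mono P) auto
      also note eA
      finally show ?thesis by (simp add: mult_ac)
    qed
  qed
  have claim2: "V r * x powr \<sigma> r \<le> V r * e x" if r: "r \<ge> R1" and x: "x > 0" for r x
  proof (rule mult_left_mono[OF _ V0])
    have "(\<sigma> r - \<rho>) * ln x \<le> \<bar>\<sigma> r - \<rho>\<bar> * \<bar>ln x\<bar>" by (metis abs_ge_self abs_mult)
    also have "\<dots> \<le> \<delta> / 2 * \<bar>ln x\<bar>" using S[of r] r R1 by (intro mult_right_mono) auto
    finally have "\<sigma> r * ln x \<le> \<rho> * ln x + \<delta> / 2 * \<bar>ln x\<bar>" by (simp add: algebra_simps)
    thus "x powr \<sigma> r \<le> e x" using x by (simp add: powr_def e_def exp_add[symmetric])
  qed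
  define K where "K = (c + K1) * A + c + 2 * K1 + c * K0"
  have K: "K \<ge> 0" using c K1 A K0 by (simp add: K_def)
  have main: "\<bar>n (r * x) - c * V r * x powr \<sigma> r\<bar> \<le> K * \<epsilon> r * V r * E x" if r: "r \<ge> R1\<^sup>2" and x: "x > 0" for r x
  proof -
    have rR: "r \<ge> R1"
    proof -
      have "R1 * 1 \<le> R1 * R1" using R1 by (intro mult_left_mono) auto
      thus ?thesis using r by (simp add: power2_eq_square)
    qed
    have r1: "r > 1" using rR R1 by simp
    have er: "\<epsilon> r > 0" "r powr - (\<delta> / 4) \<le> \<epsilon> r" "\<epsilon> (sqrt r) \<le> 2 * \<epsilon> r"
      using Ra(1)[of r] Rb[of r] rR R1 by auto
    define t where "t = r * x"
    have t: "t > 0" "t / r = x" using x r1 by (auto simp: t_def)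
    show ?thesis
    proof (cases "\<bar>ln x\<bar> \<ge> ln r / 2")
      case True
      have "e x = E x * exp (- (\<delta> / 2 * \<bar>ln x\<bar>))" by (simp add: e_def E_def exp_add[symmetric])
      also have "\<dots> \<le> E x * r powr - (\<delta> / 4)"
      proof (rule mult_left_mono[OF _ e0(2)])
        have "\<delta> / 2 * (ln r / 2) \<le> \<delta> / 2 * \<bar>ln x\<bar>" using True \<delta> by (intro mult_left_mono) auto
        thus "exp (- (\<delta> / 2 * \<bar>ln x\<bar>)) \<le> r powr - (\<delta> / 4)" using r1 by (simp add: powr_def)
      qed
      also have "\<dots> \<le> E x * \<epsilon> r" by (intro mult_left_mono er e0)
      finally have far: "e x \<le> E x * \<epsilon> r" .
      have "n t \<le> (c + K1) * A * (V r * e x)" using claim1[OF rR t(1)] t(2) by simp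
      hence "\<bar>n t - c * V r * x powr \<sigma> r\<bar> \<le> (c + K1) * A * (V r * e x) + c * (V r * x powr \<sigma> r)"
      proof -
        have "0 \<le> c * (V r * x powr \<sigma> r)" using c V0[of r] by simp
        thus ?thesis using n0(1)[of t] \<open>n t \<le> _\<close> unfolding mult.assoc[of c] by (intro abs_leI) linarith+
      qed
      also have "\<dots> \<le> (c + K1) * A * (V r * e x) + c * (V r * e x)"
        by (intro add_left_mono mult_left_mono[OF claim2[OF rR x]]) (use c in simp)
      also have "\<dots> = ((c + K1) * A + c) * (V r * e x)" by (simp add: distrib_right)
      also have "\<dots> \<le> ((c + K1) * A + c) * (V r * (E x * \<epsilon> r))"
        using far V0[of r] c K1 A by (intro mult_left_mono) auto
      also have "\<dots> \<le> K * (V r * (E x * \<epsilon> r))"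
        using V0[of r] c K1 K0 e0 er by (intro mult_right_mono) (auto simp: K_def)
      finally show ?thesis by (simp add: t_def mult_ac)
    next
      case False
      hence lx: "- (ln r / 2) \<le> ln x" "ln x \<le> ln r / 2" by auto
      have "sqrt r \<le> t"
      proof -
        have "ln (sqrt r) \<le> ln t" using lx r1 x by (simp add: ln_sqrt t_def ln_mult)
        thus ?thesis using r1 t by (subst (asm) ln_le_cancel_iff) auto
      qed
      moreover have "t \<le> r\<^sup>2"
      proof -
        have "ln x \<le> ln r" using lx(2) ln_ge_zero[of r] r1 by linarith
        hence "x \<le> r" using r1 x by (subst (asm) ln_le_cancel_iff) auto
        thus ?thesis using r1 by (simp add: t_def power2_eq_square)
      qed
      moreover have sR: "sqrt r \<ge> R1" using r R1 by (intro real_le_rsqrt) auto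
      ultimately have tR: "t \<ge> R1" and tt: "sqrt r \<le> t" "t \<le> r\<^sup>2" by auto
      have "\<epsilon> t \<le> \<epsilon> (sqrt r)" using sR tt R1 by (intro Ra(2)) auto
      hence et: "\<epsilon> t \<le> 2 * \<epsilon> r" using er by simp
      have "\<bar>n t - c * V t\<bar> \<le> K1 * \<epsilon> t * V t" by (rule nV[OF tR])
      also have "\<dots> \<le> K1 * (2 * \<epsilon> r) * V t" using et K1 V0 by (intro mult_right_mono mult_left_mono) auto
      also have "\<dots> \<le> K1 * (2 * \<epsilon> r) * (V r * e x)"
        using P[of t r] tR rR R1 K1 er t by (intro mult_left_mono) auto
      finally have 1: "\<bar>n t - c * V t\<bar> \<le> K1 * (2 * \<epsilon> r) * (V r * e x)" .
      have "\<bar>c * V t - c * (V r * x powr \<sigma> r)\<bar> = c * \<bar>V t - V r * x powr \<sigma> r\<bar>"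
        using c by (simp add: right_diff_distrib[symmetric] abs_mult)
      also have "\<dots> \<le> c * (K0 * \<epsilon> r * (V r * e x))"
        using F[OF _ tt] rR R1 c t by (intro mult_left_mono) auto
      finally have "\<bar>n t - c * (V r * x powr \<sigma> r)\<bar> \<le> K1 * (2 * \<epsilon> r) * (V r * e x) + c * (K0 * \<epsilon> r * (V r * e x))"
        using 1 by linarith
      also have "\<dots> = (2 * K1 + c * K0) * (\<epsilon> r * (V r * e x))" by (simp add: algebra_simps)
      also have "\<dots> \<le> K * (\<epsilon> r * (V r * E x))"
        using c K1 K0 A V0[of r] e0 er by (intro mult_mono mult_left_mono) (auto simp: K_def)
      finally show ?thesis by (simp add: t_def mult_ac)
    qed
  qed
  have "\<forall>\<^sub>F r in at_top. \<forall>x>0.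
     \<bar>n (r * x) - c * r powr \<sigma> r * x powr \<sigma> r\<bar> \<le> K * \<epsilon> r * r powr \<sigma> r * (x powr (\<rho> - \<delta>) + x powr (\<rho> + \<delta>))"
  proof (rule eventually_mono[OF eventually_ge_at_top[of "R1\<^sup>2"]], intro allI impI)
    fix r x :: real assume r: "R1\<^sup>2 \<le> r" and x: "x > 0"
    have "R1\<^sup>2 \<ge> R1" using R1 by (simp add: power2_eq_square)
    hence "\<epsilon> r > 0" using Ra(1)[of r] r R1 by simp
    hence "K * \<epsilon> r * V r * E x \<le> K * \<epsilon> r * V r * (x powr (\<rho> - \<delta>) + x powr (\<rho> + \<delta>))"
      unfolding E_def using K V0 by (intro mult_left_mono powr_exp_abs_ln_le x) auto
    thus "\<bar>n (r * x) - c * r powr \<sigma> r * x powr \<sigma> r\<bar> \<le> K * \<epsilon> r * r powr \<sigma> r * (x powr (\<rho> - \<delta>) + x powr (\<rho> + \<delta>))"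
      using main[OF r x] by (simp add: V_def)
  qed
  thus ?thesis using K by blast
qed

section \<open>Rotating the zeros onto the positive half-line\<close>

lemma sin_half_lower:
  fixes h t :: real
  assumes "0 \<le> h" "h \<le> 1" "h \<le> t" "t \<le> 2 * pi - h"
  shows "h / 4 \<le> sin (t / 2)"
proof -
  have small: "h / 4 \<le> sin (h / 2)"
  proof (cases "h = 0")
    case False
    hence h: "0 < h / 2" using assms by simp
    have "\<exists>\<xi>>0. \<xi> < h / 2 \<and> sin (h / 2) - sin 0 = (h / 2 - 0) * cos \<xi>"
      by (rule MVT2) (use h in \<open>auto intro!: derivative_eq_intros\<close>)
    then obtain \<xi> where \<xi>: "0 < \<xi>" "\<xi> < h / 2" "sin (h / 2) = h / 2 * cos \<xi>" by auto
    have "cos (pi / 3) \<le> cos \<xi>"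
      using \<xi> assms pi_gt3 by (subst cos_mono_le_eq) auto
    hence "1 / 2 \<le> cos \<xi>" by (simp add: cos_60)
    hence "h / 2 * (1 / 2) \<le> h / 2 * cos \<xi>" using h by (intro mult_left_mono) auto
    also have "\<dots> = sin (h / 2)" using \<xi>(3) by simp
    finally show ?thesis by simp
  qed simp
  also have "sin (h / 2) \<le> sin (t / 2)"
  proof (cases "t \<le> pi")
    case True
    show ?thesis using assms True pi_gt3 by (intro sin_monotone_2pi_le) auto
  next
    case False
    have "sin (h / 2) \<le> sin (pi - t / 2)"
      using assms False pi_gt3 by (intro sin_monotone_2pi_le) auto
    thus ?thesis by simp
  qed
  finally show ?thesis .
qed

text \<open>
  Here \<open>x\<^sub>n\<close> are the moduli of the zeros divided by \<open>r\<close>, \<open>\<phi>\<^sub>n\<close> their angles and \<open>\<eta>\<close> is \<open>sqrt \<epsilon>\<close>.  A zero of angle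
  \<open>O(\<eta>^2)\<close> stays at angular distance of order \<open>\<eta>\<close> from the point during the rotation, which costs a factor
  \<open>\<eta>^2/\<eta>\<close>.  The zeros of much smaller modulus may have any angle: they are far from the point, and the
  smallness comes from \<open>x\<^sub>n^\<delta> \<le> \<eta>\<close>.
\<close>

lemma sum_rotation_estimate:
  fixes x \<phi> :: "nat \<Rightarrow> real" and a b M \<delta> \<eta> \<theta> :: real
  assumes x: "filterlim x at_top sequentially" "\<And>n. x n > 0"
    and M: "\<And>y. y > 0 \<Longrightarrow> counting x y \<le> M * (y powr a + y powr b)"
    and ab: "real p + \<delta> < a" "a \<le> b" "b < real p + 1" "\<delta> > 0"
    and \<eta>: "0 < \<eta>" "\<eta> \<le> 1 / 4" and \<theta>: "\<eta> \<le> \<theta>" "\<theta> \<le> 2 * pi - \<eta>"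
    and near: "\<And>n. \<bar>\<phi> n\<bar> \<le> 2 * \<eta>\<^sup>2 \<or> x n \<le> 1 / 2 \<and> \<bar>\<phi> n\<bar> \<le> pi \<and> x n powr \<delta> \<le> \<eta>"
  defines "d \<equiv> \<lambda>n. log_factor p (cis (\<theta> - \<phi> n) / of_real (x n))
                   - log_factor p (cis \<theta> / of_real (x n))"
  shows "cis (\<theta> - \<phi> n) / of_real (x n) \<noteq> 1"
    and "summable (\<lambda>n. \<bar>d n\<bar>)"
    and "(\<Sum>n. \<bar>d n\<bar>) \<le> \<eta> * M * (16 * (2 powr (real p + 2) * kernel_mass (real p) a b)
            + 3 * pi * (2 powr (real p + \<delta> + 2) * kernel_mass (real p + \<delta>) a b))"
proof -
  define \<kappa> where "\<kappa> = (\<lambda>q n. x n powr - q / (1 + x n))"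
  have \<kappa>0: "\<kappa> q n \<ge> 0" for q n using x(2)[of n] by (simp add: \<kappa>_def)
  have seg: "\<exists>m>0. (\<forall>t\<in>closed_segment (\<theta> - \<phi> n) \<theta>. m * (1 + 1 / x n) \<le> norm (1 - of_real (1 / x n) * cis t)) \<and>
       \<kappa> (real p) n / m * \<bar>\<phi> n\<bar> \<le> 16 * \<eta> * \<kappa> (real p) n + 3 * pi * \<eta> * \<kappa> (real p + \<delta>) n" for n
  proof (cases "\<bar>\<phi> n\<bar> \<le> 2 * \<eta>\<^sup>2")
    case True
    have "2 * \<eta>\<^sup>2 \<le> \<eta> / 2"
      using mult_left_mono[of "\<eta>" "1 / 4" "2 * \<eta>"] \<eta> by (simp add: power2_eq_square)
    hence ph: "\<bar>\<phi> n\<bar> \<le> \<eta> / 2" using True by linarith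
    have "\<eta> / 8 * (1 + 1 / x n) \<le> norm (1 - of_real (1 / x n) * cis t)" if t: "t \<in> closed_segment (\<theta> - \<phi> n) \<theta>" for t
    proof -
      have "\<eta> / 2 \<le> t" "t \<le> 2 * pi - \<eta> / 2"
        using t ph \<theta> \<eta> by (auto simp: closed_segment_eq_real_ivl split: if_splits)
      hence "\<eta> / 2 / 4 \<le> sin (t / 2)" using \<eta> by (intro sin_half_lower) auto
      hence "\<eta> / 8 \<le> \<bar>sin (t / 2)\<bar>" by simp
      hence "(1 + 1 / x n) * (\<eta> / 8) \<le> (1 + 1 / x n) * \<bar>sin (t / 2)\<bar>"
        using x(2)[of n] by (intro mult_left_mono) auto
      also have "\<dots> \<le> norm (1 - of_real (1 / x n) * cis t)"
        using x(2)[of n] by (intro norm_one_minus_cis_ge) auto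
      finally show ?thesis by (simp only: mult.commute)
    qed
    moreover have "\<kappa> (real p) n / (\<eta> / 8) * \<bar>\<phi> n\<bar> \<le> 16 * \<eta> * \<kappa> (real p) n + 3 * pi * \<eta> * \<kappa> (real p + \<delta>) n"
    proof -
      have "\<kappa> (real p) n / (\<eta> / 8) * \<bar>\<phi> n\<bar> \<le> \<kappa> (real p) n / (\<eta> / 8) * (2 * \<eta>\<^sup>2)"
        using True \<kappa>0 \<eta> by (intro mult_left_mono) auto
      also have "\<dots> = 16 * \<eta> * \<kappa> (real p) n" using \<eta> by (simp add: power2_eq_square)
      finally show ?thesis using \<kappa>0[of "real p + \<delta>" n] \<eta> by (simp add: add_increasing2)
    qed
    ultimately show ?thesis using \<eta> by (intro exI[of _ "\<eta> / 8"]) auto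
  next
    case False
    hence f: "x n \<le> 1 / 2" "\<bar>\<phi> n\<bar> \<le> pi" "x n powr \<delta> \<le> \<eta>" using near[of n] by auto
    have y: "1 / x n \<ge> 2" using f(1) x(2)[of n] by (simp add: field_simps)
    have "1 / 3 * (1 + 1 / x n) \<le> norm (1 - of_real (1 / x n) * cis t)" for t
    proof -
      have "norm (of_real (1 / x n) * cis t) - norm (1 :: complex) \<le> norm (of_real (1 / x n) * cis t - 1)"
        by (rule norm_triangle_ineq2)
      moreover have "norm (of_real (1 / x n) * cis t) = 1 / x n"
        using x(2)[of n] by (simp add: norm_mult norm_divide)
      ultimately have "1 / x n - 1 \<le> norm (1 - of_real (1 / x n) * cis t)"
        by (simp add: norm_minus_commute)
      thus ?thesis using y by simp
    qed
    moreover have "\<kappa> (real p) n / (1 / 3) * \<bar>\<phi> n\<bar> \<le> 16 * \<eta> * \<kappa> (real p) n + 3 * pi * \<eta> * \<kappa> (real p + \<delta>) n"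
    proof -
      have "\<kappa> (real p) n = x n powr \<delta> * \<kappa> (real p + \<delta>) n"
        unfolding \<kappa>_def times_divide_eq_right powr_add[symmetric] by simp
      also have "\<dots> \<le> \<eta> * \<kappa> (real p + \<delta>) n" using f \<kappa>0 by (intro mult_right_mono) auto
      finally have "\<kappa> (real p) n / (1 / 3) * \<bar>\<phi> n\<bar> \<le> (\<eta> * \<kappa> (real p + \<delta>) n) * 3 * pi"
        using f \<kappa>0[of "real p" n] \<kappa>0[of "real p + \<delta>" n] \<eta> by (intro mult_mono) auto
      also have "\<dots> = 3 * pi * \<eta> * \<kappa> (real p + \<delta>) n" by (simp only: mult_ac)
      also have "\<dots> \<le> 16 * \<eta> * \<kappa> (real p) n + 3 * pi * \<eta> * \<kappa> (real p + \<delta>) n"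
        using \<kappa>0[of "real p" n] \<eta> by simp
      finally show ?thesis .
    qed
    ultimately show ?thesis by (intro exI[of _ "1 / 3"]) auto
  qed
  have eq: "of_real (1 / x n) * cis t = cis t / of_real (x n)" for n t by simp
  show "cis (\<theta> - \<phi> n) / of_real (x n) \<noteq> 1"
  proof -
    obtain m where m: "m > 0" "\<forall>t\<in>closed_segment (\<theta> - \<phi> n) \<theta>. m * (1 + 1 / x n) \<le> norm (1 - of_real (1 / x n) * cis t)"
      using seg[of n] by blast
    have "0 < m * (1 + 1 / x n)" using m(1) x(2)[of n] by (intro mult_pos_pos add_pos_pos) auto
    also have "\<dots> \<le> norm (1 - of_real (1 / x n) * cis (\<theta> - \<phi> n))" using m(2) by blast
    finally show ?thesis unfolding eq by auto
  qed
  have dn: "\<bar>d n\<bar> \<le> 16 * \<eta> * \<kappa> (real p) n + 3 * pi * \<eta> * \<kappa> (real p + \<delta>) n" for n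
  proof -
    obtain m where m: "m > 0" "\<forall>t\<in>closed_segment (\<theta> - \<phi> n) \<theta>. m * (1 + 1 / x n) \<le> norm (1 - of_real (1 / x n) * cis t)"
      "\<kappa> (real p) n / m * \<bar>\<phi> n\<bar> \<le> 16 * \<eta> * \<kappa> (real p) n + 3 * pi * \<eta> * \<kappa> (real p + \<delta>) n"
      using seg[of n] by blast
    have "\<bar>d n\<bar> \<le> (1 / x n) ^ Suc p / (1 + 1 / x n) / m * \<bar>(\<theta> - \<phi> n) - \<theta>\<bar>"
      unfolding d_def eq[symmetric] using m x(2)[of n] by (intro ln_weierstrass_factor_rotate) auto
    also have "\<dots> = \<kappa> (real p) n / m * \<bar>\<phi> n\<bar>"
      using inverse_power_kernel[OF x(2), of n p] by (simp add: \<kappa>_def)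
    finally show ?thesis using m(3) by linarith
  qed
  note s1 = sum_power_kernel[where q = "real p" and a = a and b = b, OF _ _ _ _ _ x M]
  note s2 = sum_power_kernel[where q = "real p + \<delta>" and a = a and b = b, OF _ _ _ _ _ x M]
  have s: "summable (\<kappa> (real p))" "summable (\<kappa> (real p + \<delta>))"
    using s1(1) s2(1) ab unfolding \<kappa>_def by auto
  have sb: "(\<Sum>n. \<kappa> (real p) n) \<le> 2 powr (real p + 2) * kernel_mass (real p) a b * M"
      "(\<Sum>n. \<kappa> (real p + \<delta>) n) \<le> 2 powr (real p + \<delta> + 2) * kernel_mass (real p + \<delta>) a b * M"
    using s1(2) s2(2) ab unfolding \<kappa>_def by auto
  have sm: "summable (\<lambda>n. 16 * \<eta> * \<kappa> (real p) n + 3 * pi * \<eta> * \<kappa> (real p + \<delta>) n)"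
    using s by (intro summable_add summable_mult)
  show sd: "summable (\<lambda>n. \<bar>d n\<bar>)"
    by (rule summable_comparison_test'[OF sm]) (use dn in simp)
  have "(\<Sum>n. \<bar>d n\<bar>) \<le> (\<Sum>n. 16 * \<eta> * \<kappa> (real p) n + 3 * pi * \<eta> * \<kappa> (real p + \<delta>) n)"
    by (intro suminf_le dn sd sm)
  also have "\<dots> = 16 * \<eta> * (\<Sum>n. \<kappa> (real p) n) + 3 * pi * \<eta> * (\<Sum>n. \<kappa> (real p + \<delta>) n)"
    using s by (simp add: suminf_add[symmetric] suminf_mult summable_mult)
  also have "\<dots> \<le> 16 * \<eta> * (2 powr (real p + 2) * kernel_mass (real p) a b * M)
      + 3 * pi * \<eta> * (2 powr (real p + \<delta> + 2) * kernel_mass (real p + \<delta>) a b * M)"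
    using sb \<eta> by (intro add_mono mult_left_mono) auto
  finally show "(\<Sum>n. \<bar>d n\<bar>) \<le> \<eta> * M * (16 * (2 powr (real p + 2) * kernel_mass (real p) a b)
            + 3 * pi * (2 powr (real p + \<delta> + 2) * kernel_mass (real p + \<delta>) a b))"
    by (simp add: algebra_simps)
qed

section \<open>Zero sequences and canonical factorization\<close>

lemma entire_eventually_nonzero:
  assumes "f holomorphic_on UNIV" "f w \<noteq> 0"
  shows "eventually (\<lambda>z. f z \<noteq> 0) (at (z::complex))"
  by (rule eventually_mono[OF non_zero_neighbour_alt[OF assms(1) open_UNIV connected_UNIV UNIV_I UNIV_I assms(2), of z]]) simp

lemma entire_finite_zeros_cball:
  assumes "f holomorphic_on UNIV" "f w \<noteq> 0" "infinite {z. f z = 0}"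
  shows "finite {z \<in> cball 0 R. f z = 0}"
proof (rule holomorphic_compact_finite_zeros[OF assms(1)])
  show "\<not> f constant_on UNIV"
  proof
    assume "f constant_on UNIV"
    then obtain k where "\<And>z. f z = k" by (auto simp: constant_on_def)
    hence "{z. f z = 0} = {}" using assms(2) by auto
    thus False using assms(3) by simp
  qed
qed auto

lemma entire_zero_sequence:
  assumes holf: "f holomorphic_on UNIV" and w: "f w \<noteq> 0" and inf: "infinite {z. f z = 0}"
  obtains a :: "nat \<Rightarrow> complex" where
    "range a = {z. f z = 0} - {0}" "filterlim a at_infinity sequentially"
    "\<And>z. f z = 0 \<Longrightarrow> z \<noteq> 0 \<Longrightarrow> finite (a -` {z}) \<and> int (card (a -` {z})) = zorder f z"
proof -
  define Z where "Z = {z. f z = 0} - {0}"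
  have fr: "frequently (\<lambda>z. f z \<noteq> 0) (at z)" for z
    using entire_eventually_nonzero[OF holf w] by (intro eventually_frequently) auto
  have pos: "zorder f z > 0" if "f z = 0" for z
    using zorder_pos_iff[OF holf open_UNIV, of z] fr that by simp
  have fin: "finite (Z \<inter> cball 0 R)" for R
    by (rule finite_subset[OF _ entire_finite_zeros_cball[OF holf w inf, of R]]) (auto simp: Z_def)
  have infZ: "infinite Z" using inf by (simp add: Z_def)
  have "\<not> z islimpt Z" for z
  proof
    assume "z islimpt Z"
    moreover have "eventually (\<lambda>w. w \<notin> Z) (at z)"
      using entire_eventually_nonzero[OF holf w, of z] by (rule eventually_mono) (auto simp: Z_def)
    ultimately show False by (simp add: islimpt_iff_eventually)
  qed
  hence clZ: "closed Z" by (simp add: closed_limpt)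
  have posZ: "nat (zorder f z) > 0" if "z \<in> Z" for z using pos[of z] that by (simp add: Z_def)
  obtain a :: "nat \<Rightarrow> complex" where a: "range a = Z" "filterlim a at_infinity sequentially"
    "\<And>z. z \<in> Z \<Longrightarrow> finite (a -` {z}) \<and> card (a -` {z}) = nat (zorder f z)"
    by (rule sequence_of_sparse_set_exists'[OF infZ clZ fin, of "\<lambda>z. nat (zorder f z)", OF posZ]) (assumption, rule that)
  show thesis
  proof (rule that[of a])
    show "finite (a -` {z}) \<and> int (card (a -` {z})) = zorder f z" if "f z = 0" "z \<noteq> 0" for z
      using a(3)[of z] pos[of z] that by (simp add: Z_def)
  qed (use a(1,2) in \<open>simp_all add: Z_def\<close>)
qed

lemma zero_count_eq_counting:
  assumes holf: "f holomorphic_on UNIV" and w: "f w \<noteq> 0" and inf: "infinite {z. f z = 0}"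
    and rng: "range a = {z. f z = 0} - {0}"
    and mult: "\<And>z. f z = 0 \<Longrightarrow> z \<noteq> 0 \<Longrightarrow> finite (a -` {z}) \<and> int (card (a -` {z})) = zorder f z"
    and "r \<ge> 0"
  shows "of_int (zero_count f r) = counting (\<lambda>n. norm (a n)) r + of_int (if f 0 = 0 then zorder f 0 else 0)"
proof -
  define Z where "Z = {z \<in> cball 0 r. f z = 0}"
  have finZ: "finite Z" unfolding Z_def by (rule entire_finite_zeros_cball[OF holf w inf])
  have "card {n. norm (a n) \<le> r} = card (\<Union>z\<in>Z - {0}. a -` {z})"
    using rng by (intro arg_cong[of _ _ card]) (auto simp: Z_def)
  also have "\<dots> = (\<Sum>z\<in>Z - {0}. card (a -` {z}))"
    using finZ mult by (intro card_UN_disjoint) (auto simp: Z_def)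
  finally have "int (card {n. norm (a n) \<le> r}) = (\<Sum>z\<in>Z - {0}. int (card (a -` {z})))" by simp
  also have "\<dots> = (\<Sum>z\<in>Z - {0}. zorder f z)"
    using mult by (intro sum.cong) (auto simp: Z_def)
  finally have c: "int (card {n. norm (a n) \<le> r}) = (\<Sum>z\<in>Z - {0}. zorder f z)" .
  have "zero_count f r = (\<Sum>z\<in>Z. zorder f z)" by (simp add: zero_count_def Z_def)
  also have "\<dots> = (\<Sum>z\<in>Z - {0}. zorder f z) + (if f 0 = 0 then zorder f 0 else 0)"
  proof (cases "f 0 = 0")
    case True
    hence "0 \<in> Z" using \<open>r \<ge> 0\<close> by (simp add: Z_def)
    thus ?thesis using True finZ by (simp add: sum.remove[of Z 0])
  next
    case False
    hence "Z - {0} = Z" by (auto simp: Z_def)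
    thus ?thesis using False by simp
  qed
  finally have "zero_count f r = int (card {n. norm (a n) \<le> r}) + (if f 0 = 0 then zorder f 0 else 0)"
    using c by simp
  thus ?thesis by (simp only: counting_def of_int_add of_int_of_nat_eq)
qed

text \<open>
  \<open>z^m\<close> times the canonical product has the same zeros with the same multiplicities as \<open>f\<close>, so the quotient is
  entire without zeros and has an entire logarithm.
\<close>

lemma entire_canonical_factorization:
  assumes holf: "f holomorphic_on UNIV" and w: "f w \<noteq> 0"
    and rng: "range a = {z. f z = 0} - {0}" and lim: "filterlim a at_infinity sequentially"
    and mult: "\<And>z. f z = 0 \<Longrightarrow> z \<noteq> 0 \<Longrightarrow> int (card (a -` {z})) = zorder f z"
    and summ: "\<And>r. r > 0 \<Longrightarrow> summable (\<lambda>n. (r / norm (a n)) ^ Suc p)"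
  obtains m g P where "g holomorphic_on UNIV" "\<And>z. f z = z ^ m * exp (g z) * P z"
    "\<And>z. (\<lambda>N. \<Prod>n<N. weierstrass_factor p (z / a n)) \<longlonglongrightarrow> P z"
proof -
  interpret W: weierstrass_product a "\<lambda>_. p"
  proof
    show "a n \<noteq> 0" for n using rng by blast
  qed (use lim summ in auto)
  have fr: "frequently (\<lambda>z. f z \<noteq> 0) (at z)" for z
    using entire_eventually_nonzero[OF holf w] by (intro eventually_frequently) auto
  have ana: "f analytic_on {z}" for z using holf analytic_at by blast
  define m where "m = nat (zorder f 0)"
  have m: "int m = zorder f 0" unfolding m_def using zorder_ge_0[OF ana fr, of 0] by simp
  have m0: "m = 0 \<longleftrightarrow> f 0 \<noteq> 0"
    using zorder_pos_iff[OF holf open_UNIV, of 0] fr m by auto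
  have W0: "W.f z = 0 \<longleftrightarrow> f z = 0 \<and> z \<noteq> 0" for z using W.zero[of z] rng by auto
  have zeq: "z ^ m * W.f z = 0 \<longleftrightarrow> f z = 0" for z
    using W0[of z] m0 by (cases "z = 0") auto
  have ord: "zorder (\<lambda>z. z ^ m * W.f z) z = zorder f z" for z
  proof (cases "z = 0")
    case True
    have "zorder (\<lambda>z. z ^ m * W.f z) 0 = int m"
    proof (rule zorder_eqI[where S = UNIV and g = W.f])
      show "W.f holomorphic_on UNIV" by (rule W.holomorphic)
      show "W.f 0 \<noteq> 0" using W0 by simp
    qed auto
    thus ?thesis using m True by simp
  next
    case False
    have "zorder (\<lambda>z. z ^ m * W.f z) z = zorder (\<lambda>z. z ^ m) z + zorder W.f z"
    proof (rule zorder_times_analytic)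
      show "eventually (\<lambda>z. z ^ m * W.f z \<noteq> 0) (at z)"
        using entire_eventually_nonzero[OF holf w, of z] by (rule eventually_mono) (use zeq in auto)
    qed (auto intro!: analytic_intros W.analytic)
    also have "zorder (\<lambda>z. z ^ m) z = 0"
      using False by (intro zorder_eq_0I analytic_intros) auto
    also have "zorder W.f z = int (card (a -` {z}))" by (rule W.zorder)
    also have "\<dots> = zorder f z"
    proof (cases "f z = 0")
      case True thus ?thesis using mult False by simp
    next
      case nz: False
      hence "a -` {z} = {}" using rng by auto
      moreover have "zorder f z = 0" using nz by (intro zorder_eq_0I ana)
      ultimately show ?thesis by simp
    qed
    finally show ?thesis by simp
  qed
  obtain h where h: "h holomorphic_on UNIV" "\<And>z. h z \<noteq> 0" "\<And>z. f z = h z * (z ^ m * W.f z)"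
  proof (rule holomorphic_zorder_factorization[OF holf open_UNIV connected_UNIV, of "\<lambda>z. z ^ m * W.f z"])
    show "(\<lambda>z. z ^ m * W.f z) holomorphic_on UNIV" by (intro holomorphic_intros W.holomorphic)
  qed (use zeq ord in auto)
  obtain g where g: "g holomorphic_on UNIV" "\<And>z. exp (g z) = h z"
    using holomorphic_logarithm_exists[OF convex_UNIV open_UNIV h(1)] h(2) by auto
  have lim: "(\<lambda>N. \<Prod>n<N. weierstrass_factor p (z / a n)) \<longlonglongrightarrow> W.f z" for z
  proof -
    have "(\<lambda>N. \<Prod>n\<le>N. weierstrass_factor p (z / a n)) \<longlonglongrightarrow> W.f z"
      using convergent_prod_LIMSEQ[OF W.convergent[of z]] by (simp add: W.f_def)
    hence "(\<lambda>N. \<Prod>n<Suc N. weierstrass_factor p (z / a n)) \<longlonglongrightarrow> W.f z"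
      by (simp only: lessThan_Suc_atMost)
    thus ?thesis by (rule LIMSEQ_imp_Suc)
  qed
  show thesis
    by (rule that[OF g(1) _ lim, of m]) (use h(3) g(2) in \<open>simp add: mult_ac\<close>)
qed

section \<open>Asymptotics of the logarithm of the modulus\<close>

lemma thin_region_polar:
  assumes "z \<in> thin_region L"
  shows "norm z > (exp ^^ L) 1"
    and "\<exists>\<theta>. z = of_real (norm z) * cis \<theta> \<and> \<bar>\<theta>\<bar> < iter_log_recip L (norm z)"
proof -
  obtain r \<theta> where z: "z = of_real r * cis \<theta>" "r > (exp ^^ L) 1" "\<bar>\<theta>\<bar> < iter_log_recip L r"
    using assms by (auto simp: thin_region_def)
  have "(exp ^^ L) (1::real) > 0" by (cases L) auto
  hence n: "norm z = r" using z by (simp add: norm_mult)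
  show "norm z > (exp ^^ L) 1" using z n by simp
  show "\<exists>\<theta>. z = of_real (norm z) * cis \<theta> \<and> \<bar>\<theta>\<bar> < iter_log_recip L (norm z)"
    using z unfolding n by blast
qed

lemma exists_nonzero_if_zeros_thin:
  assumes "finite {z. f z = 0 \<and> z \<notin> thin_region L}"
  shows "\<exists>w. f w \<noteq> 0"
proof (rule ccontr)
  assume "\<not> ?thesis"
  hence f0: "f z = 0" for z by blast
  define A where "A = (exp ^^ L) (1::real)"
  have A: "A > 0" unfolding A_def by (cases L) auto
  have "complex_of_real ` {0<..<A} \<subseteq> {z. f z = 0 \<and> z \<notin> thin_region L}"
    using thin_region_polar(1)[of _ L] by (force simp: f0 A_def)
  hence "finite (complex_of_real ` {0<..<A})" using assms finite_subset by blast
  hence "finite {0<..<A}" by (rule finite_imageD) (auto simp: inj_on_def)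
  thus False using A by (simp add: infinite_Ioo)
qed

text \<open>
  Beyond some radius every zero lies in the thin region and gets its small angle from there; the
  finitely many others get their principal argument.
\<close>

lemma zeros_polar_angles:
  fixes a :: "nat \<Rightarrow> complex"
  assumes fin: "finite (range a - thin_region L)" and \<epsilon>1: "\<forall>\<^sub>F r in at_top. iter_log_recip L r \<le> 1"
  shows "\<exists>R \<phi>. \<forall>n. a n = of_real (norm (a n)) * cis (\<phi> n) \<and> \<bar>\<phi> n\<bar> \<le> pi \<and>
           (norm (a n) \<ge> R \<longrightarrow> \<bar>\<phi> n\<bar> \<le> iter_log_recip L (norm (a n)))"
proof -
  obtain R1 where R1: "\<And>r. r \<ge> R1 \<Longrightarrow> iter_log_recip L r \<le> 1"
    using \<epsilon>1 by (auto simp: eventually_at_top_linorder)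
  obtain R2 where R2: "\<And>z. z \<in> range a - thin_region L \<Longrightarrow> norm z < R2"
    using finite_imp_bounded[OF fin] unfolding bounded_pos_less by blast
  define R where "R = max R1 R2"
  have "\<exists>t. a n = of_real (norm (a n)) * cis t \<and> \<bar>t\<bar> \<le> pi \<and>
           (norm (a n) \<ge> R \<longrightarrow> \<bar>t\<bar> \<le> iter_log_recip L (norm (a n)))" for n
  proof (cases "norm (a n) \<ge> R")
    case True
    hence "a n \<in> thin_region L" using R2[of "a n"] by (auto simp: R_def)
    from thin_region_polar(2)[OF this] obtain t where t: "a n = of_real (norm (a n)) * cis t"
      "\<bar>t\<bar> < iter_log_recip L (norm (a n))" by blast
    have "\<bar>t\<bar> \<le> pi" using t(2) R1[of "norm (a n)"] True pi_gt3 by (simp add: R_def)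
    thus ?thesis using t by (intro exI[of _ t]) auto
  next
    case False
    have "a n = of_real (norm (a n)) * cis (Arg (a n))"
      using rcis_cmod_Arg[of "a n"] by (simp add: rcis_def)
    moreover have "\<bar>Arg (a n)\<bar> \<le> pi" using Arg_bounded[of "a n"] by auto
    ultimately show ?thesis using False by blast
  qed
  then obtain \<phi> where "\<forall>n. a n = of_real (norm (a n)) * cis (\<phi> n) \<and> \<bar>\<phi> n\<bar> \<le> pi \<and>
           (norm (a n) \<ge> R \<longrightarrow> \<bar>\<phi> n\<bar> \<le> iter_log_recip L (norm (a n)))" by metis
  thus ?thesis by blast
qed

lemma entire_order_growth:
  assumes holf: "f holomorphic_on UNIV" and ord: "entire_order f = ereal \<rho>" and b: "\<rho> < b"
  shows "\<forall>\<^sub>F r in at_top. \<forall>z. norm z = r \<longrightarrow> norm (f z) \<le> exp (r powr b)"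
proof -
  have "\<forall>\<^sub>F r in at_top. ereal (ln (ln (max_modulus f r)) / ln r) < ereal b"
    using ord b unfolding entire_order_def by (intro Limsup_lessD) simp
  thus ?thesis using eventually_gt_at_top[of 1]
  proof eventually_elim
    case (elim r)
    define M where "M = max_modulus f r"
    have lr: "ln r > 0" using elim by simp
    have "M \<le> exp (r powr b)"
    proof (cases "ln M > 0 \<and> M > 0")
      case True
      have "ln (ln M) < b * ln r" using elim(1) lr by (simp add: M_def pos_divide_less_eq)
      hence "exp (ln (ln M)) < exp (b * ln r)" by simp
      hence "ln M < r powr b" using True elim by (simp add: powr_def)
      hence "exp (ln M) < exp (r powr b)" by simp
      thus ?thesis using True by simp
    next
      case False
      have "M \<le> 1"
      proof (cases "M > 0")
        case True
        hence "ln M \<le> 0" using False by simp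
        thus ?thesis using True by simp
      qed simp
      also have "\<dots> \<le> exp (r powr b)" by simp
      finally show ?thesis .
    qed
    moreover have "norm (f z) \<le> M" if "norm z = r" for z
      unfolding M_def max_modulus_def
    proof (rule cSUP_upper)
      show "z \<in> cball 0 r" using that by simp
      have "continuous_on (cball 0 r) f"
        using holf holomorphic_on_imp_continuous_on holomorphic_on_subset by blast
      hence "compact ((\<lambda>z. norm (f z)) ` cball 0 r)"
        by (intro compact_continuous_image continuous_intros) auto
      thus "bdd_above ((\<lambda>z. norm (f z)) ` cball 0 r)"
        by (intro bounded_imp_bdd_above compact_imp_bounded)
    qed
    ultimately show ?case using order.trans by blast
  qed
qed

lemma proximate_power_bounds:
  assumes prox: "proximate_order \<sigma> \<rho>"
  shows "k < \<rho> \<Longrightarrow> \<forall>\<^sub>F r in at_top. r powr k \<le> r powr \<sigma> r"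
    and "\<rho> < k \<Longrightarrow> \<forall>\<^sub>F r in at_top. r powr \<sigma> r \<le> r powr k"
proof -
  have lim: "(\<sigma> \<longlongrightarrow> \<rho>) at_top" using prox unfolding proximate_order_def by iprover
  show "\<forall>\<^sub>F r in at_top. r powr k \<le> r powr \<sigma> r" if "k < \<rho>"
    using order_tendstoD(1)[OF lim that] eventually_gt_at_top[of 1]
    by eventually_elim (intro powr_mono, auto)
  show "\<forall>\<^sub>F r in at_top. r powr \<sigma> r \<le> r powr k" if "\<rho> < k"
    using order_tendstoD(2)[OF lim that] eventually_gt_at_top[of 1]
    by eventually_elim (intro powr_mono, auto)
qed

text \<open>
  This absorbs every error term that is a power of \<open>r\<close> with exponent below \<open>\<rho>\<close>.
\<close>

lemma gauge_times_proximate_power_ge: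
  assumes prox: "proximate_order \<sigma> \<rho>" and gauge: "slow_gauge \<epsilon>" and k: "k < \<rho>"
  shows "\<forall>\<^sub>F r in at_top. r powr k \<le> \<epsilon> r * r powr \<sigma> r"
proof -
  define d where "d = (\<rho> - k) / 2"
  have d: "d > 0" "k + d < \<rho>" using k by (auto simp: d_def field_simps)
  have "\<forall>\<^sub>F r in at_top. r powr - d \<le> \<epsilon> r" by (rule slow_gauge_power[OF gauge d(1)])
  thus ?thesis using proximate_power_bounds(1)[OF prox d(2)]
  proof eventually_elim
    case (elim r)
    have "r powr k = r powr - d * r powr (k + d)" by (simp add: powr_add[symmetric])
    also have "\<dots> \<le> \<epsilon> r * r powr \<sigma> r" using elim by (intro mult_mono) (auto intro: order.trans[rotated])
    finally show ?case .
  qed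
qed

text \<open>
  With finitely many zeros the count would stay bounded, but it is eventually at least \<open>c V(r) / 2\<close>.
\<close>

lemma infinite_zeros_if_zero_count_asymp:
  assumes gauge: "slow_gauge \<epsilon>" and prox: "proximate_order \<sigma> \<rho>" and c: "c > 0"
    and O: "(\<lambda>r. of_int (zero_count f r) - c * r powr \<sigma> r) \<in> O[at_top](\<lambda>r. \<epsilon> r * r powr \<sigma> r)"
  shows "infinite {z. f z = 0}"
proof
  assume fin: "finite {z. f z = 0}"
  define B where "B = (\<Sum>z\<in>{z. f z = 0}. \<bar>zorder f z\<bar>)"
  have zB: "zero_count f r \<le> B" for r
  proof -
    have "zero_count f r \<le> (\<Sum>z\<in>{z \<in> cball 0 r. f z = 0}. \<bar>zorder f z\<bar>)"
      unfolding zero_count_def by (intro sum_mono) auto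
    also have "\<dots> \<le> B" unfolding B_def using fin by (intro sum_mono2) auto
    finally show ?thesis .
  qed
  have \<rho>: "\<rho> > 0" using prox unfolding proximate_order_def by iprover
  obtain K where K: "K > 0" "\<forall>\<^sub>F r in at_top. norm (of_int (zero_count f r) - c * r powr \<sigma> r) \<le> K * norm (\<epsilon> r * r powr \<sigma> r)"
    by (rule landau_o.bigE[OF O])
  have e: "\<forall>\<^sub>F r in at_top. \<bar>\<epsilon> r\<bar> < c / (2 * K)"
    using c K by (intro slow_gauge_eventually_less[OF gauge]) simp
  have lim: "filterlim (\<lambda>r::real. r powr (\<rho> / 2)) at_top at_top" using \<rho> by real_asymp
  have v: "\<forall>\<^sub>F r in at_top. r powr (\<rho> / 2) \<le> r powr \<sigma> r"
    using \<rho> by (intro proximate_power_bounds(1)[OF prox]) simp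
  have "\<forall>\<^sub>F r in at_top. 2 * \<bar>of_int B\<bar> / c < r powr (\<rho> / 2)"
    using lim by (simp add: filterlim_at_top_dense)
  hence "\<forall>\<^sub>F r::real in at_top. False"
    using K(2) e v
  proof eventually_elim
    case (elim r)
    define V where "V = r powr \<sigma> r"
    have V: "V > 2 * \<bar>of_int B\<bar> / c" using elim by (simp add: V_def)
    have V0: "V \<ge> 0" by (simp add: V_def)
    have "K * (\<bar>\<epsilon> r\<bar> * V) \<le> c / 2 * V"
    proof -
      have "K * \<bar>\<epsilon> r\<bar> \<le> c / 2" using elim(3) K by (simp add: field_simps)
      from mult_right_mono[OF this V0] show ?thesis by (simp add: mult.assoc)
    qed
    hence "\<bar>of_int (zero_count f r) - c * V\<bar> \<le> c / 2 * V"
      using elim(2) V0 by (simp add: abs_mult V_def)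
    hence "c / 2 * V \<le> of_int (zero_count f r)" by linarith
    also have "\<dots> \<le> \<bar>of_int B\<bar>" using zB[of r] by linarith
    finally show ?case using V c by (simp add: field_simps)
  qed
  thus False by simp
qed

lemma powr_le_add_powr:
  fixes x k l b :: real
  assumes "x > 0" "l \<le> k" "k \<le> b"
  shows "x powr k \<le> x powr l + x powr b"
proof (cases "x \<ge> 1")
  case True
  hence "x powr k \<le> x powr b" using assms by (intro powr_mono) auto
  thus ?thesis by (simp add: add_increasing)
next
  case False
  hence "x powr k \<le> x powr l" using assms by (intro powr_mono') auto
  thus ?thesis by (simp add: add_increasing2)
qed

lemma ln_norm_product_eq_suminf:
  assumes P: "(\<lambda>N. \<Prod>n<N. F n) \<longlonglongrightarrow> (P::complex)" and nz: "\<And>n. F n \<noteq> 0" "P \<noteq> 0"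
  shows "(\<lambda>n. ln (norm (F n))) sums ln (norm P)"
proof -
  have "(\<lambda>N. ln (norm (\<Prod>n<N. F n))) \<longlonglongrightarrow> ln (norm P)"
    using nz by (intro tendsto_intros P) auto
  moreover have "ln (norm (\<Prod>n<N. F n)) = (\<Sum>n<N. ln (norm (F n)))" for N
    using nz by (simp add: prod_norm[symmetric] ln_prod)
  ultimately show ?thesis by (simp add: sums_def)
qed

theorem theorem1p5:
  fixes f :: "complex \<Rightarrow> complex" and \<rho> c :: real and \<sigma> \<epsilon> :: "real \<Rightarrow> real" and L :: nat
  assumes "f holomorphic_on UNIV"
    and "entire_order f = ereal \<rho>" and "0 < \<rho>" and "\<rho> \<notin> \<nat>"
    and "L \<ge> 1" and "\<epsilon> = iter_log_recip L"
    and "finite {z. f z = 0 \<and> z \<notin> thin_region L}"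
    and "c > 0" and "proximate_order \<sigma> \<rho>"
    and "(\<lambda>r. \<bar>of_int (zero_count f r) - c * r powr \<sigma> r\<bar>)
           \<in> O[at_top](\<lambda>r. \<epsilon> r * r powr \<sigma> r)"
    and "(\<lambda>r. deriv \<sigma> r * r * ln r) \<in> O[at_top](\<epsilon>)"
  shows "\<exists>C. \<forall>\<^sub>F r in at_top. \<forall>\<theta>. sqrt (\<epsilon> r) \<le> \<theta> \<and> \<theta> \<le> 2 * pi - sqrt (\<epsilon> r) \<longrightarrow>
           f (of_real r * cis \<theta>) \<noteq> 0 \<and>
           \<bar>ln (norm (f (of_real r * cis \<theta>)))
              - c * (pi * cos ((\<theta> - pi) * \<sigma> r) / sin (pi * \<sigma> r)) * r powr \<sigma> r\<bar>
             \<le> C * (root 4 (\<epsilon> r) * r powr \<sigma> r)"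
proof -
  note holf = assms(1) and prox = assms(9)
  define p where "p = nat \<lfloor>\<rho>\<rfloor>"
  have rp: "real p = of_int \<lfloor>\<rho>\<rfloor>" using assms(3) by (simp add: p_def)
  have "real p \<noteq> \<rho>" using assms(4) by (metis of_nat_in_Nats)
  hence p: "real p < \<rho>" "\<rho> < real p + 1" unfolding rp by linarith+
  \<comment> \<open>The factor \<open>1/3\<close> leaves room for both \<open>p + \<delta> < \<rho> - \<delta>\<close> and \<open>\<rho> + \<delta> < p + 1\<close>.\<close>
  define \<delta> where "\<delta> = min (\<rho> - real p) (real p + 1 - \<rho>) / 3"
  have "3 * \<delta> \<le> \<rho> - real p" "3 * \<delta> \<le> real p + 1 - \<rho>" "\<delta> > 0"
    using p by (auto simp: \<delta>_def)
  hence \<delta>: "\<delta> > 0" "real p + \<delta> < \<rho> - \<delta>" "real p < \<rho> - 2 * \<delta>" "\<rho> + \<delta> < real p + 1" "\<delta> < \<rho>" by linarith+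
  define \<alpha> where "\<alpha> = \<rho> - \<delta>"
  define \<beta> where "\<beta> = \<rho> + \<delta>"
  have ab: "real p + \<delta> < \<alpha>" "\<alpha> \<le> \<beta>" "\<beta> < real p + 1" "real p < \<alpha>" "\<alpha> < real p + 1" "real p < \<beta>" "\<rho> < \<beta>" "\<beta> > 0"
    unfolding \<alpha>_def \<beta>_def using \<delta> p by linarith+
  define V where "V = (\<lambda>r. r powr \<sigma> r)"
  have V0: "V r \<ge> 0" for r by (simp add: V_def)
  have gauge: "slow_gauge \<epsilon>" unfolding assms(6) by (rule slow_gauge_iter_log_recip[OF assms(5)])
  obtain Ra where Ra: "Ra > 0" "\<And>r. r \<ge> Ra \<Longrightarrow> 0 < \<epsilon> r" "\<And>r s. r \<ge> Ra \<Longrightarrow> s \<ge> r \<Longrightarrow> \<epsilon> s \<le> \<epsilon> r"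
    by (rule slow_gaugeE[OF gauge]) (rule that)
  have O: "(\<lambda>r. of_int (zero_count f r) - c * r powr \<sigma> r) \<in> O[at_top](\<lambda>r. \<epsilon> r * r powr \<sigma> r)"
    using assms(10) by simp
  obtain w where w: "f w \<noteq> 0" using exists_nonzero_if_zeros_thin[OF assms(7)] by blast
  have inf: "infinite {z. f z = 0}"
    by (rule infinite_zeros_if_zero_count_asymp[OF gauge prox assms(8) O])
  obtain a :: "nat \<Rightarrow> complex" where rng: "range a = {z. f z = 0} - {0}" and lim: "filterlim a at_infinity sequentially"
    and mult: "\<And>z. f z = 0 \<Longrightarrow> z \<noteq> 0 \<Longrightarrow> finite (a -` {z}) \<and> int (card (a -` {z})) = zorder f z"
    by (rule entire_zero_sequence[OF holf w inf]) (rule that)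
  define s where "s = (\<lambda>n. norm (a n))"
  have a0: "a n \<noteq> 0" for n using rng by blast
  have s0: "s n > 0" for n using a0 by (simp add: s_def)
  have slim: "filterlim s at_top sequentially"
    unfolding s_def by (rule filterlim_at_infinity_imp_norm_at_top[OF lim])
  have "\<exists>t0>0. \<forall>n. t0 \<le> s n"
  proof -
    define J where "J = {n. s n \<le> 1}"
    have J: "finite J" unfolding J_def by (rule finite_le_if_at_top[OF slim])
    define t0 where "t0 = Min (insert 1 (s ` J))"
    have "t0 > 0" unfolding t0_def using J s0 by (subst Min_gr_iff) auto
    moreover have "t0 \<le> s n" for n
    proof (cases "n \<in> J")
      case True thus ?thesis unfolding t0_def using J by (intro Min_le) auto
    next
      case False
      have "t0 \<le> 1" unfolding t0_def using J by (intro Min_le) auto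
      thus ?thesis using False by (simp add: J_def)
    qed
    ultimately show ?thesis by blast
  qed
  then obtain t0 where t0: "t0 > 0" "\<And>n. t0 \<le> s n" by blast
  \<comment> \<open>A zero at the origin is counted by \<open>zero_count\<close> but is not a member of the sequence.\<close>
  define m0 :: real where "m0 = of_int (if f 0 = 0 then zorder f 0 else 0)"
  have zc: "of_int (zero_count f r) = counting s r + m0" if "r \<ge> 0" for r
    unfolding s_def m0_def by (rule zero_count_eq_counting[OF holf w inf rng mult that])
  have nO: "(\<lambda>r. counting s r - c * r powr \<sigma> r) \<in> O[at_top](\<lambda>r. \<epsilon> r * r powr \<sigma> r)"
  proof -
    have "\<forall>\<^sub>F r in at_top. r powr 0 \<le> \<epsilon> r * r powr \<sigma> r"
      by (rule gauge_times_proximate_power_ge[OF prox gauge assms(3)])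
    hence "\<forall>\<^sub>F r in at_top. norm m0 \<le> \<bar>m0\<bar> * norm (\<epsilon> r * r powr \<sigma> r)"
      using eventually_gt_at_top[of 0]
    proof eventually_elim
      case (elim r)
      have "\<bar>m0\<bar> * 1 \<le> \<bar>m0\<bar> * norm (\<epsilon> r * r powr \<sigma> r)" using elim by (intro mult_left_mono) auto
      thus ?case by simp
    qed
    hence "(\<lambda>_. m0) \<in> O[at_top](\<lambda>r. \<epsilon> r * r powr \<sigma> r)" by (rule bigoI)
    from sum_in_bigo(2)[OF O this]
    have "(\<lambda>r. of_int (zero_count f r) - c * r powr \<sigma> r - m0) \<in> O[at_top](\<lambda>r. \<epsilon> r * r powr \<sigma> r)" .
    also have "?this \<longleftrightarrow> ?thesis"
      by (intro landau_o.big.in_cong eventually_mono[OF eventually_ge_at_top[of 0]]) (simp add: zc)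
    finally show ?thesis .
  qed
  have vanish: "counting s t = 0" if "t < t0" for t
  proof -
    have "{n. s n \<le> t} = {}" using t0(2) that by (force simp: not_le intro: less_le_trans)
    thus ?thesis by (simp add: counting_def)
  qed
  obtain K where K: "K \<ge> 0" and cmp: "\<forall>\<^sub>F r in at_top. \<forall>x>0.
     \<bar>counting s (r * x) - c * r powr \<sigma> r * x powr \<sigma> r\<bar> \<le> K * \<epsilon> r * r powr \<sigma> r * (x powr (\<rho> - \<delta>) + x powr (\<rho> + \<delta>))"
    using counting_comparison[OF prox gauge assms(11) counting_nonneg mono_counting[OF slim] t0(1) vanish nO assms(8) \<delta>(1,5)]
    by blast
  have small: "\<forall>\<^sub>F r in at_top. \<bar>\<epsilon> r\<bar> < 1 / 16" by (rule slow_gauge_eventually_less[OF gauge]) simp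
  have \<sigma>lim: "(\<sigma> \<longlongrightarrow> \<rho>) at_top" using prox unfolding proximate_order_def by iprover
  have e6: "\<forall>\<^sub>F r in at_top. \<bar>\<sigma> r - \<rho>\<bar> < \<delta>" using tendstoD[OF \<sigma>lim \<delta>(1)] by (simp add: dist_real_def)
  have "\<exists>M. \<forall>y>0. counting s y \<le> M * (y powr \<alpha> + y powr \<beta>)"
  proof -
    from eventually_happens'[OF trivial_limit_at_top_linorder eventually_conj[OF eventually_gt_at_top[of 0] eventually_conj[OF e6 cmp]]]
    obtain r where r: "r > 0" "\<bar>\<sigma> r - \<rho>\<bar> < \<delta>" and cr: "\<And>x. x > 0 \<Longrightarrow>
      \<bar>counting s (r * x) - c * r powr \<sigma> r * x powr \<sigma> r\<bar> \<le> K * \<epsilon> r * r powr \<sigma> r * (x powr (\<rho> - \<delta>) + x powr (\<rho> + \<delta>))"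
      by auto
    define B where "B = c * r powr \<sigma> r + \<bar>K * \<epsilon> r * r powr \<sigma> r\<bar>"
    have B0: "B \<ge> 0" using assms(8) by (simp add: B_def)
    have "counting s y \<le> (B * (r powr - \<alpha> + r powr - \<beta>)) * (y powr \<alpha> + y powr \<beta>)" if y: "y > 0" for y
    proof -
      define x where "x = y / r"
      have x: "x > 0" "r * x = y" using r y by (auto simp: x_def)
      define E where "E = x powr \<alpha> + x powr \<beta>"
      have "c * r powr \<sigma> r * x powr \<sigma> r \<le> c * r powr \<sigma> r * E"
        unfolding E_def using r x assms(8) by (intro mult_left_mono powr_le_add_powr) (auto simp: \<alpha>_def \<beta>_def)
      moreover have "K * \<epsilon> r * r powr \<sigma> r * E \<le> \<bar>K * \<epsilon> r * r powr \<sigma> r\<bar> * E"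
        by (intro mult_right_mono) (auto simp: E_def)
      ultimately have "counting s y \<le> B * E"
        using cr[OF x(1)] unfolding x(2) E_def \<alpha>_def \<beta>_def B_def distrib_right by linarith
      also have "E = r powr - \<alpha> * y powr \<alpha> + r powr - \<beta> * y powr \<beta>"
        using r y by (simp add: E_def x_def powr_divide powr_minus field_simps)
      also have "B * \<dots> \<le> B * ((r powr - \<alpha> + r powr - \<beta>) * (y powr \<alpha> + y powr \<beta>))"
        using B0 by (intro mult_left_mono) (auto simp: algebra_simps)
      finally show ?thesis by (simp only: mult.assoc)
    qed
    thus ?thesis by blast
  qed
  then obtain M where M: "\<And>y. y > 0 \<Longrightarrow> counting s y \<le> M * (y powr \<alpha> + y powr \<beta>)" by blast
  have summ: "summable (\<lambda>n. (r / norm (a n)) ^ Suc p)" if r: "r > 0" for r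
  proof -
    have "summable (\<lambda>n. s n powr - real p / (1 + s n))"
      by (rule sum_power_kernel(1)[OF _ _ _ _ _ slim s0 M]) (use ab in auto)
    hence sm: "summable (\<lambda>n. r ^ Suc p * (1 + 1 / t0) * (s n powr - real p / (1 + s n)))"
      by (intro summable_mult)
    show ?thesis
    proof (rule summable_comparison_test'[OF sm])
      fix n
      define \<kappa> where "\<kappa> = s n powr - real p / (1 + s n)"
      have \<kappa>0: "\<kappa> \<ge> 0" using s0[of n] by (simp add: \<kappa>_def)
      have ne: "1 + 1 / s n > 0" using s0[of n] by (simp add: add_pos_pos)
      have K: "(1 / s n) ^ Suc p = \<kappa> * (1 + 1 / s n)"
        using inverse_power_kernel[OF s0, of n p] ne unfolding \<kappa>_def by (metis less_numeral_extra(3) nonzero_divide_eq_eq)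
      have "norm ((r / norm (a n)) ^ Suc p) = r ^ Suc p * (1 / s n) ^ Suc p"
        using r s0[of n] unfolding s_def by (simp add: power_divide)
      also have "\<dots> = r ^ Suc p * (\<kappa> * (1 + 1 / s n))" unfolding K ..
      also have "\<dots> \<le> r ^ Suc p * (\<kappa> * (1 + 1 / t0))"
        using r \<kappa>0 t0 s0[of n] by (intro mult_left_mono add_left_mono divide_left_mono) auto
      finally show "norm ((r / norm (a n)) ^ Suc p) \<le> r ^ Suc p * (1 + 1 / t0) * (s n powr - real p / (1 + s n))"
        by (simp only: \<kappa>_def mult_ac)
    qed
  qed
  obtain m g P where g: "g holomorphic_on UNIV" and fact: "\<And>z. f z = z ^ m * exp (g z) * P z"
    and P: "\<And>z. (\<lambda>N. \<Prod>n<N. weierstrass_factor p (z / a n)) \<longlonglongrightarrow> P z"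
    by (rule entire_canonical_factorization[OF holf w rng lim conjunct2[OF mult] summ]) (assumption, assumption, assumption, rule that)
  obtain Cg where Cg: "\<And>z. norm z \<ge> 1 \<Longrightarrow> norm (g z) \<le> Cg * norm z ^ p"
    using exp_factor_growth[OF fact g P a0 slim[unfolded s_def] ab(4,2,3) M[unfolded s_def]
        entire_order_growth[OF holf assms(2) ab(7)]] by blast
  have "range a - thin_region L \<subseteq> {z. f z = 0 \<and> z \<notin> thin_region L}" using rng by blast
  hence fin: "finite (range a - thin_region L)" using assms(7) finite_subset by blast
  have e1: "\<forall>\<^sub>F r in at_top. iter_log_recip L r \<le> 1"
    using small unfolding assms(6) by (rule eventually_mono) simp
  obtain R \<phi> where \<phi>: "\<And>n. a n = of_real (s n) * cis (\<phi> n)" "\<And>n. \<bar>\<phi> n\<bar> \<le> pi"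
      "\<And>n. s n \<ge> R \<Longrightarrow> \<bar>\<phi> n\<bar> \<le> \<epsilon> (s n)"
    using zeros_polar_angles[OF fin e1] unfolding s_def assms(6) by blast
  define Krot where "Krot = 16 * (2 powr (real p + 2) * kernel_mass (real p) \<alpha> \<beta>)
            + 3 * pi * (2 powr (real p + \<delta> + 2) * kernel_mass (real p + \<delta>) \<alpha> \<beta>)"
  define C where "C = 1 + (c + K) * Krot + 4 * K * kernel_mass (real p) \<alpha> \<beta>"
  have km: "kernel_mass (real p) \<alpha> \<beta> > 0" "kernel_mass (real p + \<delta>) \<alpha> \<beta> > 0"
    using ab \<delta>(1) by (auto intro!: kernel_mass_pos)
  have Krot: "Krot \<ge> 0" unfolding Krot_def using km by (intro add_nonneg_nonneg mult_nonneg_nonneg) auto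
  have C0: "C \<ge> 0" unfolding C_def using K Krot km assms(8) by (intro add_nonneg_nonneg mult_nonneg_nonneg) auto
  have rest: "\<forall>\<^sub>F r in at_top. real m * ln r + Cg * r ^ p \<le> \<epsilon> r * V r"
  proof -
    \<comment> \<open>Any exponent strictly between \<open>p\<close> and \<open>\<rho>\<close> dominates the left-hand side and stays below \<open>\<epsilon> V\<close>.\<close>
    define q where "q = \<rho> - 2 * \<delta>"
    have q: "q > real p" "q < \<rho>" "q > 0" unfolding q_def using \<delta> by linarith+
    have "((\<lambda>r. real m * (ln r / r powr q) + Cg * (r powr real p / r powr q)) \<longlongrightarrow> real m * 0 + Cg * 0) at_top"
    proof (intro tendsto_intros)
      show "((\<lambda>r. ln r / r powr q) \<longlongrightarrow> 0) at_top" using q by real_asymp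
      show "((\<lambda>r. r powr real p / r powr q) \<longlongrightarrow> 0) at_top" using q by real_asymp
    qed
    hence "\<forall>\<^sub>F r in at_top. real m * (ln r / r powr q) + Cg * (r powr real p / r powr q) < 1"
      by (intro order_tendstoD(2)) auto
    thus ?thesis using gauge_times_proximate_power_ge[OF prox gauge q(2)] eventually_gt_at_top[of 0]
    proof eventually_elim
      case (elim r)
      have "real m * ln r + Cg * r ^ p = (real m * (ln r / r powr q) + Cg * (r powr real p / r powr q)) * r powr q"
        using elim(3) by (simp add: distrib_right powr_realpow)
      also have "\<dots> \<le> 1 * r powr q" using elim by (intro mult_right_mono) auto
      finally show ?case using elim(2) by (simp add: V_def)
    qed
  qed
  have e4: "\<forall>\<^sub>F r in at_top. r powr - (\<delta> / 2) \<le> \<epsilon> r" using \<delta>(1) by (intro slow_gauge_power[OF gauge]) simp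
  have "\<forall>\<^sub>F r in at_top. \<forall>\<theta>. sqrt (\<epsilon> r) \<le> \<theta> \<and> \<theta> \<le> 2 * pi - sqrt (\<epsilon> r) \<longrightarrow>
           f (of_real r * cis \<theta>) \<noteq> 0 \<and>
           \<bar>ln (norm (f (of_real r * cis \<theta>)))
              - c * (pi * cos ((\<theta> - pi) * \<sigma> r) / sin (pi * \<sigma> r)) * r powr \<sigma> r\<bar>
             \<le> C * (root 4 (\<epsilon> r) * r powr \<sigma> r)"
    using cmp small slow_gauge_sqrt[OF gauge] e4 e6 rest eventually_ge_at_top[of "max 4 ((max R Ra)\<^sup>2)"]
  proof eventually_elim
    case (elim r)
    have r4: "r \<ge> 4" and rR: "r \<ge> (max R Ra)\<^sup>2" using elim(7) by auto
    have sq: "sqrt r \<ge> R" "sqrt r \<ge> Ra" using real_le_rsqrt[OF rR] by auto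
    have sq2: "sqrt r \<ge> 2" using r4 by (intro real_le_rsqrt) simp
    have "sqrt r * 1 \<le> sqrt r * sqrt r" using sq2 r4 by (intro mult_left_mono) auto
    hence rRa: "r \<ge> Ra" using sq(2) r4 by simp
    define \<eta> where "\<eta> = sqrt (\<epsilon> r)"
    have \<epsilon>0: "\<epsilon> r > 0" using Ra(2)[OF rRa] .
    have \<eta>2: "\<eta>\<^sup>2 = \<epsilon> r" using \<epsilon>0 by (simp add: \<eta>_def)
    have \<eta>: "0 < \<eta>" "\<eta> \<le> 1 / 4"
    proof -
      show "0 < \<eta>" using \<epsilon>0 by (simp add: \<eta>_def)
      show "\<eta> \<le> 1 / 4" unfolding \<eta>_def using elim(2) by (intro real_le_lsqrt) (auto simp: power2_eq_square)
    qed
    have \<epsilon>\<eta>: "\<epsilon> r \<le> \<eta>" using mult_left_mono[of \<eta> 1 \<eta>] \<eta> unfolding \<eta>2[symmetric] by (simp add: power2_eq_square)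
    have \<sigma>: "\<alpha> \<le> \<sigma> r" "\<sigma> r \<le> \<beta>" using elim(5) by (auto simp: \<alpha>_def \<beta>_def)
    define x where "x = (\<lambda>n. s n / r)"
    have x0: "x n > 0" for n using s0[of n] r4 by (simp add: x_def)
    have xlim: "filterlim x at_top sequentially"
      unfolding x_def divide_inverse using r4
      by (intro filterlim_at_top_mult_tendsto_pos[OF tendsto_const _ slim]) auto
    have cx: "counting x y = counting s (r * y)" for y
      unfolding x_def using r4 by (intro counting_scale) simp
    have B: "\<bar>counting x y - (c * V r) * y powr \<sigma> r\<bar> \<le> (K * \<epsilon> r * V r) * (y powr \<alpha> + y powr \<beta>)" if "y > 0" for y
      using elim(1) that unfolding cx V_def \<alpha>_def \<beta>_def by simp
    have cb: "counting x y \<le> ((c + K) * V r) * (y powr \<alpha> + y powr \<beta>)" if y: "y > 0" for y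
    proof -
      have "y powr \<sigma> r \<le> y powr \<alpha> + y powr \<beta>" using y \<sigma> by (rule powr_le_add_powr)
      hence "(c * V r) * y powr \<sigma> r \<le> (c * V r) * (y powr \<alpha> + y powr \<beta>)"
        using assms(8) V0 by (intro mult_left_mono) auto
      moreover have "(K * \<epsilon> r * V r) * (y powr \<alpha> + y powr \<beta>) \<le> (K * 1 * V r) * (y powr \<alpha> + y powr \<beta>)"
        using K V0 \<epsilon>\<eta> \<eta> by (intro mult_right_mono mult_left_mono) auto
      ultimately have "counting x y \<le> (c * V r) * (y powr \<alpha> + y powr \<beta>) + (K * 1 * V r) * (y powr \<alpha> + y powr \<beta>)"
        using B[OF y] by linarith
      thus ?thesis by (simp add: distrib_right)
    qed
    \<comment> \<open>Zeros of modulus at least \<open>sqrt r\<close> have angle at most \<open>\<epsilon>(sqrt r) \<le> 2 \<epsilon>(r)\<close>; for the others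
        \<open>x n < 1/sqrt r\<close>.\<close>
    have near: "\<bar>\<phi> n\<bar> \<le> 2 * \<eta>\<^sup>2 \<or> x n \<le> 1 / 2 \<and> \<bar>\<phi> n\<bar> \<le> pi \<and> x n powr \<delta> \<le> \<eta>" for n
    proof (cases "s n \<ge> sqrt r")
      case True
      have "\<bar>\<phi> n\<bar> \<le> \<epsilon> (s n)" using True sq by (intro \<phi>(3)) simp
      also have "\<dots> \<le> \<epsilon> (sqrt r)" using True sq by (intro Ra(3)) auto
      also have "\<dots> \<le> 2 * \<eta>\<^sup>2" using elim(3) \<eta>2 by simp
      finally show ?thesis by blast
    next
      case False
      have "x n \<le> sqrt r / r" unfolding x_def using False r4 by (intro divide_right_mono) auto
      also have "sqrt r / r = 1 / sqrt r" using r4 by (simp add: real_div_sqrt field_simps)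
      finally have x1: "x n \<le> 1 / sqrt r" .
      also have "\<dots> \<le> 1 / 2" using sq2 r4 by (intro divide_left_mono) auto
      finally have x2: "x n \<le> 1 / 2" .
      have "x n powr \<delta> \<le> (1 / sqrt r) powr \<delta>" using x1 x0[of n] \<delta>(1) by (intro powr_mono2) auto
      also have "1 / sqrt r = r powr - (1 / 2)" 
      proof -
        have "r powr (1 / 2) = sqrt r" using r4 by (intro powr_half_sqrt) simp
        thus ?thesis by (simp only: powr_minus inverse_eq_divide)
      qed
      also have "\<dots> powr \<delta> = r powr - (\<delta> / 2)" by (simp add: powr_powr)
      also have "\<dots> \<le> \<eta>" using elim(4) \<epsilon>\<eta> by linarith
      finally have "x n powr \<delta> \<le> \<eta>" .
      thus ?thesis using x2 \<phi>(2)[of n] by simp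
    qed
    show ?case
    proof (intro allI impI)
      fix \<theta> assume "sqrt (\<epsilon> r) \<le> \<theta> \<and> \<theta> \<le> 2 * pi - sqrt (\<epsilon> r)"
      hence \<theta>: "\<eta> \<le> \<theta>" "\<theta> \<le> 2 * pi - \<eta>" by (auto simp: \<eta>_def)
      define z where "z = of_real r * cis \<theta>"
      have nz: "norm z = r" using r4 by (simp add: z_def norm_mult)
      define d where "d = (\<lambda>n. log_factor p (cis (\<theta> - \<phi> n) / of_real (x n))
                   - log_factor p (cis \<theta> / of_real (x n)))"
      note rot = sum_rotation_estimate[OF xlim x0 cb ab(1,2,3) \<delta>(1) \<eta> \<theta> near]
      have rot2: "summable (\<lambda>n. \<bar>d n\<bar>)" unfolding d_def by (rule rot(2))
      have rot3: "(\<Sum>n. \<bar>d n\<bar>) \<le> \<eta> * ((c + K) * V r) * Krot" unfolding d_def Krot_def by (rule rot(3))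
      have za: "z / a n = cis (\<theta> - \<phi> n) / of_real (x n)" for n
        by (subst \<phi>(1)) (simp add: z_def x_def cis_divide[symmetric] mult.commute)
      have zne: "z / a n \<noteq> 1" for n unfolding za by (rule rot(1))
      have "z \<notin> range a" using zne a0 by auto
      moreover have z0: "z \<noteq> 0" using nz r4 by auto
      ultimately have fz: "f z \<noteq> 0" using rng by blast
      hence Pz: "P z \<noteq> 0" using fact[of z] by auto
      have logP: "(\<lambda>n. log_factor p (z / a n)) sums ln (norm (P z))"
        using zne Pz by (intro ln_norm_product_eq_suminf P) auto
      have logf: "ln (norm (f z)) = real m * ln r + Re (g z) + ln (norm (P z))"
        using z0 Pz nz r4 by (simp add: fact norm_mult norm_power ln_mult ln_realpow)
      have \<theta>': "0 < \<theta>" "\<theta> < 2 * pi" using \<theta> \<eta> by auto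
      have \<sigma>': "real p < \<sigma> r" "\<sigma> r < real p + 1" using \<sigma> ab by auto
      define H where "H = pi * cos ((\<theta> - pi) * \<sigma> r) / sin (pi * \<sigma> r)"
      define T where "T = (\<Sum>n. log_factor p (cis \<theta> / of_real (x n)))"
      note pot = log_potential_asymp[OF ab(4,5,6,3) \<sigma>' xlim x0 \<theta>' B, folded T_def H_def]
      \<comment> \<open>\<open>T\<close> is the sum for the zeros moved to the positive half-line.\<close>
      have PT: "\<bar>ln (norm (P z)) - T\<bar> \<le> \<eta> * ((c + K) * V r) * Krot"
      proof -
        have "(\<lambda>n. log_factor p (z / a n) - log_factor p (cis \<theta> / of_real (x n))) sums (ln (norm (P z)) - T)"
          unfolding T_def by (intro sums_diff logP summable_sums pot(1))
        hence ds: "d sums (ln (norm (P z)) - T)" by (simp add: d_def za)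
        hence "\<bar>ln (norm (P z)) - T\<bar> = \<bar>\<Sum>n. d n\<bar>" by (simp add: sums_iff)
        also have "\<dots> \<le> (\<Sum>n. \<bar>d n\<bar>)" by (rule summable_rabs[OF rot2])
        also have "\<dots> \<le> \<eta> * ((c + K) * V r) * Krot" by (rule rot3)
        finally show ?thesis .
      qed
      have Tm: "\<bar>T - c * V r * H\<bar> \<le> 4 * K * kernel_mass (real p) \<alpha> \<beta> * (\<eta> * V r)"
      proof -
        have "\<eta> / 4 \<le> sin (\<theta> / 2)" using \<theta> \<eta> by (intro sin_half_lower) auto
        hence "K * \<epsilon> r * V r * kernel_mass (real p) \<alpha> \<beta> / sin (\<theta> / 2) \<le> K * \<epsilon> r * V r * kernel_mass (real p) \<alpha> \<beta> / (\<eta> / 4)"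
          using K V0[of r] \<epsilon>0 km \<eta> by (intro divide_left_mono mult_nonneg_nonneg mult_pos_pos) auto
        also have "\<dots> = 4 * K * kernel_mass (real p) \<alpha> \<beta> * (\<eta> * V r)"
          unfolding \<eta>2[symmetric] using \<eta> by (simp add: power2_eq_square)
        finally show ?thesis using pot(2) by linarith
      qed
      have ge: "\<bar>real m * ln r + Re (g z)\<bar> \<le> \<eta> * V r"
      proof -
        have "\<bar>Re (g z)\<bar> \<le> Cg * r ^ p" using Cg[of z] abs_Re_le_cmod[of "g z"] nz r4 by simp
        moreover have "real m * ln r \<ge> 0" using r4 by simp
        moreover have "\<epsilon> r * V r \<le> \<eta> * V r" using \<epsilon>\<eta> V0 by (intro mult_right_mono)
        ultimately show ?thesis using elim(6) by linarith
      qed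
      have "\<bar>ln (norm (f z)) - c * V r * H\<bar>
         \<le> \<eta> * V r + \<eta> * ((c + K) * V r) * Krot + 4 * K * kernel_mass (real p) \<alpha> \<beta> * (\<eta> * V r)"
        using ge PT Tm unfolding logf by linarith
      also have "\<dots> = C * (\<eta> * V r)" by (simp add: C_def algebra_simps)
      also have "\<dots> \<le> C * (root 4 (\<epsilon> r) * V r)"
      proof -
        have "root 4 (\<epsilon> r) = sqrt \<eta>"
          unfolding \<eta>_def sqrt_def by (subst real_root_mult_exp[symmetric]) simp
        moreover have "\<eta> \<le> sqrt \<eta>" using \<eta> by (intro real_le_rsqrt) (simp add: power2_eq_square mult_left_le)
        ultimately show ?thesis using C0 V0 by (intro mult_left_mono mult_right_mono) auto
      qed
      finally show "f (of_real r * cis \<theta>) \<noteq> 0 \<and>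
           \<bar>ln (norm (f (of_real r * cis \<theta>)))
              - c * (pi * cos ((\<theta> - pi) * \<sigma> r) / sin (pi * \<sigma> r)) * r powr \<sigma> r\<bar>
             \<le> C * (root 4 (\<epsilon> r) * r powr \<sigma> r)"
        using fz by (simp add: z_def V_def H_def mult_ac)
    qed
  qed
  thus ?thesis by blast
qed

end
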